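(* Let $g,n$ be non-negative integers with $2g-2+n>0$ and $3g-3+n>0$. If $(g,n)\neq(0,4)$ and $(g,n)\neq(0,5)$, then the space $\Delta_{g,n}$, i.e. the moduli space of stable tropical curves of genus $g$ with $n$ marked points and volume $1$, is simply connected.
   Context: All graphs are finite and connected, and may have loops and multiple edges; $V(G)$ and $E(G)$ denote the vertex and edge sets. An $n$-marked weighted graph is a triple $(G,w,m)$ with weights $w\colon V(G)\to\mathbb{Z}_{\ge 0}$ and a marking function $m\colon\{1,\dots,n\}\to V(G)$. Its genus is $h^1(G)+\sum_{v\in V(G)}w(v)$, where $h^1(G)=|E(G)|-|V(G)|+1$. It is stable if every vertex $v$ with $w(v)=0$ satisfies: (valence of $v$) $+\,|m^{-1}(v)|\ge 3$ (loops count twice in the valence). A stable tropical curve of genus $g$ with $n$ marked points is a stable $n$-marked weighted graph of genus $g$ together with a length $\ell(e)>0$ for each edge; its volume is $\sum_e\ell(e)$. Contracting an edge $e$: if $e$ is not a loop, its two endpoints are identified, and the new vertex gets the sum of their weights and all of their markings; if $e$ is a loop at $v$, it is deleted and $w(v)$ is increased by $1$. Contraction preserves genus and stability. For $2g-2+n>0$ and $3g-3+n>0$, the points of $\Delta_{g,n}$ are the isomorphism classes of stable tropical curves of genus $g$ with $n$ marked points and volume $1$; it is the link of the cone point in the moduli space $M_{g,n}^{\mathrm{trop}}$. As a topological space it is the following. Let $[p]=\{0,\dots,p\}$ and let $\Delta^p$ be the standard $p$-simplex with vertices indexed by $[p]$. For $p\ge0$ let $X_p$ be the set of isomorphism classes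 of pairs $(\mathbf G,\tau)$ with $\mathbf G$ a stable $n$-marked weighted graph of genus $g$ having $p+1$ edges and $\tau\colon E(G)\to[p]$ a bijection. For an injection $\theta\colon[p]\to[q]$ let $\theta^*\colon X_q\to X_p$ send $(\mathbf G,\tau)$ to the graph obtained by contracting all edges $e$ with $\tau(e)\notin\theta([p])$, with edge labelling $\theta^{-1}\circ\tau$ on the remaining edges; let $\theta_*\colon\Delta^p\to\Delta^q$ be the induced inclusion of simplices. Then $$\Delta_{g,n}=\Big(\coprod_{p\ge0}X_p\times\Delta^p\Big)\big/\sim,$$ where $X_p$ is discrete and $\sim$ is the equivalence relation generated by $(x,\theta_*a)\sim(\theta^*x,a)$ for all injections $\theta\colon[p]\to[q]$, $x\in X_q$, $a\in\Delta^p$. The point $((\mathbf G,\tau),a)$ corresponds to the tropical curve with lengths $\ell(e)=a_{\tau(e)}$, edges of length $0$ being contracted. *)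

theory Defs
  imports "HOL-Analysis.Analysis" "HOL-Homology.Simplices"
begin

section \<open>Marked weighted graphs\<close>

text \<open>
  Vertices and edges are natural numbers, which is no restriction since finite graphs are only
  considered up to isomorphism. \<open>ends e\<close> is the set of endpoints of \<open>e\<close>: a singleton for a loop,
  a two-element set otherwise. The fields \<open>ends\<close>, \<open>weight\<close>, \<open>mark\<close> are meaningful only on
  \<open>edges\<close>, \<open>verts\<close> and \<open>{1..n}\<close> respectively; graph isomorphism ignores their other values.
\<close>

record mwgraph =
  verts :: "nat set"
  edges :: "nat set"
  ends :: "nat \<Rightarrow> nat set"
  weight :: "nat \<Rightarrow> nat"
  mark :: "nat \<Rightarrow> nat"

definition adjacency :: "mwgraph \<Rightarrow> (nat \<times> nat) set" where
  "adjacency G = {(u, v). \<exists>e \<in> edges G. ends G e = {u, v}}"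

definition marked_weighted_graph :: "nat \<Rightarrow> mwgraph \<Rightarrow> bool" where
  "marked_weighted_graph n G \<longleftrightarrow>
     finite (verts G) \<and> verts G \<noteq> {} \<and> finite (edges G) \<and>
     (\<forall>e \<in> edges G. ends G e \<subseteq> verts G \<and> card (ends G e) \<in> {1, 2}) \<and>
     (\<forall>u \<in> verts G. \<forall>v \<in> verts G. (u, v) \<in> (adjacency G)\<^sup>*) \<and>
     (\<forall>i \<in> {1..n}. mark G i \<in> verts G)"

definition genus :: "mwgraph \<Rightarrow> int" where
  "genus G = (int (card (edges G)) - int (card (verts G)) + 1) + (\<Sum>v \<in> verts G. int (weight G v))"

definition valence :: "mwgraph \<Rightarrow> nat \<Rightarrow> nat" where
  "valence G v = (\<Sum>e \<in> {e \<in> edges G. v \<in> ends G e}. if ends G e = {v} then 2 else 1)"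

definition stable_graph :: "nat \<Rightarrow> nat \<Rightarrow> mwgraph \<Rightarrow> bool" where
  "stable_graph g n G \<longleftrightarrow>
     marked_weighted_graph n G \<and> genus G = int g \<and>
     (\<forall>v \<in> verts G. weight G v = 0 \<longrightarrow> valence G v + card {i \<in> {1..n}. mark G i = v} \<ge> 3)"

section \<open>Contraction\<close>

text \<open>
  All endpoints of \<open>e\<close> are replaced by the smallest one. This treats both kinds of edges: for
  a loop at \<open>v\<close> nothing is identified, and the weight of \<open>v\<close> becomes \<open>weight G v + 1\<close>.
\<close>

definition contract_edge :: "nat \<Rightarrow> mwgraph \<Rightarrow> mwgraph" where
  "contract_edge e G =
     (let a = Min (ends G e); r = (\<lambda>v. if v \<in> ends G e then a else v) in
      \<lparr> verts = r ` verts G,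
        edges = edges G - {e},
        ends = (\<lambda>f. r ` ends G f),
        weight = (weight G)
          (a := (\<Sum>v \<in> ends G e. weight G v) + (if card (ends G e) = 1 then 1 else 0)),
        mark = (\<lambda>i. r (mark G i)) \<rparr>)"

definition contract_edges :: "nat set \<Rightarrow> mwgraph \<Rightarrow> mwgraph" where
  "contract_edges S G = fold contract_edge (sorted_list_of_set S) G"

section \<open>Edge-labelled graphs up to isomorphism\<close>

type_synonym labelled_graph = "mwgraph \<times> (nat \<Rightarrow> nat)"

definition labelled_graphs :: "nat \<Rightarrow> nat \<Rightarrow> nat \<Rightarrow> labelled_graph set" where
  "labelled_graphs g n p =
     {(G, \<tau>). stable_graph g n G \<and> card (edges G) = p + 1 \<and> bij_betw \<tau> (edges G) {..p}}"

text \<open>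
  Since endpoints are recorded as sets, an isomorphism is a pair of bijections on vertices and
  edges. Automorphisms flipping a loop act trivially on both, and do not matter for isomorphism
  classes.
\<close>

definition isomorphic :: "nat \<Rightarrow> labelled_graph \<Rightarrow> labelled_graph \<Rightarrow> bool" where
  "isomorphic n = (\<lambda>(G, \<tau>) (H, \<sigma>).
     \<exists>\<phi> \<psi>. bij_betw \<phi> (verts G) (verts H) \<and> bij_betw \<psi> (edges G) (edges H) \<and>
       (\<forall>e \<in> edges G. ends H (\<psi> e) = \<phi> ` ends G e) \<and>
       (\<forall>v \<in> verts G. weight H (\<phi> v) = weight G v) \<and>
       (\<forall>i \<in> {1..n}. mark H i = \<phi> (mark G i)) \<and>
       (\<forall>e \<in> edges G. \<sigma> (\<psi> e) = \<tau> e))"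

definition iso_rel :: "nat \<Rightarrow> nat \<Rightarrow> nat \<Rightarrow> (labelled_graph \<times> labelled_graph) set" where
  "iso_rel g n p =
     {(x, y). x \<in> labelled_graphs g n p \<and> y \<in> labelled_graphs g n p \<and> isomorphic n x y}"

definition cells :: "nat \<Rightarrow> nat \<Rightarrow> nat \<Rightarrow> labelled_graph set set" where
  "cells g n p = labelled_graphs g n p // iso_rel g n p"

text \<open>
  The map \<open>\<theta>\<^sup>* : X\<^sub>q \<rightarrow> X\<^sub>p\<close> induced by an injection \<open>\<theta> : [p] \<rightarrow> [q]\<close>. The isomorphism class
  of the contracted graph does not depend on the representative, so the union below is that
  of a single class.
\<close>

definition pull_cell ::
    "nat \<Rightarrow> nat \<Rightarrow> nat \<Rightarrow> (nat \<Rightarrow> nat) \<Rightarrow> labelled_graph set \<Rightarrow> labelled_graph set" where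
  "pull_cell g n p \<theta> x =
     (\<Union>(G, \<tau>) \<in> x. iso_rel g n p ``
        {(contract_edges {e \<in> edges G. \<tau> e \<notin> \<theta> ` {..p}} G, the_inv_into {..p} \<theta> \<circ> \<tau>)})"

definition push_simplex :: "nat \<Rightarrow> (nat \<Rightarrow> nat) \<Rightarrow> (nat \<Rightarrow> real) \<Rightarrow> (nat \<Rightarrow> real)" where
  "push_simplex p \<theta> a = (\<lambda>j. \<Sum>i | i \<le> p \<and> \<theta> i = j. a i)"

section \<open>The moduli space as a quotient space\<close>

definition quotient_topology :: "'a topology \<Rightarrow> ('a \<Rightarrow> 'b) \<Rightarrow> 'b topology" where
  "quotient_topology X f =
     topology (\<lambda>U. U \<subseteq> f ` topspace X \<and> openin X {x \<in> topspace X. f x \<in> U})"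

lemma openin_quotient_topology:
  fixes X :: "'a topology" and f :: "'a \<Rightarrow> 'b"
  shows "openin (quotient_topology X f) U \<longleftrightarrow>
     U \<subseteq> f ` topspace X \<and> openin X {x \<in> topspace X. f x \<in> U}"
proof -
  have "istopology (\<lambda>U. U \<subseteq> f ` topspace X \<and> openin X {x \<in> topspace X. f x \<in> U})"
    unfolding istopology_def
  proof (intro conjI allI impI)
    fix S T
    assume S: "S \<subseteq> f ` topspace X \<and> openin X {x \<in> topspace X. f x \<in> S}"
      and T: "T \<subseteq> f ` topspace X \<and> openin X {x \<in> topspace X. f x \<in> T}"
    have "{x \<in> topspace X. f x \<in> S \<inter> T} =
        {x \<in> topspace X. f x \<in> S} \<inter> {x \<in> topspace X. f x \<in> T}"
      by auto
    then show "openin X {x \<in> topspace X. f x \<in> S \<inter> T}"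
      using S T by (simp only: openin_Int)
    show "S \<inter> T \<subseteq> f ` topspace X" using S by blast
  next
    fix K :: "'b set set"
    assume K: "\<forall>S\<in>K. S \<subseteq> f ` topspace X \<and> openin X {x \<in> topspace X. f x \<in> S}"
    then show "\<Union> K \<subseteq> f ` topspace X" by blast
    have "{x \<in> topspace X. f x \<in> \<Union> K} = (\<Union>S\<in>K. {x \<in> topspace X. f x \<in> S})"
      by auto
    moreover have "openin X (\<Union>S\<in>K. {x \<in> topspace X. f x \<in> S})"
      using K by (intro openin_Union) blast
    ultimately show "openin X {x \<in> topspace X. f x \<in> \<Union> K}"
      by simp
  qed
  then show ?thesis
    by (simp only: quotient_topology_def topology_inverse')
qed

lemma topspace_quotient_topology [simp]: "topspace (quotient_topology X f) = f ` topspace X"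
proof (rule subset_antisym)
  show "topspace (quotient_topology X f) \<subseteq> f ` topspace X"
    using openin_topspace[of "quotient_topology X f"] by (simp only: openin_quotient_topology)
  have "{x \<in> topspace X. f x \<in> f ` topspace X} = topspace X"
    by auto
  then have "openin (quotient_topology X f) (f ` topspace X)"
    by (simp only: openin_quotient_topology subset_refl openin_topspace simp_thms)
  then show "f ` topspace X \<subseteq> topspace (quotient_topology X f)"
    by (rule openin_subset)
qed

lemma quotient_map_quotient_topology: "quotient_map X (quotient_topology X f) f"
  unfolding quotient_map_def topspace_quotient_topology openin_quotient_topology by blast

type_synonym cell_point = "nat \<times> (labelled_graph set \<times> (nat \<Rightarrow> real))"

definition coproduct_space :: "nat \<Rightarrow> nat \<Rightarrow> cell_point topology" where
  "coproduct_space g n =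
     sum_topology
       (\<lambda>p. prod_topology (discrete_topology (cells g n p))
              (subtopology (powertop_real UNIV) (standard_simplex p)))
       UNIV"

definition glue :: "nat \<Rightarrow> nat \<Rightarrow> cell_point \<Rightarrow> cell_point \<Rightarrow> bool" where
  "glue g n u v \<longleftrightarrow>
     (\<exists>p q \<theta> x a. inj_on \<theta> {..p} \<and> \<theta> ` {..p} \<subseteq> {..q} \<and> x \<in> cells g n q \<and> a \<in> standard_simplex p \<and>
        u = (q, x, push_simplex p \<theta> a) \<and> v = (p, pull_cell g n p \<theta> x, a))"

definition tropical_moduli_space :: "nat \<Rightarrow> nat \<Rightarrow> cell_point set topology" where
  "tropical_moduli_space g n =
     quotient_topology (coproduct_space g n) (\<lambda>u. {v. equivclp (glue g n) u v})"

section \<open>Simple connectedness of abstract topological spaces\<close>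

text \<open>
  The library only has \<open>simply_connected\<close> for subsets of topological-space types. Here: nonempty,
  path-connected, and every loop is homotopic relative to its endpoints to a constant loop.
\<close>

definition simply_connected_space :: "'a topology \<Rightarrow> bool" where
  "simply_connected_space X \<longleftrightarrow>
     topspace X \<noteq> {} \<and> path_connected_space X \<and>
     (\<forall>\<gamma> x. pathin X \<gamma> \<and> \<gamma> 0 = x \<and> \<gamma> 1 = x \<longrightarrow>
        homotopic_with (\<lambda>h. h 0 = x \<and> h 1 = x) (top_of_set {0..1::real}) X \<gamma> (\<lambda>_. x))"

end

theory Submission
  imports Defs
begin

text \<open>
  The space is the realization of a symmetric Delta-complex. A point whose \<open>k\<close> largest edge lengths
  are strictly larger than the others can be moved straight to the tropical curve having only these
  \<open>k\<close> edges, all of the same length. This involves no choice, so it descends to the quotient and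
  contracts the pieces of an open cover along straight segments. Hence every path is homotopic to a
  concatenation of straight segments in cells, and simple connectedness follows once every vertex is
  given a path from a base vertex such that these paths are compatible with all 1-cells.

  For positive genus the base vertex is the loop with one vertex. Every bridge graph is joined to it
  by attaching a loop to a vertex of positive weight, and attaching loops to graphs with two edges
  gives the 2-cells that show compatibility; 1-cells with two parallel edges are folded by an
  automorphism. In genus zero the vertices are bipartitions of the markings, and one uses the
  projection that forgets a marking.
\<close>

section \<open>Paths up to homotopy in an abstract topological space\<close>

text \<open>The realization need not be a simplicial complex: symmetries of a graph glue its cell to
  itself, and two vertices can be joined by several 1-cells. So a path from the base vertex is
  chosen, without continuity, to every point, and a path \<open>f\<close> counts as transported if
  the path chosen for its start, followed by \<open>f\<close>, is homotopic to the one chosen for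
  its end. Checking the 1-cells suffices, because in a cell two sides of a triangle determine the
  third up to homotopy.

  In positive genus a bridge graph can receive the loop at either end. The 2-cell with loops at both
  ends shows that the choice is immaterial: contracting its bridge leaves two loops at one vertex,
  whose 1-cell is folded. A graph made of two bridges is a tree, so its whole genus is weight and a
  loop can be attached.

  In genus zero compatible bipartitions span exactly one 1-cell and pairwise compatible triples span
  a 2-cell, which reduces the problem to a relation on subsets of \<open>{1..<n}\<close>. The
  excluded cases are genuine exceptions: three points for \<open>n = 4\<close> and the Petersen
  graph for \<open>n = 5\<close>.\<close>

definition path_hom :: "'a topology \<Rightarrow> 'a \<Rightarrow> 'a \<Rightarrow> (real \<Rightarrow> 'a) \<Rightarrow> (real \<Rightarrow> 'a) \<Rightarrow> bool" where
  "path_hom X x y f g \<longleftrightarrow>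
     homotopic_with (\<lambda>h. h 0 = x \<and> h 1 = y) (top_of_set {0..1::real}) X f g"

definition path_join :: "(real \<Rightarrow> 'a) \<Rightarrow> (real \<Rightarrow> 'a) \<Rightarrow> real \<Rightarrow> 'a" where
  "path_join f g = (\<lambda>t. if t \<le> 1/2 then f (2 * t) else g (2 * t - 1))"

definition path_rev :: "(real \<Rightarrow> 'a) \<Rightarrow> real \<Rightarrow> 'a" where
  "path_rev f = (\<lambda>t. f (1 - t))"

definition path_from_to :: "'a topology \<Rightarrow> 'a \<Rightarrow> 'a \<Rightarrow> (real \<Rightarrow> 'a) \<Rightarrow> bool" where
  "path_from_to X x y f \<longleftrightarrow> pathin X f \<and> f 0 = x \<and> f 1 = y"

lemma path_hom_refl: "path_hom X x y f f \<longleftrightarrow> path_from_to X x y f"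
  by (auto simp: path_hom_def path_from_to_def pathin_def)

lemma path_hom_sym: "path_hom X x y f g \<Longrightarrow> path_hom X x y g f"
  unfolding path_hom_def by (rule homotopic_with_symD)

lemma path_hom_trans [trans]:
  "path_hom X x y f g \<Longrightarrow> path_hom X x y g h \<Longrightarrow> path_hom X x y f h"
  unfolding path_hom_def by (rule homotopic_with_trans)

lemma path_hom_imp_path:
  assumes "path_hom X x y f g"
  shows "path_from_to X x y f" "path_from_to X x y g"
  using assms path_hom_trans path_hom_sym path_hom_refl by metis+

lemma path_hom_eqI:
  assumes "path_from_to X x y f" "\<And>t. 0 \<le> t \<Longrightarrow> t \<le> 1 \<Longrightarrow> f t = g t"
  shows "path_hom X x y f g"
  unfolding path_hom_def
  by (rule homotopic_with_equal) (use assms in \<open>auto simp: path_from_to_def pathin_def\<close>)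

lemma path_hom_join:
  assumes f: "path_hom X x y f f'" and g: "path_hom X y z g g'"
  shows "path_hom X x z (path_join f g) (path_join f' g')"
proof -
  let ?I = "top_of_set {0..1::real}"
  obtain h where h: "continuous_map (prod_topology ?I ?I) X h"
      "\<And>t. h (0, t) = f t" "\<And>t. h (1, t) = f' t"
      "\<And>s. s \<in> {0..1} \<Longrightarrow> h (s, 0) = x \<and> h (s, 1) = y"
    using f unfolding path_hom_def homotopic_with_def by blast
  obtain k where k: "continuous_map (prod_topology ?I ?I) X k"
      "\<And>t. k (0, t) = g t" "\<And>t. k (1, t) = g' t"
      "\<And>s. s \<in> {0..1} \<Longrightarrow> k (s, 0) = y \<and> k (s, 1) = z"
    using g unfolding path_hom_def homotopic_with_def by blast
  \<comment> \<open>The second coordinate is the path parameter. On the line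
    \<open>snd u = 1/2\<close> both homotopies rest at \<open>y\<close>, so the two halves fit
    together.\<close>
  let ?l = "\<lambda>u::real\<times>real. if snd u \<le> 1/2 then (h \<circ> (\<lambda>u. (fst u, 2 * snd u))) u
                          else (k \<circ> (\<lambda>u. (fst u, 2 * snd u - 1))) u"
  let ?S = "{0..1::real} \<times> {0..1::real}"
  have II: "prod_topology ?I ?I = top_of_set ?S"
    by (rule prod_topology_subtopology_eu)
  have "continuous_map (top_of_set ?S) X ?l"
  proof (rule continuous_map_cases_le)
    show "continuous_map (top_of_set ?S) euclideanreal snd"
      unfolding continuous_map_iff_continuous by (rule continuous_on_snd[OF continuous_on_id])
    have eq: "subtopology (top_of_set ?S) {x \<in> topspace (top_of_set ?S). P x} = top_of_set {x \<in> ?S. P x}"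
      for P by (simp add: subtopology_subtopology Int_def conj_ac cong: conj_cong)
    show "continuous_map (subtopology (top_of_set ?S)
        {x \<in> topspace (top_of_set ?S). snd x \<le> 1/2}) X (h \<circ> (\<lambda>u. (fst u, 2 * snd u)))"
      unfolding eq
      by (rule continuous_map_compose[OF _ h(1)[unfolded II]])
         (auto intro!: continuous_intros)
    show "continuous_map (subtopology (top_of_set ?S)
        {x \<in> topspace (top_of_set ?S). 1/2 \<le> snd x}) X (k \<circ> (\<lambda>u. (fst u, 2 * snd u - 1)))"
      unfolding eq
      by (rule continuous_map_compose[OF _ k(1)[unfolded II]])
         (auto intro!: continuous_intros)
  next
    fix u :: "real \<times> real" assume "u \<in> topspace (top_of_set ?S)" "snd u = 1/2"
    then show "(h \<circ> (\<lambda>u. (fst u, 2 * snd u))) u = (k \<circ> (\<lambda>u. (fst u, 2 * snd u - 1))) u"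
      using h(4)[of "fst u"] k(4)[of "fst u"] by (cases u) (auto simp: mult.commute)
  qed auto
  then have "continuous_map (prod_topology ?I ?I) X ?l"
    by (simp only: II)
  then show ?thesis
    unfolding path_hom_def homotopic_with_def
    by (intro exI[of _ ?l]) (auto simp: path_join_def h k)
qed

lemma path_from_to_join:
  assumes "path_from_to X x y f" "path_from_to X y z g"
  shows "path_from_to X x z (path_join f g)"
  using path_hom_join[of X x y f f z g g] assms by (simp add: path_hom_refl)

lemma path_hom_join_left:
  "path_from_to X x y f \<Longrightarrow> path_hom X y z g g' \<Longrightarrow> path_hom X x z (path_join f g) (path_join f g')"
  by (rule path_hom_join) (simp_all add: path_hom_refl)

lemma path_hom_join_right:
  "path_hom X x y f f' \<Longrightarrow> path_from_to X y z g \<Longrightarrow> path_hom X x z (path_join f g) (path_join f' g)"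
  by (rule path_hom_join) (simp_all add: path_hom_refl)

text \<open>The groupoid laws below are instances of the following lemma.\<close>

lemma path_hom_convex:
  fixes C :: "'b::real_normed_vector set"
  assumes C: "convex C" and F: "continuous_map (top_of_set C) X F"
    and p: "path p" "path_image p \<subseteq> C" and q: "path q" "path_image q \<subseteq> C"
    and eq: "pathstart p = pathstart q" "pathfinish p = pathfinish q"
    and "F (pathstart p) = x" "F (pathfinish p) = y"
  shows "path_hom X x y (F \<circ> p) (F \<circ> q)"
proof -
  have "homotopic_paths C p q"
  proof (rule homotopic_paths_linear)
    show "closed_segment (p t) (q t) \<subseteq> C" if "t \<in> {0..1}" for t
      using that p(2) q(2) C by (intro closed_segment_subset) (auto simp: path_image_def)
  qed (use p q eq in auto)
  then have "homotopic_with (\<lambda>r. r 0 = p 0 \<and> r 1 = p 1) (top_of_set {0..1}) (top_of_set C) p q"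
    by (simp add: homotopic_paths_def pathstart_def pathfinish_def)
  then show ?thesis
    unfolding path_hom_def
    by (rule homotopic_with_compose_continuous_map_left[OF _ F])
       (use assms(9,10) in \<open>auto simp: pathstart_def pathfinish_def\<close>)
qed

lemma path_join_comp: "path_join (F \<circ> p) (F \<circ> q) = F \<circ> (p +++ q)"
  by (auto simp: path_join_def joinpaths_def)

text \<open>\<open>f\<close> itself serves as the map on the convex set \<open>{0..1}\<close>, where
  \<open>p\<close> and the identity are paths with the same ends.\<close>

lemma path_hom_reparam:
  assumes f: "path_from_to X x y f"
    and p: "path p" "path_image p \<subseteq> {0..1}" "p 0 = 0" "p 1 = 1"
  shows "path_hom X x y (f \<circ> p) f"
proof -
  have "path_hom X x y (f \<circ> p) (f \<circ> linepath 0 1)"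
    by (rule path_hom_convex[where C = "{0..1}"])
       (use assms in \<open>auto simp: path_from_to_def pathin_def pathstart_def pathfinish_def
          path_image_def path_def linepath_def\<close>)
  then show ?thesis
    by (simp add: linepath_def o_def)
qed

lemma path_from_to_rev:
  assumes "path_from_to X x y f"
  shows "path_from_to X y x (path_rev f)"
proof -
  have "continuous_map (top_of_set {0..1}) X (f \<circ> (\<lambda>t. 1 - t))"
    by (rule continuous_map_compose[of _ "top_of_set {0..1}"])
       (use assms in \<open>auto simp: path_from_to_def pathin_def intro!: continuous_intros\<close>)
  then show ?thesis
    using assms by (auto simp: path_from_to_def pathin_def path_rev_def o_def)
qed

lemma path_from_to_const: "x \<in> topspace X \<Longrightarrow> path_from_to X x x (\<lambda>_. x)"
  by (simp add: path_from_to_def pathin_def)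

lemma path_hom_assoc:
  assumes f: "path_from_to X w x f" and g: "path_from_to X x y g" and h: "path_from_to X y z h"
  shows "path_hom X w z (path_join f (path_join g h)) (path_join (path_join f g) h)"
proof -
  let ?F = "path_join (path_join f g) h"
  \<comment> \<open>The reparametrisation sends the break points 1/2 and 3/4 to 1/4 and 1/2. Its
    slopes 1/2, 1, 2 increase, so it is the maximum of its affine pieces and visibly
    continuous.\<close>
  let ?p = "\<lambda>t::real. max (t/2) (max (t - 1/4) (2 * t - 1))"
  have F: "path_from_to X w z ?F"
    by (rule path_from_to_join[OF path_from_to_join[OF f g] h])
  have eq: "path_join f (path_join g h) = ?F \<circ> ?p"
  proof
    fix t :: real
    consider "t \<le> 1/2" | "1/2 < t" "t \<le> 3/4" | "3/4 < t" by linarith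
    then show "path_join f (path_join g h) t = (?F \<circ> ?p) t"
    proof cases
      case 1
      then have "?p t = t/2" by linarith
      with 1 show ?thesis by (simp add: path_join_def)
    next
      case 2
      then have p: "?p t = t - 1/4" by linarith
      from 2 show ?thesis unfolding o_def p by (simp add: path_join_def algebra_simps)
    next
      case 3
      then have p: "?p t = 2 * t - 1" by linarith
      from 3 show ?thesis unfolding o_def p by (simp add: path_join_def algebra_simps)
    qed
  qed
  show ?thesis
    unfolding eq
    by (rule path_hom_reparam[OF F])
       (auto simp: path_def path_image_def le_max_iff_disj intro!: continuous_intros)
qed

text \<open>The closed path \<open>p\<close> contracts inside the interval before \<open>f\<close>
  is applied. Out-and-back paths have this form: a path followed by its reverse, and later the
  folded 1-cells.\<close>

lemma path_hom_null:
  assumes f: "pathin X f"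
    and p: "path p" "path_image p \<subseteq> {0..1}" "p 0 = p 1" "f (p 0) = x"
  shows "path_hom X x x (f \<circ> p) (\<lambda>_. x)"
proof -
  have "path_hom X x x (f \<circ> p) (f \<circ> (\<lambda>_. p 0))"
    by (rule path_hom_convex[where C = "{0..1}"])
       (use assms in \<open>auto simp: pathin_def pathstart_def pathfinish_def path_image_def path_def
          image_subset_iff\<close>)
  then show ?thesis
    using p by (simp add: o_def)
qed

lemma path_hom_rev_right:
  assumes f: "path_from_to X x y f"
  shows "path_hom X x x (path_join f (path_rev f)) (\<lambda>_. x)"
proof -
  \<comment> \<open>The concatenation reads \<open>f\<close> along a tent function that reaches 1 at
    time 1/2.\<close>
  have eq: "path_join f (path_rev f) = f \<circ> (\<lambda>t. min (2 * t) (2 - 2 * t))"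
  proof
    fix t :: real
    show "path_join f (path_rev f) t = (f \<circ> (\<lambda>t. min (2 * t) (2 - 2 * t))) t"
      by (cases "t \<le> 1/2") (auto simp: path_join_def path_rev_def min_def algebra_simps)
  qed
  show ?thesis
    unfolding eq
    by (rule path_hom_null)
       (use f in \<open>auto simp: path_from_to_def path_def path_image_def intro!: continuous_intros\<close>)
qed

lemma path_rev_rev [simp]: "path_rev (path_rev f) = f"
  by (simp add: path_rev_def)

lemma path_hom_rev_left:
  assumes f: "path_from_to X x y f"
  shows "path_hom X y y (path_join (path_rev f) f) (\<lambda>_. y)"
  using path_hom_rev_right[OF path_from_to_rev[OF f]] by simp

lemma path_hom_const_right:
  assumes f: "path_from_to X x y f"
  shows "path_hom X x y (path_join f (\<lambda>_. y)) f"
proof -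
  have eq: "path_join f (\<lambda>_. y) = f \<circ> (\<lambda>t. min (2 * t) 1)"
    using f by (auto simp: path_join_def min_def path_from_to_def fun_eq_iff)
  show ?thesis
    unfolding eq
    by (rule path_hom_reparam[OF f]) (auto simp: path_def path_image_def intro!: continuous_intros)
qed

lemma path_hom_const_left:
  assumes f: "path_from_to X x y f"
  shows "path_hom X x y (path_join (\<lambda>_. x) f) f"
proof -
  have "max 0 (2 * t - 1) = (if t \<le> 1/2 then 0 else 2 * t - 1)" for t :: real
    by auto
  then have eq: "path_join (\<lambda>_. x) f = f \<circ> (\<lambda>t. max 0 (2 * t - 1))"
    using f by (auto simp: path_join_def path_from_to_def fun_eq_iff)
  show ?thesis
    unfolding eq
    by (rule path_hom_reparam[OF f]) (auto simp: path_def path_image_def intro!: continuous_intros)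
qed

lemma path_hom_cancel_right:
  assumes h: "path_hom X x z (path_join f g) h"
    and f: "path_from_to X x y f" and g: "path_from_to X y z g"
  shows "path_hom X x y (path_join h (path_rev g)) f"
proof -
  note r = path_from_to_rev[OF g]
  have "path_hom X x y (path_join h (path_rev g)) (path_join (path_join f g) (path_rev g))"
    by (rule path_hom_join[OF path_hom_sym[OF h]]) (simp add: path_hom_refl r)
  also have "path_hom X x y \<dots> (path_join f (path_join g (path_rev g)))"
    by (rule path_hom_sym[OF path_hom_assoc[OF f g r]])
  also have "path_hom X x y \<dots> (path_join f (\<lambda>_. y))"
    by (rule path_hom_join[OF _ path_hom_rev_right[OF g]]) (simp add: path_hom_refl f)
  also have "path_hom X x y \<dots> f"
    by (rule path_hom_const_right[OF f])
  finally show ?thesis .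
qed

lemma path_hom_cancel_left:
  assumes h: "path_hom X x z (path_join f g) h"
    and f: "path_from_to X x y f" and g: "path_from_to X y z g"
  shows "path_hom X y z g (path_join (path_rev f) h)"
proof -
  note r = path_from_to_rev[OF f]
  have "path_hom X y z (path_join (path_rev f) h) (path_join (path_rev f) (path_join f g))"
    by (rule path_hom_join[OF _ path_hom_sym[OF h]]) (simp add: path_hom_refl r)
  also have "path_hom X y z \<dots> (path_join (path_join (path_rev f) f) g)"
    by (rule path_hom_assoc[OF r f g])
  also have "path_hom X y z \<dots> (path_join (\<lambda>_. y) g)"
    by (rule path_hom_join[OF path_hom_rev_left[OF f]]) (simp add: path_hom_refl g)
  also have "path_hom X y z \<dots> g"
    by (rule path_hom_const_left[OF g])
  finally show ?thesis by (rule path_hom_sym)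
qed

section \<open>Transport of chosen paths and its local character\<close>

text \<open>Being transported is stable under concatenation and can therefore be checked locally. If all
  paths are transported, then \<open>P x\<close> followed by a loop at \<open>x\<close> is homotopic to \<open>P x\<close>, so the loop is null.\<close>

definition transported :: "'a topology \<Rightarrow> 'a \<Rightarrow> ('a \<Rightarrow> real \<Rightarrow> 'a) \<Rightarrow> (real \<Rightarrow> 'a) \<Rightarrow> bool" where
  "transported X b P f \<longleftrightarrow>
     pathin X f \<and> path_hom X b (f 1) (path_join (P (f 0)) f) (P (f 1))"

text \<open>No continuity of \<open>P x\<close> in \<open>x\<close> is asked for; all compatibility
  between the chosen paths is expressed through \<open>transported\<close>.\<close>

locale path_choice =
  fixes X :: "'a topology" and b :: 'a and P :: "'a \<Rightarrow> real \<Rightarrow> 'a"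
  assumes P: "x \<in> topspace X \<Longrightarrow> path_from_to X b x (P x)"
begin

lemma P_start: "pathin X f \<Longrightarrow> path_from_to X b (f 0) (P (f 0))"
  by (rule P) (auto simp: pathin_def continuous_map_def)

lemma transported_hom:
  assumes "path_hom X x y f g" and f: "transported X b P f"
  shows "transported X b P g"
proof -
  have p: "path_from_to X x y f" "path_from_to X x y g"
    using path_hom_imp_path[OF assms(1)] by auto
  then have eq: "f 0 = x" "f 1 = y" "g 0 = x" "g 1 = y"
    by (auto simp: path_from_to_def)
  have Px: "path_from_to X b x (P x)"
    using P_start[of f] p eq by (auto simp: path_from_to_def)
  have "path_hom X b y (path_join (P x) g) (path_join (P x) f)"
    by (rule path_hom_join[OF _ path_hom_sym[OF assms(1)]]) (simp add: path_hom_refl Px)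
  also have "path_hom X b y \<dots> (P y)"
    using f eq by (simp add: transported_def)
  finally show ?thesis
    using p eq by (simp add: transported_def path_from_to_def)
qed

lemma transported_join:
  assumes f: "transported X b P f" and g: "transported X b P g" and eq: "f 1 = g 0"
  shows "transported X b P (path_join f g)"
proof -
  have pf: "path_from_to X (f 0) (f 1) f" and pg: "path_from_to X (f 1) (g 1) g"
    using f g eq by (auto simp: transported_def path_from_to_def)
  have Pf: "path_from_to X b (f 0) (P (f 0))"
    using f by (intro P_start) (simp add: transported_def)
  have j: "path_from_to X (f 0) (g 1) (path_join f g)"
    by (rule path_from_to_join[OF pf pg])
  have "path_hom X b (g 1) (path_join (P (f 0)) (path_join f g)) (path_join (path_join (P (f 0)) f) g)"
    by (rule path_hom_assoc[OF Pf pf pg])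
  also have "path_hom X b (g 1) \<dots> (path_join (P (f 1)) g)"
    by (rule path_hom_join) (use f pg in \<open>auto simp: transported_def path_hom_refl\<close>)
  also have "path_hom X b (g 1) \<dots> (P (g 1))"
    using g eq by (simp add: transported_def)
  finally show ?thesis
    using j by (simp add: transported_def path_from_to_def)
qed

lemma transported_rev:
  assumes f: "transported X b P f"
  shows "transported X b P (path_rev f)"
proof -
  have pf: "path_from_to X (f 0) (f 1) f"
    using f by (auto simp: transported_def path_from_to_def)
  have "path_hom X b (f 0) (path_join (P (f 1)) (path_rev f)) (P (f 0))"
    by (rule path_hom_cancel_right[OF _ _ pf])
       (use f in \<open>auto simp: transported_def intro!: P_start\<close>)
  then show ?thesis
    using path_from_to_rev[OF pf] by (simp add: transported_def path_from_to_def path_rev_def)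
qed

lemma transported_const: "x \<in> topspace X \<Longrightarrow> transported X b P (\<lambda>_. x)"
  using path_hom_const_right[OF P] by (simp add: transported_def pathin_def)

text \<open>Over an open set contracting to a point, any path is homotopic to the concatenation of the
  track of its start with the reversed track of its end.\<close>

lemma transported_in_contractible:
  assumes U: "continuous_map (prod_topology (subtopology X U) (top_of_set {0..1})) X H"
    and H: "\<And>y. y \<in> U \<Longrightarrow> H (y, 0) = y \<and> H (y, 1) = c \<and> transported X b P (\<lambda>t. H (y, t))"
    and f: "pathin X f" "f ` {0..1} \<subseteq> U"
  shows "transported X b P f"
proof -
  define F where "F = (\<lambda>u::real\<times>real. H (f (fst u), snd u))"
  let ?S = "{0..1::real} \<times> {0..1::real}"
  have "continuous_map (top_of_set {0..1}) (subtopology X U) f"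
    using f by (auto simp: pathin_def continuous_map_in_subtopology)
  then have "continuous_map (prod_topology (top_of_set {0..1}) (top_of_set {0..1}))
      (prod_topology (subtopology X U) (top_of_set {0..1})) (\<lambda>u. (f (fst u), snd u))"
    by (intro continuous_map_pairedI continuous_map_snd
          continuous_map_compose[OF continuous_map_fst, unfolded o_def])
  from continuous_map_compose[OF this U]
  have F: "continuous_map (top_of_set ?S) X F"
    by (simp add: F_def o_def prod_topology_subtopology subtopology_subtopology Times_Int_Times
         flip: euclidean_product_topology)
  \<comment> \<open>In the square the first coordinate is time on \<open>f\<close>, the second the
    time of the contraction. The left side is the track of \<open>f 0\<close>, the top is constant
    at \<open>c\<close>, the right side is the reversed track of \<open>f 1\<close>, and the bottom
    is \<open>f\<close>.\<close>
  let ?A = "linepath (0,0) (0,1) :: real \<Rightarrow> real \<times> real"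
  let ?M = "linepath (0,1) (1,1) :: real \<Rightarrow> real \<times> real"
  let ?B = "linepath (1,1) (1,0) :: real \<Rightarrow> real \<times> real"
  let ?L = "linepath (0,0) (1,0) :: real \<Rightarrow> real \<times> real"
  have cv: "convex ?S"
    by (intro convex_Times) auto
  have fU: "f 0 \<in> U" "f 1 \<in> U" "\<And>t. 0 \<le> t \<Longrightarrow> t \<le> 1 \<Longrightarrow> f t \<in> U"
    using f by auto
  have "path_hom X (f 0) (f 1) (F \<circ> ((?A +++ ?M) +++ ?B)) (F \<circ> ?L)"
  proof (rule path_hom_convex[OF cv F])
    show "path_image ((?A +++ ?M) +++ ?B) \<subseteq> ?S"
      by (intro subset_path_image_join)
         (simp_all add: closed_segment_subset[OF _ _ cv])
  qed (use H fU in \<open>auto simp: F_def closed_segment_subset[OF _ _ cv]\<close>)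
  moreover have "transported X b P (F \<circ> ((?A +++ ?M) +++ ?B))"
    unfolding path_join_comp[symmetric]
  proof (intro transported_join)
    show "transported X b P (F \<circ> ?A)"
      using H[OF fU(1)] by (simp add: F_def o_def linepath_def)
    have "transported X b P (path_rev (\<lambda>t. H (f 1, t)))"
      using H[OF fU(2)] by (intro transported_rev) simp
    then show "transported X b P (F \<circ> ?B)"
      by (simp add: F_def o_def linepath_def path_rev_def)
    have c: "c \<in> topspace X"
      using H[OF fU(1)] by (force simp: transported_def pathin_def continuous_map_def)
    have "path_hom X c c (\<lambda>_. c) (F \<circ> ?M)"
      by (rule path_hom_eqI[OF path_from_to_const[OF c]])
         (use H fU in \<open>simp add: F_def linepath_def\<close>)
    then show "transported X b P (F \<circ> ?M)"
      by (rule transported_hom[OF _ transported_const[OF c]])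
  qed (auto simp: path_join_def linepath_def)
  moreover have "path_hom X (f 0) (f 1) (F \<circ> ?L) f"
  proof (rule path_hom_sym, rule path_hom_eqI)
    show "path_from_to X (f 0) (f 1) f"
      using f by (simp add: path_from_to_def)
    show "f t = (F \<circ> ?L) t" if "0 \<le> t" "t \<le> 1" for t
      using H[OF fU(3)[OF that]] by (simp add: F_def linepath_def)
  qed
  ultimately show ?thesis
    using transported_hom by blast
qed

text \<open>Being transported is additive under subdivision and holds on short pieces, which stay
  inside one of the open sets. Bisection (\<open>Bolzano\<close>) takes the place of a Lebesgue
  number.\<close>

lemma transported_if_locally_contractible:
  assumes loc: "\<And>x. x \<in> topspace X \<Longrightarrow> \<exists>U H c. openin X U \<and> x \<in> U \<and>
       continuous_map (prod_topology (subtopology X U) (top_of_set {0..1})) X H \<and>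
       (\<forall>y \<in> U. H (y, 0) = y \<and> H (y, 1) = c \<and> transported X b P (\<lambda>t. H (y, t)))"
    and f: "pathin X f"
  shows "transported X b P f"
proof -
  define sub where "sub = (\<lambda>u v. f \<circ> linepath u v)"
  have sub: "path_from_to X (f u) (f v) (sub u v)" if "u \<in> {0..1}" "v \<in> {0..1}" for u v
  proof -
    have "linepath u v ` {0..1} \<subseteq> {0..1}"
      using closed_segment_subset[of u "{0..1}" v] that
      by (simp add: path_image_linepath flip: path_image_def)
    moreover have "continuous_on {0..1} (linepath u v)"
      by (rule continuous_on_linepath)
    ultimately have "continuous_map (top_of_set {0..1}) (top_of_set {0..1}) (linepath u v)"
      by (auto simp: image_subset_iff)
    then have "continuous_map (top_of_set {0..1}) X (f \<circ> linepath u v)"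
      by (rule continuous_map_compose) (use f in \<open>simp add: pathin_def\<close>)
    then show ?thesis
      by (simp add: path_from_to_def pathin_def sub_def linepath_def)
  qed
  have "transported X b P (sub 0 1)"
  proof -
    have "(0::real) \<le> 1" by simp
    \<comment> \<open>\<open>Bolzano\<close> ranges over all real end points, so the bounds of the
      unit interval enter the predicate as premises.\<close>
    then have "0 \<le> (0::real) \<longrightarrow> 1 \<le> (1::real) \<longrightarrow> (0::real) \<le> 1 \<longrightarrow> transported X b P (sub 0 1)"
    proof (induct rule: Bolzano[where P = "\<lambda>u v. 0 \<le> u \<longrightarrow> v \<le> 1 \<longrightarrow> u \<le> v \<longrightarrow> transported X b P (sub u v)"])
      case (trans u v w)
      show ?case
      proof (intro impI)
        assume uw: "0 \<le> u" "w \<le> 1" "u \<le> w"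
        have "transported X b P (path_join (sub u v) (sub v w))"
          using trans uw by (intro transported_join) (auto, simp add: sub_def linepath_def)
        \<comment> \<open>The two restrictions joined together run through \<open>f\<close> from
          \<open>u\<close> to \<open>w\<close> at another speed; both parametrisations are paths in
          the convex set \<open>{0..1}\<close> with the same ends.\<close>
        moreover have "path_hom X (f u) (f w) (f \<circ> (linepath u v +++ linepath v w)) (f \<circ> linepath u w)"
        proof (rule path_hom_convex[where C = "{0..1}" and F = f and p = "linepath u v +++ linepath v w" and
              q = "linepath u w"])
          show "path_image (linepath u v +++ linepath v w) \<subseteq> {0..1}"
            by (intro subset_path_image_join)
               (use trans uw in \<open>auto simp: path_image_linepath closed_segment_eq_real_ivl\<close>)
          show "path_image (linepath u w) \<subseteq> {0..1}"
            unfolding path_image_linepath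
            by (rule closed_segment_subset) (use uw in auto)
        qed (use f uw in \<open>auto simp: pathin_def\<close>)
        ultimately show "transported X b P (sub u w)"
          unfolding sub_def path_join_comp using transported_hom by blast
      qed
    next
      case (local x)
      then have "f x \<in> topspace X"
        using f by (auto simp: pathin_def continuous_map_def)
      then obtain U H c where U: "openin X U" "f x \<in> U"
        "continuous_map (prod_topology (subtopology X U) (top_of_set {0..1})) X H"
        "\<And>y. y \<in> U \<Longrightarrow> H (y, 0) = y \<and> H (y, 1) = c \<and> transported X b P (\<lambda>t. H (y, t))"
        using loc by metis
      have "openin (top_of_set {0..1}) {t \<in> topspace (top_of_set {0..1}). f t \<in> U}"
        using f U(1) unfolding pathin_def by (rule openin_continuous_map_preimage)
      then obtain T where T: "open T" "{t \<in> {0..1}. f t \<in> U} = {0..1} \<inter> T"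
        by (auto simp: openin_open)
      with local U(2) have "x \<in> T" by auto
      then obtain d where d: "d > 0" "ball x d \<subseteq> T"
        using T(1) open_contains_ball by blast
      show ?case
      proof (intro exI conjI allI impI)
        fix u v assume uv: "u \<le> x \<and> x \<le> v \<and> v - u < d" "0 \<le> u" "v \<le> 1" "u \<le> v"
        show "transported X b P (sub u v)"
        proof (rule transported_in_contractible[OF U(3,4)])
          show "pathin X (sub u v)"
            using sub[of u v] uv by (simp add: path_from_to_def)
          show "sub u v ` {0..1} \<subseteq> U"
          proof
            fix y assume "y \<in> sub u v ` {0..1}"
            then obtain t where t: "t \<in> {0..1}" "y = f (linepath u v t)"
              by (auto simp: sub_def)
            have "linepath u v t \<in> closed_segment u v"
              using t(1) by (metis path_image_linepath path_image_def imageI)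
            then have "u \<le> linepath u v t" "linepath u v t \<le> v"
              using uv by (auto simp: closed_segment_eq_real_ivl)
            then have "linepath u v t \<in> {0..1} \<inter> T"
              using uv d by (auto simp: subset_iff dist_real_def)
            then show "y \<in> U"
              using t(2) T(2) by blast
          qed
        qed auto
      qed (use d in auto)
    qed
    then show ?thesis
      by simp
  qed
  then show ?thesis
    by (simp add: sub_def linepath_def o_def)
qed

lemma simply_connected_if_transported:
  assumes b: "b \<in> topspace X"
    and tr: "\<And>f. pathin X f \<Longrightarrow> transported X b P f"
  shows "simply_connected_space X"
  unfolding simply_connected_space_def
proof (intro conjI allI impI)
  show "topspace X \<noteq> {}"
    using b by auto
  show "path_connected_space X"
    unfolding path_connected_space_def
  proof (intro ballI)
    fix x y assume "x \<in> topspace X" "y \<in> topspace X"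
    then have "path_from_to X x y (path_join (path_rev (P x)) (P y))"
      by (intro path_from_to_join[OF path_from_to_rev]) (auto intro: P)
    then show "\<exists>g. pathin X g \<and> g 0 = x \<and> g 1 = y"
      by (auto simp: path_from_to_def)
  qed
next
  fix f x assume f: "pathin X f \<and> f 0 = x \<and> f 1 = x"
  then have pf: "path_from_to X x x f" and Px: "path_from_to X b x (P x)"
    using P_start[of f] by (auto simp: path_from_to_def)
  have "path_hom X b x (path_join (P x) f) (P x)"
    using tr[of f] f by (simp add: transported_def)
  from path_hom_cancel_left[OF this Px pf]
  have "path_hom X x x f (path_join (path_rev (P x)) (P x))" .
  also have "path_hom X x x \<dots> (\<lambda>_. x)"
    by (rule path_hom_rev_left[OF Px])
  finally show "homotopic_with (\<lambda>h. h 0 = x \<and> h 1 = x) (top_of_set {0..1}) X f (\<lambda>_. x)"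
    by (simp add: path_hom_def)
qed

end

section \<open>Coordinates of the standard simplex\<close>

definition vert :: "nat \<Rightarrow> nat \<Rightarrow> real" where
  "vert i = (\<lambda>j. if j = i then 1 else 0)"

lemma vert_in_simplex: "i \<le> p \<Longrightarrow> vert i \<in> standard_simplex p"
  by (auto simp: vert_def standard_simplex_def)

lemma push_simplex_apply:
  assumes "inj_on \<theta> {..p}" "i \<le> p"
  shows "push_simplex p \<theta> a (\<theta> i) = a i"
proof -
  have "{j. j \<le> p \<and> \<theta> j = \<theta> i} = {i}"
    using assms by (auto simp: inj_on_def)
  then show ?thesis by (simp add: push_simplex_def)
qed

lemma push_simplex_outside: "j \<notin> \<theta> ` {..p} \<Longrightarrow> push_simplex p \<theta> a j = 0"
  by (auto simp: push_simplex_def intro!: sum.neutral)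

lemma push_simplex_in_simplex:
  assumes \<theta>: "inj_on \<theta> {..p}" "\<theta> ` {..p} \<subseteq> {..q}" and a: "a \<in> standard_simplex p"
  shows "push_simplex p \<theta> a \<in> standard_simplex q"
proof -
  have range: "0 \<le> push_simplex p \<theta> a j \<and> push_simplex p \<theta> a j \<le> 1" for j
  proof (cases "j \<in> \<theta> ` {..p}")
    case True
    then show ?thesis
      using a push_simplex_apply[OF \<theta>(1)] by (auto simp: standard_simplex_def)
  qed (simp add: push_simplex_outside)
  have "(\<Sum>j\<le>q. push_simplex p \<theta> a j) = (\<Sum>j\<in>\<theta> ` {..p}. push_simplex p \<theta> a j)"
    using \<theta>(2) by (intro sum.mono_neutral_right) (auto simp: push_simplex_outside)
  also have "\<dots> = (\<Sum>i\<le>p. a i)"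
    using push_simplex_apply[OF \<theta>(1)] by (simp add: sum.reindex[OF \<theta>(1)])
  also have "\<dots> = 1"
    using a by (simp add: standard_simplex_def)
  finally have "(\<Sum>j\<le>q. push_simplex p \<theta> a j) = 1" .
  moreover have "push_simplex p \<theta> a j = 0" if "j > q" for j
    using that \<theta>(2) by (intro push_simplex_outside) auto
  ultimately show ?thesis
    using range by (simp add: standard_simplex_def)
qed

lemma push_simplex_affine:
  "push_simplex p \<theta> (\<lambda>i. x * a i + y * b i) =
     (\<lambda>i. x * push_simplex p \<theta> a i + y * push_simplex p \<theta> b i)"
  by (simp add: push_simplex_def sum.distrib sum_distrib_left)

lemma push_simplex_vert:
  assumes "inj_on \<theta> {..p}" "i \<le> p"
  shows "push_simplex p \<theta> (vert i) = vert (\<theta> i)"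
proof
  fix j
  show "push_simplex p \<theta> (vert i) j = vert (\<theta> i) j"
  proof (cases "j \<in> \<theta> ` {..p}")
    case True
    then obtain k where "k \<le> p" "j = \<theta> k" by auto
    with assms show ?thesis
      using push_simplex_apply[OF assms(1) \<open>k \<le> p\<close>] by (auto simp: vert_def inj_on_def)
  next
    case False
    then show ?thesis
      using assms by (auto simp: push_simplex_outside vert_def)
  qed
qed

section \<open>Leading coordinates and barycentres of faces\<close>

text \<open>For given \<open>k\<close> and \<open>b\<close> there is at most one such \<open>S\<close>. Hence moving \<open>b\<close> straight to the barycentre
  of the face spanned by \<open>S\<close> is compatible with all gluing maps, which gives the local contractibility
  of the realization.\<close>

definition leading_set :: "nat \<Rightarrow> (nat \<Rightarrow> real) \<Rightarrow> nat set \<Rightarrow> bool" where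
  "leading_set k b S \<longleftrightarrow> card S = k \<and> k > 0 \<and> (\<forall>i \<in> S. \<forall>j. j \<notin> S \<longrightarrow> b j < b i)"

definition barycentre :: "nat set \<Rightarrow> nat \<Rightarrow> real" where
  "barycentre S = (\<lambda>i. if i \<in> S then 1 / card S else 0)"

lemma leading_set_finite: "leading_set k b S \<Longrightarrow> finite S \<and> S \<noteq> {}"
  by (auto simp: leading_set_def card_gt_0_iff)

lemma leading_set_unique:
  assumes "leading_set k b S" "leading_set k b S'"
  shows "S = S'"
proof (rule ccontr)
  assume "S \<noteq> S'"
  moreover have "finite S" "finite S'" "card S = card S'"
    using assms leading_set_finite by (auto simp: leading_set_def)
  ultimately have "\<not> S \<subseteq> S'" "\<not> S' \<subseteq> S"
    by (metis card_subset_eq)+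
  then obtain i j where "i \<in> S - S'" "j \<in> S' - S" by blast
  with assms have "b j < b i" "b i < b j"
    by (auto simp: leading_set_def)
  then show False by simp
qed

lemma the_leading_set: "leading_set k b S \<Longrightarrow> (THE S. leading_set k b S) = S"
  by (rule the_equality) (auto dest: leading_set_unique)

text \<open>\<open>leading_set\<close> compares with all indices outside the finite set
  \<open>S\<close>, also with those beyond \<open>p\<close>, where the coordinate is 0. So zero
  coordinates never lead, and the notion does not refer to the dimension of the simplex.\<close>

lemma leading_set_positive:
  assumes b: "b \<in> standard_simplex p" and S: "leading_set k b S" and "i \<in> S"
  shows "b i > 0"
proof -
  obtain j where "j \<notin> S"
    using leading_set_finite[OF S] by (meson ex_new_if_finite infinite_UNIV_nat)
  then have "b j < b i"
    using S \<open>i \<in> S\<close> by (simp add: leading_set_def)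
  moreover have "0 \<le> b j"
    using b by (simp add: standard_simplex_def)
  ultimately show ?thesis by simp
qed

lemma leading_set_subset:
  assumes b: "b \<in> standard_simplex p" and S: "leading_set k b S"
  shows "S \<subseteq> {..p}"
proof
  fix i assume "i \<in> S"
  then show "i \<in> {..p}"
    using leading_set_positive[OF assms, of i] b by (cases "i \<le> p") (auto simp: standard_simplex_def)
qed

text \<open>The infinitely many inequalities of \<open>leading_set\<close> reduce on a simplex to
  finitely many strict ones, since those for indices beyond \<open>p\<close> all say
  \<open>b i > 0\<close>. This form makes openness evident.\<close>

lemma leading_set_iff:
  assumes b: "b \<in> standard_simplex p" and S: "S \<subseteq> {..p}"
  shows "leading_set k b S \<longleftrightarrow>
     card S = k \<and> k > 0 \<and> (\<forall>i \<in> S. b i > 0 \<and> (\<forall>j \<in> {..p} - S. b j < b i))"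
proof
  assume "leading_set k b S"
  then show "card S = k \<and> k > 0 \<and> (\<forall>i \<in> S. b i > 0 \<and> (\<forall>j \<in> {..p} - S. b j < b i))"
    using leading_set_positive[OF b] by (auto simp: leading_set_def)
next
  assume *: "card S = k \<and> k > 0 \<and> (\<forall>i \<in> S. b i > 0 \<and> (\<forall>j \<in> {..p} - S. b j < b i))"
  have "b j < b i" if "i \<in> S" "j \<notin> S" for i j
    using * that b by (cases "j \<le> p") (auto simp: standard_simplex_def)
  then show "leading_set k b S"
    using * by (auto simp: leading_set_def)
qed

lemma barycentre_in_simplex:
  assumes "S \<subseteq> {..p}" "S \<noteq> {}"
  shows "barycentre S \<in> standard_simplex p"
proof -
  have "finite S"
    using assms(1) by (rule finite_subset) simp
  then have "card S > 0"
    using assms by (simp add: card_gt_0_iff)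
  moreover have "(\<Sum>i\<le>p. barycentre S i) = (\<Sum>i\<in>S. 1 / card S)"
    using assms by (intro sum.mono_neutral_cong_right) (auto simp: barycentre_def)
  ultimately have "(\<Sum>i\<le>p. barycentre S i) = 1"
    by simp
  moreover have "0 \<le> barycentre S i \<and> barycentre S i \<le> 1" for i
    using \<open>card S > 0\<close> by (simp add: barycentre_def)
  moreover have "barycentre S i = 0" if "i > p" for i
    using assms(1) that by (auto simp: barycentre_def)
  ultimately show ?thesis
    by (simp add: standard_simplex_def)
qed

lemma leading_set_push:
  assumes \<theta>: "inj_on \<theta> {..p}" and b: "b \<in> standard_simplex p" and S: "leading_set k b S"
  shows "leading_set k (push_simplex p \<theta> b) (\<theta> ` S)"
proof -
  have sub: "S \<subseteq> {..p}"
    by (rule leading_set_subset[OF b S])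
  then have "card (\<theta> ` S) = card S"
    using \<theta> by (intro card_image) (rule inj_on_subset)
  moreover have "push_simplex p \<theta> b j < push_simplex p \<theta> b (\<theta> i)" if "i \<in> S" "j \<notin> \<theta> ` S" for i j
  proof (cases "j \<in> \<theta> ` {..p}")
    case True
    then obtain l where l: "l \<le> p" "j = \<theta> l" by auto
    with that have "l \<notin> S" by auto
    then have "b l < b i"
      using S that by (auto simp: leading_set_def)
    then show ?thesis
      using push_simplex_apply[OF \<theta>] l sub that by auto
  next
    case False
    then show ?thesis
      using push_simplex_apply[OF \<theta>, of i] leading_set_positive[OF b S] sub that
      by (auto simp: push_simplex_outside)
  qed
  ultimately show ?thesis
    using S by (auto simp: leading_set_def)
qed

text \<open>Coordinates outside the image of \<open>\<theta>\<close> are zero and cannot lead, so a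
  leading set of the pushed point comes from the smaller simplex.\<close>

lemma leading_set_pushD:
  assumes \<theta>: "inj_on \<theta> {..p}" "\<theta> ` {..p} \<subseteq> {..q}" and b: "b \<in> standard_simplex p"
    and S: "leading_set k (push_simplex p \<theta> b) S"
  obtains S' where "leading_set k b S'" "S = \<theta> ` S'"
proof
  let ?S = "{i \<in> {..p}. \<theta> i \<in> S}"
  have b': "push_simplex p \<theta> b \<in> standard_simplex q"
    by (rule push_simplex_in_simplex[OF \<theta> b])
  have "S \<subseteq> \<theta> ` {..p}"
  proof
    fix j assume "j \<in> S"
    from leading_set_positive[OF b' S this] show "j \<in> \<theta> ` {..p}"
      using push_simplex_outside[of j \<theta> p b] by force
  qed
  then show eq: "S = \<theta> ` ?S"
    by auto
  have inj: "inj_on \<theta> ?S"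
    using \<theta>(1) by (rule inj_on_subset) auto
  have "card ?S = card S"
    using card_image[OF inj] eq by simp
  moreover have "b j < b i" if "i \<in> ?S" "j \<notin> ?S" for i j
  proof (cases "j \<le> p")
    case True
    then have "push_simplex p \<theta> b (\<theta> j) < push_simplex p \<theta> b (\<theta> i)"
      using S that by (auto simp: leading_set_def)
    then show ?thesis
      using push_simplex_apply[OF \<theta>(1)] True that by auto
  next
    case False
    then show ?thesis
      using b leading_set_positive[OF b' S, of "\<theta> i"] push_simplex_apply[OF \<theta>(1), of i b] that
      by (auto simp: standard_simplex_def)
  qed
  ultimately show "leading_set k b ?S"
    using S by (auto simp: leading_set_def)
qed

lemma barycentre_push:
  assumes \<theta>: "inj_on \<theta> {..p}" and S: "S \<subseteq> {..p}"
  shows "push_simplex p \<theta> (barycentre S) = barycentre (\<theta> ` S)"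
proof
  fix j
  have c: "card (\<theta> ` S) = card S"
    using \<theta> S by (intro card_image) (rule inj_on_subset)
  show "push_simplex p \<theta> (barycentre S) j = barycentre (\<theta> ` S) j"
  proof (cases "j \<in> \<theta> ` {..p}")
    case True
    then obtain l where l: "l \<le> p" "j = \<theta> l" by auto
    then have "\<theta> l \<in> \<theta> ` S \<longleftrightarrow> l \<in> S"
      using \<theta> S by (auto simp: inj_on_def)
    then show ?thesis
      using push_simplex_apply[OF \<theta> l(1)] l c by (simp add: barycentre_def)
  next
    case False
    then show ?thesis
      using S by (auto simp: push_simplex_outside barycentre_def)
  qed
qed

text \<open>The support of \<open>b\<close> leads, with \<open>k\<close> the number of nonzero
  coordinates. Hence the open pieces defined by leading sets cover the realization.\<close>

lemma leading_set_exists: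
  assumes b: "b \<in> standard_simplex p"
  shows "\<exists>k S. leading_set k b S"
proof -
  let ?S = "{i. b i > 0}"
  have "?S \<subseteq> {..p}"
    using b by (auto simp: standard_simplex_def simp flip: not_le)
  then have fin: "finite ?S"
    by (rule finite_subset) simp
  have "?S \<noteq> {}"
  proof
    assume "?S = {}"
    then have "b i \<le> 0" for i
      using not_less by blast
    then have "b i = 0" for i
      using b by (simp add: standard_simplex_def order_antisym)
    then have "(\<Sum>i\<le>p. b i) = 0"
      by simp
    then show False
      using b by (simp add: standard_simplex_def)
  qed
  with fin have "card ?S > 0"
    by (simp add: card_gt_0_iff)
  moreover have "b j < b i" if "i \<in> ?S" "j \<notin> ?S" for i j
    using that by auto
  ultimately have "leading_set (card ?S) b ?S"
    by (auto simp: leading_set_def)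
  then show ?thesis by blast
qed

lemma openin_leading_set:
  assumes S: "S \<subseteq> {..p}"
  shows "openin (subtopology (powertop_real UNIV) (standard_simplex p))
     {b \<in> standard_simplex p. leading_set k b S}"
    (is "openin ?X _")
proof (cases "card S = k \<and> k > 0")
  case True
  have fin: "finite S"
    using S by (rule finite_subset) simp
  have coord: "continuous_map ?X euclideanreal (\<lambda>b. b i)" for i
    by (intro continuous_map_from_subtopology continuous_map_product_projection) simp
  have top: "topspace ?X = standard_simplex p"
    by simp
  have o1: "openin ?X {b \<in> topspace ?X. b i \<in> {0<..}}" for i
    by (rule openin_continuous_map_preimage[OF coord]) simp
  have o2: "openin ?X {b \<in> topspace ?X. b i - b j \<in> {0<..}}" for i j
    by (rule openin_continuous_map_preimage[OF continuous_map_diff[OF coord coord]]) simp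
  have ne: "S \<noteq> {}" using True by auto
  \<comment> \<open>The factor \<open>topspace ?X\<close> covers the case that
    \<open>{..p} - S\<close> is empty.\<close>
  have o3: "openin ?X ((\<Inter>j\<in>{..p} - S. {b \<in> topspace ?X. b i - b j \<in> {0<..}}) \<inter> topspace ?X)" for i
    by (rule openin_INT) (rule finite_Diff[OF finite_atMost], rule o2)
  have "openin ?X (\<Inter>i\<in>S. {b \<in> topspace ?X. b i \<in> {0<..}} \<inter>
      ((\<Inter>j\<in>{..p} - S. {b \<in> topspace ?X. b i - b j \<in> {0<..}}) \<inter> topspace ?X))"
    by (rule openin_INT2[OF fin ne]) (rule openin_Int[OF o1 o3])
  also have "(\<Inter>i\<in>S. {b \<in> topspace ?X. b i \<in> {0<..}} \<inter>
      ((\<Inter>j\<in>{..p} - S. {b \<in> topspace ?X. b i - b j \<in> {0<..}}) \<inter> topspace ?X)) =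
      {b \<in> standard_simplex p. leading_set k b S}"
    using True ne by (auto simp: top leading_set_iff[OF _ S])
  finally show ?thesis .
next
  case False
  then have "{b \<in> standard_simplex p. leading_set k b S} = {}"
    by (auto simp: leading_set_def)
  then show ?thesis
    by (simp only: openin_empty)
qed

section \<open>Symmetric Delta-complexes\<close>

text \<open>Contravariant functoriality for all injections, not only the increasing ones.
  Permutations of \<open>{..p}\<close> thus act on \<open>C p\<close>, and a cell fixed by one of
  them is glued to itself.\<close>

locale symmetric_delta_complex =
  fixes C :: "nat \<Rightarrow> 'c set" and pull :: "nat \<Rightarrow> (nat \<Rightarrow> nat) \<Rightarrow> 'c \<Rightarrow> 'c"
  assumes pull_closed:
    "\<lbrakk>inj_on \<theta> {..p}; \<theta> ` {..p} \<subseteq> {..q}; c \<in> C q\<rbrakk> \<Longrightarrow> pull p \<theta> c \<in> C p"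
    and pull_pull:
    "\<lbrakk>inj_on \<eta> {..p}; \<eta> ` {..p} \<subseteq> {..q}; inj_on \<theta> {..q}; \<theta> ` {..q} \<subseteq> {..r}; c \<in> C r\<rbrakk>
      \<Longrightarrow> pull p \<eta> (pull q \<theta> c) = pull p (\<theta> \<circ> \<eta>) c"
begin

definition coproduct :: "(nat \<times> ('c \<times> (nat \<Rightarrow> real))) topology" where
  "coproduct = sum_topology
     (\<lambda>p. prod_topology (discrete_topology (C p))
            (subtopology (powertop_real UNIV) (standard_simplex p))) UNIV"

definition glued :: "nat \<times> ('c \<times> (nat \<Rightarrow> real)) \<Rightarrow> nat \<times> ('c \<times> (nat \<Rightarrow> real)) \<Rightarrow> bool" where
  "glued u v \<longleftrightarrow>
     (\<exists>p q \<theta> c a. inj_on \<theta> {..p} \<and> \<theta> ` {..p} \<subseteq> {..q} \<and> c \<in> C q \<and> a \<in> standard_simplex p \<and>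
        u = (q, c, push_simplex p \<theta> a) \<and> v = (p, pull p \<theta> c, a))"

definition point :: "nat \<times> ('c \<times> (nat \<Rightarrow> real)) \<Rightarrow> (nat \<times> ('c \<times> (nat \<Rightarrow> real))) set" where
  "point u = {v. equivclp glued u v}"

definition realization :: "(nat \<times> ('c \<times> (nat \<Rightarrow> real))) set topology" where
  "realization = quotient_topology coproduct point"

lemma topspace_coproduct:
  "(p, c, a) \<in> topspace coproduct \<longleftrightarrow> c \<in> C p \<and> a \<in> standard_simplex p"
  by (auto simp: coproduct_def)

lemma glued_topspace:
  "glued u v \<Longrightarrow> u \<in> topspace coproduct \<and> v \<in> topspace coproduct"
  by (auto simp: glued_def topspace_coproduct push_simplex_in_simplex pull_closed)

lemma point_eq_iff: "point u = point v \<longleftrightarrow> equivclp glued u v"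
proof
  assume *: "point u = point v"
  have "v \<in> point v"
    unfolding point_def mem_Collect_eq by (rule equivclp_refl)
  then show "equivclp glued u v"
    unfolding *[symmetric] by (simp only: point_def mem_Collect_eq)
next
  assume *: "equivclp glued u v"
  show "point u = point v"
    unfolding point_def
    using equivclp_trans[OF *] equivclp_trans[OF equivclp_sym[OF *]] by (intro Collect_cong iffI)
qed

lemma point_push:
  assumes "inj_on \<theta> {..p}" "\<theta> ` {..p} \<subseteq> {..q}" "c \<in> C q" "a \<in> standard_simplex p"
  shows "point (q, c, push_simplex p \<theta> a) = point (p, pull p \<theta> c, a)"
  unfolding point_eq_iff by (rule r_into_equivclp) (use assms in \<open>auto simp: glued_def\<close>)

text \<open>A relation with the properties of an equivalence need only be checked on single gluing
  steps. The premises \<open>point u = point v\<close> in the symmetric and transitive cases serve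
  statements such as \<open>path_hom\<close>, whose end point is written in terms of
  \<open>u\<close>.\<close>

lemma point_eq_induct [consumes 2, case_names refl sym trans glued]:
  assumes eq: "point u = point v" and u: "u \<in> topspace coproduct"
    and refl: "\<And>u. u \<in> topspace coproduct \<Longrightarrow> R u u"
    and sym: "\<And>u v. \<lbrakk>u \<in> topspace coproduct; v \<in> topspace coproduct; point u = point v; R u v\<rbrakk> \<Longrightarrow> R v u"
    and trans: "\<And>u v w. \<lbrakk>point u = point v; point v = point w; R u v; R v w\<rbrakk> \<Longrightarrow> R u w"
    and glued: "\<And>p q \<theta> c a. \<lbrakk>inj_on \<theta> {..p}; \<theta> ` {..p} \<subseteq> {..q}; c \<in> C q; a \<in> standard_simplex p\<rbrakk> \<Longrightarrow>
       R (q, c, push_simplex p \<theta> a) (p, pull p \<theta> c, a)"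
  shows "v \<in> topspace coproduct \<and> R u v"
proof -
  have "equivclp glued u v"
    using eq by (simp add: point_eq_iff)
  then show ?thesis
  proof (induction rule: equivclp_induct)
    case base
    then show ?case using u refl by simp
  next
    case (step v w)
    have vw: "v \<in> topspace coproduct" "w \<in> topspace coproduct" "point v = point w"
      using step(2) glued_topspace[of v w] glued_topspace[of w v]
      by (auto simp: point_eq_iff intro: equivclp_sym)
    have *: "glued x y \<Longrightarrow> R x y" for x y
      unfolding glued_def using glued by blast
    have "R v w"
      using step(2) *[of v w] *[of w v] sym[of w v] vw by auto
    moreover have "point u = point v"
      using step(1) by (simp add: point_eq_iff)
    ultimately show ?case
      using trans[of u v w] vw step(3) by blast
  qed
qed

lemma quotient_map_point: "quotient_map coproduct realization point"
  unfolding realization_def by (rule quotient_map_quotient_topology)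

lemma topspace_realization: "topspace realization = point ` topspace coproduct"
  by (simp add: realization_def)

lemma point_in_realization:
  "c \<in> C p \<Longrightarrow> a \<in> standard_simplex p \<Longrightarrow> point (p, c, a) \<in> topspace realization"
  by (auto simp: topspace_realization topspace_coproduct)

lemma continuous_map_into_cell:
  assumes h: "continuous_map Y (powertop_real UNIV) h"
    and s: "\<And>y. y \<in> topspace Y \<Longrightarrow> h y \<in> standard_simplex p" and c: "c \<in> C p"
  shows "continuous_map Y realization (\<lambda>y. point (p, c, h y))"
proof -
  let ?X = "\<lambda>p. prod_topology (discrete_topology (C p))
            (subtopology (powertop_real UNIV) (standard_simplex p))"
  have "continuous_map Y (?X p) (\<lambda>y. (c, h y))"
    using assms by (auto simp: continuous_map_pairwise o_def continuous_map_in_subtopology)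
  moreover have "continuous_map (?X p) coproduct (\<lambda>x. (p, x))"
    unfolding coproduct_def using continuous_map_component_injection[of p UNIV ?X] by simp
  ultimately have "continuous_map Y coproduct ((\<lambda>x. (p, x)) \<circ> (\<lambda>y. (c, h y)))"
    by (rule continuous_map_compose)
  from continuous_map_compose[OF this quotient_imp_continuous_map[OF quotient_map_point]]
  show ?thesis
    by (simp add: o_def)
qed

definition segment :: "nat \<Rightarrow> 'c \<Rightarrow> (nat \<Rightarrow> real) \<Rightarrow> (nat \<Rightarrow> real) \<Rightarrow> real \<Rightarrow>
    (nat \<times> ('c \<times> (nat \<Rightarrow> real))) set" where
  "segment p c a b = (\<lambda>t. point (p, c, \<lambda>i. (1 - t) * a i + t * b i))"

lemma segment_path:
  assumes "c \<in> C p" "a \<in> standard_simplex p" "b \<in> standard_simplex p"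
  shows "path_from_to realization (point (p, c, a)) (point (p, c, b)) (segment p c a b)"
  unfolding path_from_to_def pathin_def segment_def
  using assms
  by (auto intro!: continuous_map_into_cell convex_standard_simplex continuous_intros
      simp: continuous_map_componentwise_UNIV)

text \<open>A plane triangle maps affinely into the simplex with corners going to \<open>a\<close>,
  \<open>b\<close> and \<open>d\<close>; there the two sides and the third side are paths in a
  convex set.\<close>

lemma segment_triangle:
  assumes c: "c \<in> C p"
    and a: "a \<in> standard_simplex p" and b: "b \<in> standard_simplex p" and d: "d \<in> standard_simplex p"
  shows "path_hom realization (point (p, c, a)) (point (p, c, d))
     (path_join (segment p c a b) (segment p c b d)) (segment p c a d)"
proof -
  let ?C = "{u::real\<times>real. 0 \<le> fst u \<and> 0 \<le> snd u \<and> fst u + snd u \<le> 1}"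
  let ?h = "\<lambda>u::real\<times>real. \<lambda>i. (1 - fst u - snd u) * a i + fst u * b i + snd u * d i"
  let ?F = "\<lambda>u. point (p, c, ?h u)"
  have cv: "convex ?C"
  proof -
    have "?C = {u. 0 \<le> (1, 0) \<bullet> u} \<inter> {u. 0 \<le> (0, 1) \<bullet> u} \<inter> {u. (1, 1) \<bullet> u \<le> 1}"
      by (auto simp: inner_prod_def)
    then show ?thesis
      by (simp add: convex_Int convex_halfspace_le convex_halfspace_ge)
  qed
  have s: "?h u \<in> standard_simplex p" if "u \<in> ?C" for u
  proof -
    have nn: "0 \<le> ?h u i" for i
      using that a b d by (auto simp: standard_simplex_def intro!: add_nonneg_nonneg mult_nonneg_nonneg)
    have sum: "(\<Sum>i\<le>p. ?h u i) = 1"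
      using a b d by (simp add: standard_simplex_def sum.distrib flip: sum_distrib_left)
    have z: "?h u i = 0" if "i > p" for i
      using a b d that by (simp add: standard_simplex_def)
    have "?h u i \<le> 1" for i
    proof (cases "i \<le> p")
      case True
      then show ?thesis
        using member_le_sum[of i "{..p}" "?h u"] nn sum by simp
    qed (use z[of i] in simp)
    then show ?thesis
      using nn sum z by (simp add: standard_simplex_def)
  qed
  have F: "continuous_map (top_of_set ?C) realization ?F"
    by (rule continuous_map_into_cell[OF _ s c])
       (auto simp: continuous_map_componentwise_UNIV intro!: continuous_intros)
  let ?p = "linepath (0,0) (1,0) +++ linepath (1,0) (0,1) :: real \<Rightarrow> real \<times> real"
  let ?q = "linepath (0,0) (0,1) :: real \<Rightarrow> real \<times> real"
  have "path_hom realization (point (p, c, a)) (point (p, c, d)) (?F \<circ> ?p) (?F \<circ> ?q)"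
  proof (rule path_hom_convex[OF cv F])
    show "path_image ?p \<subseteq> ?C"
      by (intro subset_path_image_join; unfold path_image_linepath;
          rule closed_segment_subset[OF _ _ cv]) auto
    show "path_image ?q \<subseteq> ?C"
      unfolding path_image_linepath by (rule closed_segment_subset[OF _ _ cv]) auto
  qed auto
  moreover have "?F \<circ> ?q = segment p c a d"
    by (simp add: segment_def linepath_def o_def fun_eq_iff)
  moreover have "?F \<circ> ?p = path_join (segment p c a b) (segment p c b d)"
    unfolding path_join_comp[symmetric]
    by (simp add: segment_def linepath_def o_def fun_eq_iff algebra_simps)
  ultimately show ?thesis by simp
qed

lemma segment_push:
  assumes \<theta>: "inj_on \<theta> {..p}" "\<theta> ` {..p} \<subseteq> {..q}" and c: "c \<in> C q"
    and a: "a \<in> standard_simplex p" and b: "b \<in> standard_simplex p"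
  shows "path_hom realization
      (point (q, c, push_simplex p \<theta> a)) (point (q, c, push_simplex p \<theta> b))
      (segment q c (push_simplex p \<theta> a) (push_simplex p \<theta> b)) (segment p (pull p \<theta> c) a b)"
proof (rule path_hom_eqI)
  show "path_from_to realization (point (q, c, push_simplex p \<theta> a)) (point (q, c, push_simplex p \<theta> b))
      (segment q c (push_simplex p \<theta> a) (push_simplex p \<theta> b))"
    by (intro segment_path push_simplex_in_simplex assms)
  fix t :: real assume "0 \<le> t" "t \<le> 1"
  then have "(\<lambda>i. (1 - t) * a i + t * b i) \<in> standard_simplex p"
    by (intro convex_standard_simplex a b)
  from point_push[OF \<theta> c this]
  show "segment q c (push_simplex p \<theta> a) (push_simplex p \<theta> b) t = segment p (pull p \<theta> c) a b t"
    by (simp add: segment_def push_simplex_affine)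
qed

lemma segment_rev: "path_rev (segment p c a b) = segment p c b a"
  by (simp add: path_rev_def segment_def add.commute)

definition cell_vertex :: "'c \<Rightarrow> nat \<Rightarrow> 'c" where
  "cell_vertex c i = pull 0 (\<lambda>_. i) c"

definition vertex_point :: "'c \<Rightarrow> (nat \<times> ('c \<times> (nat \<Rightarrow> real))) set" where
  "vertex_point d = point (0, d, vert 0)"

lemma cell_vertex_closed: "c \<in> C p \<Longrightarrow> i \<le> p \<Longrightarrow> cell_vertex c i \<in> C 0"
  unfolding cell_vertex_def by (rule pull_closed) auto

lemma cell_vertex_pull:
  assumes "inj_on \<theta> {..p}" "\<theta> ` {..p} \<subseteq> {..q}" "c \<in> C q" "i \<le> p"
  shows "cell_vertex (pull p \<theta> c) i = cell_vertex c (\<theta> i)"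
  unfolding cell_vertex_def
  by (subst pull_pull[OF _ _ assms(1-3)]) (use assms in \<open>auto simp: o_def\<close>)

lemma point_vertex:
  assumes "c \<in> C p" "i \<le> p"
  shows "point (p, c, vert i) = vertex_point (cell_vertex c i)"
proof -
  have "push_simplex 0 (\<lambda>_. i) (vert 0) = vert i"
    by (rule push_simplex_vert) auto
  then show ?thesis
    unfolding vertex_point_def cell_vertex_def
    using point_push[of "\<lambda>_. i" 0 p c "vert 0"] assms by (simp add: vert_in_simplex)
qed

end

section \<open>Open pieces of the realization and their straight-line contractions\<close>

context symmetric_delta_complex
begin

text \<open>The piece lies before gluing, but its label \<open>z\<close> is a point after gluing: it
  gathers, from all cells, the points whose leading face has its barycentre at
  \<open>z\<close>.\<close>

definition contractible_piece :: "nat \<Rightarrow> (nat \<times> ('c \<times> (nat \<Rightarrow> real))) set \<Rightarrow>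
    (nat \<times> ('c \<times> (nat \<Rightarrow> real))) set" where
  "contractible_piece k z = {(p, c, b). c \<in> C p \<and> b \<in> standard_simplex p \<and>
     (\<exists>S. leading_set k b S \<and> point (p, c, barycentre S) = z)}"

lemma point_barycentre_push:
  assumes \<theta>: "inj_on \<theta> {..p}" "\<theta> ` {..p} \<subseteq> {..q}" "c \<in> C q"
    and b: "b \<in> standard_simplex p" and S: "leading_set k b S"
  shows "point (q, c, barycentre (\<theta> ` S)) = point (p, pull p \<theta> c, barycentre S)"
proof -
  have sub: "S \<subseteq> {..p}" "S \<noteq> {}"
    using leading_set_subset[OF b S] leading_set_finite[OF S] by auto
  show ?thesis
    unfolding barycentre_push[OF \<theta>(1) sub(1), symmetric]
    by (rule point_push[OF \<theta> barycentre_in_simplex[OF sub]])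
qed

text \<open>Face inclusions match leading sets and their barycentres in both directions, so the
  piece is a union of fibres of \<open>point\<close>.\<close>

lemma contractible_piece_saturated:
  assumes "point u = point v" "u \<in> contractible_piece k z"
  shows "v \<in> contractible_piece k z"
proof -
  have "u \<in> topspace coproduct"
    using assms(2) by (auto simp: contractible_piece_def topspace_coproduct)
  with assms(1) have "v \<in> topspace coproduct \<and>
      (u \<in> contractible_piece k z \<longleftrightarrow> v \<in> contractible_piece k z)"
  proof (induction rule: point_eq_induct)
    case (glued p q \<theta> c a)
    note g = \<open>inj_on \<theta> {..p}\<close> \<open>\<theta> ` {..p} \<subseteq> {..q}\<close> \<open>c \<in> C q\<close> \<open>a \<in> standard_simplex p\<close>
    have pc: "pull p \<theta> c \<in> C p" and pa: "push_simplex p \<theta> a \<in> standard_simplex q"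
      using g by (auto intro: pull_closed push_simplex_in_simplex)
    have "(\<exists>S. leading_set k (push_simplex p \<theta> a) S \<and> point (q, c, barycentre S) = z) \<longleftrightarrow>
       (\<exists>S. leading_set k a S \<and> point (p, pull p \<theta> c, barycentre S) = z)"
    proof
      assume "\<exists>S. leading_set k (push_simplex p \<theta> a) S \<and> point (q, c, barycentre S) = z"
      then obtain S where S: "leading_set k (push_simplex p \<theta> a) S" "point (q, c, barycentre S) = z"
        by blast
      obtain S' where "leading_set k a S'" "S = \<theta> ` S'"
        by (rule leading_set_pushD[OF g(1,2,4) S(1)])
      then show "\<exists>S. leading_set k a S \<and> point (p, pull p \<theta> c, barycentre S) = z"
        using point_barycentre_push[OF g(1-4)] S(2) by auto
    next
      assume "\<exists>S. leading_set k a S \<and> point (p, pull p \<theta> c, barycentre S) = z"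
      then show "\<exists>S. leading_set k (push_simplex p \<theta> a) S \<and> point (q, c, barycentre S) = z"
        using leading_set_push[OF g(1,4)] point_barycentre_push[OF g(1-4)] by metis
    qed
    then show ?case
      using g pc pa by (simp add: contractible_piece_def)
  qed auto
  then show ?thesis
    using assms(2) by simp
qed

lemma openin_face_cell:
  assumes "c \<in> C p" "S \<subseteq> {..p}"
  shows "openin coproduct ({p} \<times> ({c} \<times> {b \<in> standard_simplex p. leading_set k b S}))"
proof -
  have "openin (prod_topology (discrete_topology (C p))
        (subtopology (powertop_real UNIV) (standard_simplex p)))
      ({c} \<times> {b \<in> standard_simplex p. leading_set k b S})"
    using assms openin_leading_set[of S p k] by (auto simp: openin_prod_Times_iff)
  moreover have "{x. (i, x) \<in> {p} \<times> ({c} \<times> {b \<in> standard_simplex p. leading_set k b S})} =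
      (if i = p then {c} \<times> {b \<in> standard_simplex p. leading_set k b S} else {})" for i
    by auto
  ultimately show ?thesis
    unfolding coproduct_def openin_sum_topology using assms(1) by auto
qed

lemma contractible_piece_Union:
  "contractible_piece k z =
     (\<Union>(p, c, S) \<in> {(p, c, S). c \<in> C p \<and> S \<subseteq> {..p} \<and> point (p, c, barycentre S) = z}.
        {p} \<times> ({c} \<times> {b \<in> standard_simplex p. leading_set k b S}))"
  (is "_ = ?R")
proof (intro Set.set_eqI iffI)
  fix u assume "u \<in> contractible_piece k z"
  then obtain p c b S where u: "u = (p, c, b)" "c \<in> C p" "b \<in> standard_simplex p"
      "leading_set k b S" "point (p, c, barycentre S) = z"
    by (auto simp: contractible_piece_def)
  with leading_set_subset[OF u(3,4)] show "u \<in> ?R"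
    by (intro UN_I[of "(p, c, S)"]) auto
qed (auto simp: contractible_piece_def)

lemma openin_contractible_piece: "openin coproduct (contractible_piece k z)"
  unfolding contractible_piece_Union
  by (intro openin_Union) (auto intro: openin_face_cell)

lemma vimage_point_piece:
  "{u \<in> topspace coproduct. point u \<in> point ` contractible_piece k z} = contractible_piece k z"
proof (intro Set.set_eqI iffI)
  fix u assume "u \<in> {u \<in> topspace coproduct. point u \<in> point ` contractible_piece k z}"
  then obtain v where "v \<in> contractible_piece k z" "point v = point u"
    by auto
  then show "u \<in> contractible_piece k z"
    using contractible_piece_saturated by blast
next
  fix u assume "u \<in> contractible_piece k z"
  then show "u \<in> {u \<in> topspace coproduct. point u \<in> point ` contractible_piece k z}"
    using openin_subset[OF openin_contractible_piece] by blast
qed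

lemma openin_point_piece: "openin realization (point ` contractible_piece k z)"
proof -
  have sub: "contractible_piece k z \<subseteq> topspace coproduct"
    by (rule openin_subset[OF openin_contractible_piece])
  then show ?thesis
    unfolding realization_def openin_quotient_topology vimage_point_piece
    using openin_contractible_piece by blast
qed

definition piece_homotopy :: "nat \<Rightarrow> (nat \<times> ('c \<times> (nat \<Rightarrow> real))) \<times> real \<Rightarrow>
    (nat \<times> ('c \<times> (nat \<Rightarrow> real))) set" where
  "piece_homotopy k =
     (\<lambda>((p, c, b), s). segment p c b (barycentre (THE S. leading_set k b S)) s)"

lemma piece_homotopy_eq:
  "leading_set k b S \<Longrightarrow> piece_homotopy k ((p, c, b), s) = segment p c b (barycentre S) s"
  by (simp add: piece_homotopy_def the_leading_set)

text \<open>The barycentre aimed at is determined by \<open>b\<close> alone and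
  \<open>push_simplex\<close> is affine, so whole segments are glued and not only their
  ends.\<close>

lemma piece_homotopy_respects:
  assumes "point u = point v" "u \<in> contractible_piece k z" and s: "0 \<le> s" "s \<le> 1"
  shows "piece_homotopy k (u, s) = piece_homotopy k (v, s)"
proof -
  have "u \<in> topspace coproduct"
    using assms(2) by (auto simp: contractible_piece_def topspace_coproduct)
  with assms(1) have "v \<in> topspace coproduct \<and>
      (\<forall>z. u \<in> contractible_piece k z \<longrightarrow> piece_homotopy k (u, s) = piece_homotopy k (v, s))"
  proof (induction rule: point_eq_induct)
    case (sym u v)
    then show ?case
      using contractible_piece_saturated by metis
  next
    case (trans u v w)
    then show ?case
      using contractible_piece_saturated by metis
  next
    case (glued p q \<theta> c a)
    note g = \<open>inj_on \<theta> {..p}\<close> \<open>\<theta> ` {..p} \<subseteq> {..q}\<close> \<open>c \<in> C q\<close> \<open>a \<in> standard_simplex p\<close>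
    show ?case
    proof (intro allI impI)
      fix z assume "(q, c, push_simplex p \<theta> a) \<in> contractible_piece k z"
      then obtain S where S: "leading_set k (push_simplex p \<theta> a) S"
        by (auto simp: contractible_piece_def)
      obtain S' where S': "leading_set k a S'" "S = \<theta> ` S'"
        by (rule leading_set_pushD[OF g(1,2,4) S])
      have sub: "S' \<subseteq> {..p}" "S' \<noteq> {}"
        using leading_set_subset[OF g(4) S'(1)] leading_set_finite[OF S'(1)] by auto
      have "(\<lambda>i. (1 - s) * a i + s * barycentre S' i) \<in> standard_simplex p"
        by (intro convex_standard_simplex g barycentre_in_simplex sub s)
      from point_push[OF g(1-3) this]
      show "piece_homotopy k ((q, c, push_simplex p \<theta> a), s) =
          piece_homotopy k ((p, pull p \<theta> c, a), s)"
        unfolding piece_homotopy_eq[OF S] piece_homotopy_eq[OF S'(1)]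
        by (simp add: segment_def push_simplex_affine S'(2) barycentre_push[OF g(1) sub(1)])
    qed
  qed auto
  then show ?thesis
    using assms(2) by blast
qed

lemma continuous_map_coordinate:
  "continuous_map coproduct euclideanreal (\<lambda>u. snd (snd u) i)"
  unfolding continuous_map_def
proof (intro conjI allI impI)
  fix W :: "real set" assume W: "openin euclideanreal W"
  have "openin (prod_topology (discrete_topology (C p))
        (subtopology (powertop_real UNIV) (standard_simplex p)))
      {x. (p, x) \<in> {u \<in> topspace coproduct. snd (snd u) i \<in> W}}" (is "openin ?X _") for p
  proof -
    have "continuous_map ?X euclideanreal (\<lambda>x. snd x i)"
      by (intro continuous_map_of_snd[THEN iffD2, unfolded o_def] disjI2
          continuous_map_from_subtopology continuous_map_product_projection) simp
    from openin_continuous_map_preimage[OF this W]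
    have "openin ?X {x \<in> topspace ?X. snd x i \<in> W}" .
    also have "{x \<in> topspace ?X. snd x i \<in> W} =
        {x. (p, x) \<in> {u \<in> topspace coproduct. snd (snd u) i \<in> W}}"
      by (auto simp: topspace_coproduct)
    finally show ?thesis .
  qed
  then show "openin coproduct {u \<in> topspace coproduct. snd (snd u) i \<in> W}"
    unfolding coproduct_def openin_sum_topology by (auto simp: standard_simplex_def)
qed auto

lemma continuous_map_piece_homotopy:
  "continuous_map (prod_topology (subtopology coproduct (contractible_piece k z)) (top_of_set {0..1}))
     realization (piece_homotopy k)"
  (is "continuous_map ?Y _ _")
proof -
  let ?I = "{(p, c, S). c \<in> C p \<and> S \<subseteq> {..p} \<and> point (p, c, barycentre S) = z}"
  let ?B = "\<lambda>(p, c, S). {p} \<times> ({c} \<times> {b \<in> standard_simplex p. leading_set k b S})"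
  let ?f = "\<lambda>(p, c, S) (u, s). point (p, c, \<lambda>i. (1 - s) * snd (snd u) i + s * barycentre S i)"
  have top: "topspace ?Y = contractible_piece k z \<times> {0..1}"
    using openin_subset[OF openin_contractible_piece] by auto
  show ?thesis
  \<comment> \<open>On the part of a cell where a fixed \<open>S\<close> leads, the description
    operator in \<open>piece_homotopy\<close> is constant. These parts are open and cover the piece,
    and by uniqueness of leading sets the formulas agree on overlaps.\<close>
  proof (rule pasting_lemma[where I = ?I and T = "\<lambda>i. ?B i \<times> {0..1}" and f = ?f])
    fix i assume "i \<in> ?I"
    then obtain p c S where i: "i = (p, c, S)" "c \<in> C p" "S \<subseteq> {..p}" "point (p, c, barycentre S) = z"
      by auto
    have "openin coproduct (?B i)"
      using i openin_face_cell by simp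
    moreover have "?B i \<subseteq> contractible_piece k z"
      using i by (auto simp: contractible_piece_def)
    ultimately have "openin (subtopology coproduct (contractible_piece k z)) (?B i)"
      by (rule openin_open_subtopology[OF openin_contractible_piece, THEN iffD2, OF conjI])
    then show "openin ?Y (?B i \<times> {0..1})"
      by (simp add: openin_prod_Times_iff)
    let ?Z = "subtopology ?Y (?B i \<times> {0..1})"
    have coord: "continuous_map ?Z euclideanreal (\<lambda>y. snd (snd (fst y)) j)" for j
      by (intro continuous_map_from_subtopology
          continuous_map_of_fst[THEN iffD2, unfolded o_def] disjI2 continuous_map_coordinate)
    have time: "continuous_map ?Z euclideanreal (\<lambda>y. snd y)"
      by (intro continuous_map_from_subtopology
          continuous_map_into_fulltopology[OF continuous_map_snd])
    have "continuous_map ?Z realization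
       (\<lambda>y. point (p, c, \<lambda>j. (1 - snd y) * snd (snd (fst y)) j + snd y * barycentre S j))"
    proof (rule continuous_map_into_cell[OF _ _ i(2)])
      show "continuous_map ?Z (powertop_real UNIV)
         (\<lambda>y j. (1 - snd y) * snd (snd (fst y)) j + snd y * barycentre S j)"
        unfolding continuous_map_componentwise_UNIV
        by (intro allI continuous_map_add continuous_map_real_mult continuous_map_diff
            coord time) auto
      fix y assume "y \<in> topspace ?Z"
      then obtain b s where y: "y = ((p, c, b), s)" "b \<in> standard_simplex p" "leading_set k b S"
          "0 \<le> s" "s \<le> 1"
        using i by auto
      have "S \<noteq> {}"
        using leading_set_finite[OF y(3)] by simp
      then show "(\<lambda>j. (1 - snd y) * snd (snd (fst y)) j + snd y * barycentre S j) \<in> standard_simplex p"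
        using y i by (auto intro!: convex_standard_simplex barycentre_in_simplex)
    qed
    then show "continuous_map ?Z realization (?f i)"
      by (simp add: i case_prod_unfold)
  next
    fix i j y assume "i \<in> ?I" "j \<in> ?I" and y: "y \<in> topspace ?Y \<inter> ?B i \<times> {0..1} \<inter> ?B j \<times> {0..1}"
    then obtain p c S p' c' S' b s where "i = (p, c, S)" "j = (p', c', S')" "y = ((p, c, b), s)"
        "p' = p" "c' = c" "leading_set k b S" "leading_set k b S'"
      by auto
    moreover from this have "S' = S"
      using leading_set_unique by blast
    ultimately show "?f i y = ?f j y" by simp
  next
    fix y assume "y \<in> topspace ?Y"
    then obtain p c b s S where y: "y = ((p, c, b), s)" "c \<in> C p" "b \<in> standard_simplex p"
        "leading_set k b S" "point (p, c, barycentre S) = z" "s \<in> {0..1}"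
      unfolding top by (auto simp: contractible_piece_def)
    have "(p, c, S) \<in> ?I" "y \<in> ?B (p, c, S) \<times> {0..1}"
      using y leading_set_subset[OF y(3,4)] by auto
    moreover have "piece_homotopy k y = ?f (p, c, S) y"
      unfolding y(1) piece_homotopy_eq[OF y(4)] by (simp add: segment_def)
    ultimately show "\<exists>j. j \<in> ?I \<and> y \<in> ?B j \<times> {0..1} \<and> piece_homotopy k y = ?f j y"
      by blast
  qed
qed

lemma realization_locally_contractible:
  assumes x: "x \<in> topspace realization"
  obtains U H z where "openin realization U" "x \<in> U"
    "continuous_map (prod_topology (subtopology realization U) (top_of_set {0..1})) realization H"
    "\<And>y. y \<in> U \<Longrightarrow> H (y, 0) = y \<and> H (y, 1) = z \<and>
      (\<exists>p c a b. c \<in> C p \<and> a \<in> standard_simplex p \<and> b \<in> standard_simplex p \<and>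
         (\<forall>t \<in> {0..1}. H (y, t) = segment p c a b t))"
proof -
  obtain p c b where u: "x = point (p, c, b)" "c \<in> C p" "b \<in> standard_simplex p"
    using x by (auto simp: topspace_realization topspace_coproduct)
  obtain k S where S: "leading_set k b S"
    using leading_set_exists[OF u(3)] by blast
  define z where "z = point (p, c, barycentre S)"
  let ?V = "contractible_piece k z"
  let ?U = "point ` ?V"
  \<comment> \<open>Any representative will do, since \<open>piece_homotopy\<close> takes the same
    value on all of them.\<close>
  define H where "H = (\<lambda>(y, s). piece_homotopy k (SOME u. u \<in> ?V \<and> point u = y, s))"
  have H: "H (point u, s) = piece_homotopy k (u, s)" if "u \<in> ?V" "s \<in> {0..1}" for u s
  proof -
    have "\<exists>v. v \<in> ?V \<and> point v = point u"
      using that by blast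
    from someI_ex[OF this]
    have "piece_homotopy k (SOME v. v \<in> ?V \<and> point v = point u, s) = piece_homotopy k (u, s)"
      using that(2) by (intro piece_homotopy_respects) auto
    then show ?thesis
      by (simp only: H_def prod.case)
  qed
  have "quotient_map (subtopology coproduct ?V) (subtopology realization ?U) point"
    by (rule quotient_map_restriction[OF quotient_map_point vimage_point_piece])
       (simp add: openin_point_piece)
  \<comment> \<open>The product of a quotient map with the compact interval is again a quotient map,
    so continuity of \<open>H\<close> can be checked before gluing.\<close>
  then have q: "quotient_map (prod_topology (subtopology coproduct ?V) (top_of_set {0..1::real}))
      (prod_topology (subtopology realization ?U) (top_of_set {0..1})) (\<lambda>(u, s). (point u, s))"
  proof (rule quotient_map_prod_left[rotated 2])
    have "compact_space (top_of_set {0..1::real})"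
      by (rule compact_space_subtopology) simp
    then show "locally_compact_space (top_of_set {0..1::real})"
      by (intro compact_imp_locally_compact_space)
    show "Hausdorff_space (top_of_set {0..1::real}) \<or> regular_space (top_of_set {0..1::real})"
      by (intro disjI1 Hausdorff_space_subtopology[OF Hausdorff_space_euclidean])
  qed
  have cont: "continuous_map (prod_topology (subtopology realization ?U) (top_of_set {0..1})) realization H"
  proof (rule continuous_compose_quotient_map[OF q])
    show "continuous_map (prod_topology (subtopology coproduct ?V) (top_of_set {0..1})) realization
        (H \<circ> (\<lambda>(u, s). (point u, s)))"
      by (rule continuous_map_eq[OF continuous_map_piece_homotopy]) (auto simp: H)
  qed
  show thesis
  proof (rule that[OF openin_point_piece _ cont])
    have "(p, c, b) \<in> ?V"
      using u S z_def by (auto simp: contractible_piece_def)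
    then show "x \<in> ?U"
      using u(1) by blast
    fix y assume "y \<in> ?U"
    then obtain p' c' b' where y: "y = point (p', c', b')" "(p', c', b') \<in> ?V"
      by auto
    then obtain S' where v: "y = point (p', c', b')" "c' \<in> C p'" "b' \<in> standard_simplex p'"
        "leading_set k b' S'" "point (p', c', barycentre S') = z" "(p', c', b') \<in> ?V"
      by (auto simp: contractible_piece_def)
    have "H (y, t) = segment p' c' b' (barycentre S') t" if "t \<in> {0..1}" for t
      using H[OF v(6) that] v by (simp add: piece_homotopy_eq)
    moreover have "barycentre S' \<in> standard_simplex p'"
      using leading_set_subset[OF v(3,4)] leading_set_finite[OF v(4)]
      by (intro barycentre_in_simplex) auto
    ultimately show "H (y, 0) = y \<and> H (y, 1) = z \<and>
      (\<exists>p c a b. c \<in> C p \<and> a \<in> standard_simplex p \<and> b \<in> standard_simplex p \<and>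
         (\<forall>t \<in> {0..1}. H (y, t) = segment p c a b t))"
      using v by (auto simp: segment_def)
  qed
qed

end

section \<open>Paths to the vertices, and simple connectedness from the 1-cells\<close>

locale vertex_paths = symmetric_delta_complex C pull
  for C :: "nat \<Rightarrow> 'c set" and pull +
  fixes d0 :: 'c and Q :: "'c \<Rightarrow> real \<Rightarrow> (nat \<times> ('c \<times> (nat \<Rightarrow> real))) set"
  assumes d0: "d0 \<in> C 0"
    and Q: "d \<in> C 0 \<Longrightarrow> path_from_to realization (vertex_point d0) (vertex_point d) (Q d)"
begin

text \<open>The transport condition for the edge from vertex \<open>i\<close> to vertex
  \<open>j\<close> of a cell. On the vertices of one cell it is an equivalence relation, as the next
  lemmas show.\<close>

definition good :: "nat \<Rightarrow> 'c \<Rightarrow> nat \<Rightarrow> nat \<Rightarrow> bool" where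
  "good p c i j \<longleftrightarrow> path_hom realization (vertex_point d0) (vertex_point (cell_vertex c j))
     (path_join (Q (cell_vertex c i)) (segment p c (vert i) (vert j))) (Q (cell_vertex c j))"

lemma Q_vertex:
  "c \<in> C p \<Longrightarrow> i \<le> p \<Longrightarrow>
     path_from_to realization (vertex_point d0) (vertex_point (cell_vertex c i)) (Q (cell_vertex c i))"
  by (intro Q cell_vertex_closed)

lemma segment_vertices:
  "c \<in> C p \<Longrightarrow> i \<le> p \<Longrightarrow> j \<le> p \<Longrightarrow> path_from_to realization
     (vertex_point (cell_vertex c i)) (vertex_point (cell_vertex c j)) (segment p c (vert i) (vert j))"
  using segment_path[of c p "vert i" "vert j"] by (simp add: vert_in_simplex point_vertex)

lemma good_refl:
  assumes "c \<in> C p" "i \<le> p"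
  shows "good p c i i"
proof -
  have "(\<lambda>l. (1 - t) * vert i l + t * vert i l) = vert i" for t
    by (simp add: algebra_simps)
  then have "segment p c (vert i) (vert i) = (\<lambda>_. vertex_point (cell_vertex c i))"
    by (simp add: segment_def point_vertex[OF assms])
  then show ?thesis
    unfolding good_def using path_hom_const_right[OF Q_vertex[OF assms]] by simp
qed

lemma good_sym:
  assumes c: "c \<in> C p" "i \<le> p" "j \<le> p" and g: "good p c i j"
  shows "good p c j i"
proof -
  have "path_hom realization (vertex_point d0) (vertex_point (cell_vertex c i))
      (path_join (Q (cell_vertex c j)) (path_rev (segment p c (vert i) (vert j)))) (Q (cell_vertex c i))"
    by (rule path_hom_cancel_right[OF g[unfolded good_def] Q_vertex segment_vertices]) (use c in auto)
  then show ?thesis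
    by (simp add: good_def segment_rev)
qed

text \<open>The three edges bound a triangle in the cell, so the edge from \<open>i\<close> to
  \<open>k\<close> may be replaced by the detour through \<open>j\<close>.\<close>

lemma good_trans:
  assumes c: "c \<in> C p" "i \<le> p" "j \<le> p" "k \<le> p" and g: "good p c i j" "good p c j k"
  shows "good p c i k"
proof -
  let ?s = "\<lambda>i j. segment p c (vert i) (vert j)" and ?v = "\<lambda>i. vertex_point (cell_vertex c i)"
    and ?Q = "\<lambda>i. Q (cell_vertex c i)"
  have "path_hom realization (?v i) (?v k) (path_join (?s i j) (?s j k)) (?s i k)"
    using segment_triangle[of c p "vert i" "vert j" "vert k"] c by (simp add: vert_in_simplex point_vertex)
  from path_hom_sym[OF this]
  have "path_hom realization (vertex_point d0) (?v k) (path_join (?Q i) (?s i k))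
      (path_join (?Q i) (path_join (?s i j) (?s j k)))"
    by (rule path_hom_join_left[OF Q_vertex[OF c(1,2)]])
  also have "path_hom realization (vertex_point d0) (?v k) \<dots> (path_join (path_join (?Q i) (?s i j)) (?s j k))"
    by (rule path_hom_assoc[OF Q_vertex[OF c(1,2)] segment_vertices[OF c(1-3)] segment_vertices[OF c(1,3,4)]])
  also have "path_hom realization (vertex_point d0) (?v k) \<dots> (path_join (?Q j) (?s j k))"
    by (rule path_hom_join_right[OF g(1)[unfolded good_def] segment_vertices[OF c(1,3,4)]])
  also have "path_hom realization (vertex_point d0) (?v k) \<dots> (?Q k)"
    using g(2) by (simp add: good_def)
  finally show ?thesis by (simp add: good_def)
qed

text \<open>Moves the condition between a cell and its faces; this is how different 1-cells are
  compared inside a common 2-cell.\<close>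

lemma good_pull:
  assumes \<theta>: "inj_on \<theta> {..p}" "\<theta> ` {..p} \<subseteq> {..q}" and c: "c \<in> C q" and ij: "i \<le> p" "j \<le> p"
  shows "good p (pull p \<theta> c) i j \<longleftrightarrow> good q c (\<theta> i) (\<theta> j)"
proof -
  have le: "\<theta> i \<le> q" "\<theta> j \<le> q"
    using \<theta> ij by auto
  have v: "cell_vertex (pull p \<theta> c) i = cell_vertex c (\<theta> i)"
      "cell_vertex (pull p \<theta> c) j = cell_vertex c (\<theta> j)"
    using cell_vertex_pull[OF \<theta> c] ij by auto
  have "path_hom realization (vertex_point (cell_vertex c (\<theta> i))) (vertex_point (cell_vertex c (\<theta> j)))
      (segment q c (vert (\<theta> i)) (vert (\<theta> j))) (segment p (pull p \<theta> c) (vert i) (vert j))"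
    using segment_push[OF \<theta> c, of "vert i" "vert j"] ij le
    by (simp add: vert_in_simplex push_simplex_vert[OF \<theta>(1)] point_vertex[OF c])
  then have *: "path_hom realization (vertex_point d0) (vertex_point (cell_vertex c (\<theta> j)))
      (path_join (Q (cell_vertex c (\<theta> i))) (segment q c (vert (\<theta> i)) (vert (\<theta> j))))
      (path_join (Q (cell_vertex c (\<theta> i))) (segment p (pull p \<theta> c) (vert i) (vert j)))"
    by (rule path_hom_join_left[OF Q_vertex[OF c le(1)]])
  show ?thesis
    unfolding good_def v using path_hom_trans[OF *] path_hom_trans[OF path_hom_sym[OF *]] by blast
qed

end

locale simply_connected_complex = vertex_paths +
  assumes edges: "c \<in> C 1 \<Longrightarrow> good 1 c 0 1"
begin

lemma good_all:
  assumes c: "c \<in> C p" and "i \<le> p" "j \<le> p"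
  shows "good p c i j"
proof (cases "i = j")
  case True
  then show ?thesis
    using good_refl assms by simp
next
  case False
  let ?\<theta> = "\<lambda>l::nat. if l = 0 then i else j"
  have \<theta>: "inj_on ?\<theta> {..1}" "?\<theta> ` {..1} \<subseteq> {..p}"
    using False assms by (auto simp: inj_on_def)
  have "good 1 (pull 1 ?\<theta> c) 0 1"
    by (rule edges[OF pull_closed[OF \<theta> c]])
  then show ?thesis
    using good_pull[OF \<theta> c, of 0 1] by simp
qed

definition path_to :: "nat \<times> ('a \<times> (nat \<Rightarrow> real)) \<Rightarrow> real \<Rightarrow> (nat \<times> ('a \<times> (nat \<Rightarrow> real))) set" where
  "path_to = (\<lambda>(p, c, a). path_join (Q (cell_vertex c 0)) (segment p c (vert 0) a))"

text \<open>Gluing maps need not send vertex 0 to vertex 0, so up to homotopy the path to a point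
  must not depend on the vertex at which it enters the cell. The triangle with corners
  \<open>vert 0\<close>, \<open>vert i\<close> and \<open>a\<close>, together with
  \<open>good_all\<close>, gives this.\<close>

lemma path_to_via:
  assumes c: "c \<in> C p" and a: "a \<in> standard_simplex p" and i: "i \<le> p"
  shows "path_hom realization (vertex_point d0) (point (p, c, a))
     (path_join (Q (cell_vertex c i)) (segment p c (vert i) a)) (path_to (p, c, a))"
proof -
  let ?s = "\<lambda>i. segment p c (vert i)" and ?v = "\<lambda>i. vertex_point (cell_vertex c i)"
    and ?Q = "\<lambda>i. Q (cell_vertex c i)" and ?x = "point (p, c, a)"
  have le0: "0 \<le> p" by simp
  have s: "path_from_to realization (?v j) ?x (?s j a)" if "j \<le> p" for j
    using segment_path[OF c vert_in_simplex[OF that] a] that c by (simp add: point_vertex)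
  have "path_hom realization (?v 0) ?x (path_join (?s 0 (vert i)) (?s i a)) (?s 0 a)"
    using segment_triangle[OF c vert_in_simplex[of 0 p] vert_in_simplex[OF i] a] c i
    by (simp add: point_vertex)
  then have "path_hom realization (vertex_point d0) ?x
      (path_join (?Q 0) (path_join (?s 0 (vert i)) (?s i a))) (path_to (p, c, a))"
    unfolding path_to_def prod.case
    by (rule path_hom_join_left[OF Q_vertex[OF c le0]])
  moreover have "path_hom realization (vertex_point d0) ?x (path_join (?Q i) (?s i a))
      (path_join (path_join (?Q 0) (?s 0 (vert i))) (?s i a))"
    using path_hom_sym[OF good_all[OF c, of 0 i, unfolded good_def]] i s[OF i]
    by (intro path_hom_join_right) auto
  moreover have "path_hom realization (vertex_point d0) ?x
      (path_join (?Q 0) (path_join (?s 0 (vert i)) (?s i a)))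
      (path_join (path_join (?Q 0) (?s 0 (vert i))) (?s i a))"
    by (rule path_hom_assoc[OF Q_vertex[OF c le0] segment_vertices[OF c le0 i] s[OF i]])
  ultimately show ?thesis
    by (meson path_hom_trans path_hom_sym)
qed

lemma path_to_path:
  assumes "u \<in> topspace coproduct"
  shows "path_from_to realization (vertex_point d0) (point u) (path_to u)"
proof -
  obtain p c a where "u = (p, c, a)" "c \<in> C p" "a \<in> standard_simplex p"
    using assms by (cases u) (auto simp: topspace_coproduct)
  then show ?thesis
    using path_hom_imp_path(2)[OF path_to_via[of c p a 0]] by simp
qed

lemma path_to_respects:
  assumes "point u = point v" "u \<in> topspace coproduct"
  shows "path_hom realization (vertex_point d0) (point u) (path_to u) (path_to v)"
proof -
  have "v \<in> topspace coproduct \<and>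
      path_hom realization (vertex_point d0) (point u) (path_to u) (path_to v)"
    using assms
  proof (induction rule: point_eq_induct)
    case (refl u)
    then show ?case
      by (simp add: path_hom_refl path_to_path)
  next
    case (sym u v)
    then show ?case
      using path_hom_sym by metis
  next
    case (trans u v w)
    then show ?case
      using path_hom_trans by metis
  next
    case (glued p q \<theta> c a)
    note \<theta> = \<open>inj_on \<theta> {..p}\<close> \<open>\<theta> ` {..p} \<subseteq> {..q}\<close>
      and c = \<open>c \<in> C q\<close> and a = \<open>a \<in> standard_simplex p\<close>
    let ?x = "point (q, c, push_simplex p \<theta> a)"
    have a': "push_simplex p \<theta> a \<in> standard_simplex q"
      by (rule push_simplex_in_simplex[OF \<theta> a])
    have le: "\<theta> 0 \<le> q"
      using \<theta>(2) by auto
    have v: "cell_vertex (pull p \<theta> c) 0 = cell_vertex c (\<theta> 0)"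
      by (rule cell_vertex_pull[OF \<theta> c]) simp
    have "path_hom realization (vertex_point (cell_vertex c (\<theta> 0))) ?x
       (segment q c (vert (\<theta> 0)) (push_simplex p \<theta> a)) (segment p (pull p \<theta> c) (vert 0) a)"
      using segment_push[OF \<theta> c vert_in_simplex[of 0 p] a] le
      by (simp add: push_simplex_vert[OF \<theta>(1)] point_vertex[OF c])
    then have "path_hom realization (vertex_point d0) ?x
       (path_join (Q (cell_vertex c (\<theta> 0))) (segment q c (vert (\<theta> 0)) (push_simplex p \<theta> a)))
       (path_to (p, pull p \<theta> c, a))"
      unfolding path_to_def prod.case v
      by (rule path_hom_join_left[OF Q_vertex[OF c le]])
    from path_hom_trans[OF path_hom_sym[OF path_to_via[OF c a' le]] this]
    show ?case .
  qed
  then show ?thesis by simp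
qed

definition chosen_path :: "(nat \<times> ('a \<times> (nat \<Rightarrow> real))) set \<Rightarrow> real \<Rightarrow> (nat \<times> ('a \<times> (nat \<Rightarrow> real))) set" where
  "chosen_path x = path_to (SOME u. u \<in> topspace coproduct \<and> point u = x)"

lemma chosen_path:
  assumes "u \<in> topspace coproduct"
  shows "path_hom realization (vertex_point d0) (point u) (path_to u) (chosen_path (point u))"
proof -
  have "\<exists>v. v \<in> topspace coproduct \<and> point v = point u"
    using assms by blast
  from someI_ex[OF this] show ?thesis
    unfolding chosen_path_def using assms by (intro path_to_respects) auto
qed

sublocale path_choice realization "vertex_point d0" chosen_path
proof
  fix x assume "x \<in> topspace realization"
  then obtain u where "u \<in> topspace coproduct" "x = point u"
    by (auto simp: topspace_realization)
  then show "path_from_to realization (vertex_point d0) x (chosen_path x)"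
    using path_hom_imp_path(2)[OF chosen_path] by simp
qed

text \<open>The chosen paths to both ends can be taken through vertex 0 of the same cell; what
  remains is the triangle with corners \<open>vert 0\<close>, \<open>a\<close>,
  \<open>b\<close>.\<close>

lemma transported_segment:
  assumes c: "c \<in> C p" and a: "a \<in> standard_simplex p" and b: "b \<in> standard_simplex p"
  shows "transported realization (vertex_point d0) chosen_path (segment p c a b)"
proof -
  let ?s = "segment p c" and ?x = "\<lambda>a. point (p, c, a)" and ?q = "Q (cell_vertex c 0)"
  note s = segment_path[OF c a b]
  have eq: "?s a b 0 = ?x a" "?s a b 1 = ?x b"
    by (simp_all add: segment_def)
  have v0: "?x (vert 0) = vertex_point (cell_vertex c 0)"
    using c by (simp add: point_vertex)
  have top: "(p, c, a) \<in> topspace coproduct" "(p, c, b) \<in> topspace coproduct"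
    using assms by (simp_all add: topspace_coproduct)
  have "path_hom realization (vertex_point d0) (?x b) (path_join (chosen_path (?x a)) (?s a b))
     (path_join (path_to (p, c, a)) (?s a b))"
    by (rule path_hom_join_right[OF path_hom_sym[OF chosen_path[OF top(1)]] s])
  also have "path_hom realization (vertex_point d0) (?x b) (path_join (path_to (p, c, a)) (?s a b))
     (path_join ?q (path_join (?s (vert 0) a) (?s a b)))"
    unfolding path_to_def prod.case
    by (rule path_hom_sym[OF path_hom_assoc[OF Q_vertex[OF c] _ s]])
       (use segment_path[OF c vert_in_simplex[of 0 p] a] v0 in auto)
  also have "path_hom realization (vertex_point d0) (?x b)
     (path_join ?q (path_join (?s (vert 0) a) (?s a b))) (path_to (p, c, b))"
    unfolding path_to_def prod.case
    using segment_triangle[OF c vert_in_simplex[of 0 p] a b] v0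
    by (intro path_hom_join_left[OF Q_vertex[OF c, of 0]]) auto
  also have "path_hom realization (vertex_point d0) (?x b) (path_to (p, c, b)) (chosen_path (?x b))"
    by (rule chosen_path[OF top(2)])
  finally show ?thesis
    using s by (simp add: transported_def eq path_from_to_def)
qed

text \<open>The tracks of the local contractions are straight segments in cells, which are
  transported; locality then gives all paths.\<close>

theorem simply_connected_realization: "simply_connected_space realization"
proof (rule simply_connected_if_transported)
  show "vertex_point d0 \<in> topspace realization"
    unfolding vertex_point_def by (rule point_in_realization) (simp_all add: d0 vert_in_simplex)
  fix f assume f: "pathin realization f"
  show "transported realization (vertex_point d0) chosen_path f"
  proof (rule transported_if_locally_contractible[OF _ f])
    fix x assume x: "x \<in> topspace realization"
    show "\<exists>U H z. openin realization U \<and> x \<in> U \<and>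
       continuous_map (prod_topology (subtopology realization U) (top_of_set {0..1})) realization H \<and>
       (\<forall>y\<in>U. H (y, 0) = y \<and> H (y, 1) = z \<and>
          transported realization (vertex_point d0) chosen_path (\<lambda>t. H (y, t)))"
    proof (rule realization_locally_contractible[OF x])
      fix U H z
      assume U: "openin realization U" "x \<in> U"
        "continuous_map (prod_topology (subtopology realization U) (top_of_set {0..1})) realization H"
        and H: "\<And>y. y \<in> U \<Longrightarrow> H (y, 0) = y \<and> H (y, 1) = z \<and>
          (\<exists>p c a b. c \<in> C p \<and> a \<in> standard_simplex p \<and> b \<in> standard_simplex p \<and>
             (\<forall>t \<in> {0..1}. H (y, t) = segment p c a b t))"
      have tr: "transported realization (vertex_point d0) chosen_path (\<lambda>t. H (y, t))" if y: "y \<in> U" for y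
      proof -
        obtain p c a b where pc: "c \<in> C p" "a \<in> standard_simplex p" "b \<in> standard_simplex p"
            and eq: "\<And>t. t \<in> {0..1} \<Longrightarrow> H (y, t) = segment p c a b t"
          using H[OF y] by blast
        have "path_hom realization (point (p, c, a)) (point (p, c, b)) (segment p c a b) (\<lambda>t. H (y, t))"
          by (rule path_hom_eqI[OF segment_path[OF pc]]) (simp add: eq)
        then show ?thesis
          by (rule transported_hom[OF _ transported_segment[OF pc]])
      qed
      show ?thesis
        by (intro exI[of _ U] exI[of _ H] exI[of _ z] conjI ballI U tr) (simp_all add: H)
    qed
  qed
qed

end

section \<open>1-cells reversed by a symmetry\<close>

context symmetric_delta_complex
begin

text \<open>The flip identifies the points at times \<open>t\<close> and \<open>1 - t\<close>, so
  the edge returns from its midpoint along itself and factors through an out-and-back path in the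
  interval. In particular its two ends coincide.\<close>

lemma folded_edge_null:
  assumes c: "c \<in> C 1" and fold: "pull 1 (\<lambda>i. 1 - i) c = c"
  shows "path_hom realization (vertex_point (cell_vertex c 0)) (vertex_point (cell_vertex c 0))
    (segment 1 c (vert 0) (vert 1)) (\<lambda>_. vertex_point (cell_vertex c 0))"
proof -
  let ?s = "segment 1 c (vert 0) (vert 1)"
  let ?\<theta> = "\<lambda>i::nat. 1 - i"
  have \<theta>: "inj_on ?\<theta> {..1}" "?\<theta> ` {..1} \<subseteq> {..1}"
    by (auto simp: inj_on_def)
  have sym: "?s (1 - t) = ?s t" if "0 \<le> t" "t \<le> 1" for t
  proof -
    let ?a = "\<lambda>i. (1 - t) * vert 0 i + t * vert 1 i"
    have "?a \<in> standard_simplex 1"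
      using that by (intro convex_standard_simplex vert_in_simplex) auto
    from point_push[OF \<theta> c this]
    have "point (1, c, push_simplex 1 ?\<theta> ?a) = point (1, c, ?a)"
      by (simp only: fold)
    \<comment> \<open>Pushing along the flip exchanges the two coordinates, which replaces
      \<open>t\<close> by \<open>1 - t\<close>.\<close>
    moreover have "push_simplex 1 ?\<theta> ?a = (\<lambda>i. (1 - (1 - t)) * vert 0 i + (1 - t) * vert 1 i)"
      unfolding push_simplex_affine using push_simplex_vert[OF \<theta>(1)] by (simp add: add.commute)
    ultimately show ?thesis
      by (simp add: segment_def)
  qed
  have "path_from_to realization (point (1, c, vert 0)) (point (1, c, vert 1)) ?s"
    by (intro segment_path[OF c] vert_in_simplex) auto
  then have path: "pathin realization ?s" "?s 0 = vertex_point (cell_vertex c 0)"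
    unfolding path_from_to_def point_vertex[OF c le0] by blast+
  have "?s 1 = ?s 0"
    using sym[of 0] by simp
  with path have p: "path_from_to realization (vertex_point (cell_vertex c 0)) (vertex_point (cell_vertex c 0)) ?s"
    by (simp add: path_from_to_def)
  have "path_hom realization (vertex_point (cell_vertex c 0)) (vertex_point (cell_vertex c 0))
      ?s (?s \<circ> (\<lambda>t. min t (1 - t)))"
    by (rule path_hom_eqI[OF p]) (use sym in \<open>auto simp: min_def\<close>)
  also have "path_hom realization (vertex_point (cell_vertex c 0)) (vertex_point (cell_vertex c 0))
      (?s \<circ> (\<lambda>t. min t (1 - t))) (\<lambda>_. vertex_point (cell_vertex c 0))"
    by (rule path_hom_null[OF path(1)])
       (auto simp: path(2) path_def path_image_def simp del: One_nat_def intro!: continuous_intros)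
  finally show ?thesis .
qed

end

section \<open>Contractions of graphs\<close>

text \<open>A contraction of the edge set \<open>S\<close>, described up to isomorphism by a vertex map \<open>r\<close> and a
  renaming \<open>\<psi>\<close> of the remaining edges. The sixth conjunct says that \<open>r\<close> identifies no more than the
  edges of \<open>S\<close> force it to; the seventh says that the new weight of a vertex is the sum of the old
  weights plus the first Betti number of the subgraph collapsed to it.\<close>

definition contraction ::
    "nat \<Rightarrow> (nat \<Rightarrow> nat) \<Rightarrow> (nat \<Rightarrow> nat) \<Rightarrow> nat set \<Rightarrow> mwgraph \<Rightarrow> mwgraph \<Rightarrow> bool" where
  "contraction n r \<psi> S G H \<longleftrightarrow>
     S \<subseteq> edges G \<and> r ` verts G = verts H \<and> bij_betw \<psi> (edges G - S) (edges H) \<and>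
     (\<forall>e \<in> edges G - S. ends H (\<psi> e) = r ` ends G e) \<and>
     (\<forall>e \<in> S. \<forall>u \<in> ends G e. \<forall>v \<in> ends G e. r u = r v) \<and>
     (\<forall>f :: nat \<Rightarrow> nat. (\<forall>e \<in> S. \<forall>u \<in> ends G e. \<forall>v \<in> ends G e. f u = f v) \<longrightarrow>
        (\<forall>u \<in> verts G. \<forall>v \<in> verts G. r u = r v \<longrightarrow> f u = f v)) \<and>
     (\<forall>x \<in> verts H. int (weight H x) - 1 =
        (\<Sum>u | u \<in> verts G \<and> r u = x. int (weight G u) - 1) + int (card {e \<in> S. r ` ends G e = {x}})) \<and>
     (\<forall>i \<in> {1..n}. mark H i = r (mark G i))"

lemma contractionD:
  assumes "contraction n r \<psi> S G H"
  shows "S \<subseteq> edges G" "r ` verts G = verts H" "bij_betw \<psi> (edges G - S) (edges H)"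
    "\<And>e. e \<in> edges G - S \<Longrightarrow> ends H (\<psi> e) = r ` ends G e"
    "\<And>e u v. \<lbrakk>e \<in> S; u \<in> ends G e; v \<in> ends G e\<rbrakk> \<Longrightarrow> r u = r v"
    "\<And>f u v. \<lbrakk>\<And>e u v. \<lbrakk>e \<in> S; u \<in> ends G e; v \<in> ends G e\<rbrakk> \<Longrightarrow> (f u :: nat) = f v;
       u \<in> verts G; v \<in> verts G; r u = r v\<rbrakk> \<Longrightarrow> f u = f v"
    "\<And>x. x \<in> verts H \<Longrightarrow> int (weight H x) - 1 =
        (\<Sum>u | u \<in> verts G \<and> r u = x. int (weight G u) - 1) + int (card {e \<in> S. r ` ends G e = {x}})"
    "\<And>i. 1 \<le> i \<Longrightarrow> i \<le> n \<Longrightarrow> mark H i = r (mark G i)"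
proof -
  note c = assms[unfolded contraction_def]
  show "S \<subseteq> edges G" "r ` verts G = verts H" "bij_betw \<psi> (edges G - S) (edges H)"
    using c by blast+
  show "ends H (\<psi> e) = r ` ends G e" if "e \<in> edges G - S" for e
    using c that by blast
  show "r u = r v" if "e \<in> S" "u \<in> ends G e" "v \<in> ends G e" for e u v
    using c that by blast
  show "f u = f v" if f: "\<And>e u v. \<lbrakk>e \<in> S; u \<in> ends G e; v \<in> ends G e\<rbrakk> \<Longrightarrow> (f u :: nat) = f v"
    and uv: "u \<in> verts G" "v \<in> verts G" "r u = r v" for f u v
  proof -
    have "\<forall>e \<in> S. \<forall>u \<in> ends G e. \<forall>v \<in> ends G e. f u = f v"
      by (intro ballI f)
    moreover from c have "\<forall>f :: nat \<Rightarrow> nat. (\<forall>e \<in> S. \<forall>u \<in> ends G e. \<forall>v \<in> ends G e. f u = f v) \<longrightarrow>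
        (\<forall>u \<in> verts G. \<forall>v \<in> verts G. r u = r v \<longrightarrow> f u = f v)"
      by (elim conjE) assumption
    ultimately have "\<forall>u \<in> verts G. \<forall>v \<in> verts G. r u = r v \<longrightarrow> f u = f v"
      by (elim allE impE)
    with uv show ?thesis by blast
  qed
  show "int (weight H x) - 1 =
        (\<Sum>u | u \<in> verts G \<and> r u = x. int (weight G u) - 1) + int (card {e \<in> S. r ` ends G e = {x}})"
    if "x \<in> verts H" for x
    using c that by simp
  show "mark H i = r (mark G i)" if "1 \<le> i" "i \<le> n" for i
    using c that by simp
qed

lemma contractionI:
  assumes "S \<subseteq> edges G" "r ` verts G = verts H" "bij_betw \<psi> (edges G - S) (edges H)"
    "\<And>e. e \<in> edges G - S \<Longrightarrow> ends H (\<psi> e) = r ` ends G e"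
    "\<And>e u v. \<lbrakk>e \<in> S; u \<in> ends G e; v \<in> ends G e\<rbrakk> \<Longrightarrow> r u = r v"
    "\<And>f u v. \<lbrakk>\<And>e u v. \<lbrakk>e \<in> S; u \<in> ends G e; v \<in> ends G e\<rbrakk> \<Longrightarrow> (f u :: nat) = f v;
       u \<in> verts G; v \<in> verts G; r u = r v\<rbrakk> \<Longrightarrow> f u = f v"
    "\<And>x. x \<in> verts H \<Longrightarrow> int (weight H x) - 1 =
        (\<Sum>u | u \<in> verts G \<and> r u = x. int (weight G u) - 1) + int (card {e \<in> S. r ` ends G e = {x}})"
    "\<And>i. 1 \<le> i \<Longrightarrow> i \<le> n \<Longrightarrow> mark H i = r (mark G i)"
  shows "contraction n r \<psi> S G H"
  unfolding contraction_def
proof (intro conjI)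
  show "\<forall>f :: nat \<Rightarrow> nat. (\<forall>e \<in> S. \<forall>u \<in> ends G e. \<forall>v \<in> ends G e. f u = f v) \<longrightarrow>
        (\<forall>u \<in> verts G. \<forall>v \<in> verts G. r u = r v \<longrightarrow> f u = f v)"
  proof (intro allI impI ballI)
    fix f :: "nat \<Rightarrow> nat" and u v
    assume "\<forall>e \<in> S. \<forall>u \<in> ends G e. \<forall>v \<in> ends G e. f u = f v"
      and uv: "u \<in> verts G" "v \<in> verts G" "r u = r v"
    then show "f u = f v"
      by (intro assms(6)[OF _ uv]) blast
  qed
  show "\<forall>x \<in> verts H. int (weight H x) - 1 =
      (\<Sum>u | u \<in> verts G \<and> r u = x. int (weight G u) - 1) + int (card {e \<in> S. r ` ends G e = {x}})"
    by (intro ballI assms(7))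
  show "\<forall>e \<in> S. \<forall>u \<in> ends G e. \<forall>v \<in> ends G e. r u = r v"
    by (intro ballI assms(5))
qed (use assms(1-4,8) in simp_all)

lemma marked_weighted_graphD:
  assumes "marked_weighted_graph n G"
  shows "finite (verts G)" "verts G \<noteq> {}" "finite (edges G)"
    "\<And>e. e \<in> edges G \<Longrightarrow> ends G e \<subseteq> verts G" "\<And>e. e \<in> edges G \<Longrightarrow> card (ends G e) \<in> {1, 2}"
    "\<And>e. e \<in> edges G \<Longrightarrow> finite (ends G e)" "\<And>e. e \<in> edges G \<Longrightarrow> ends G e \<noteq> {}"
    "\<And>u v. u \<in> verts G \<Longrightarrow> v \<in> verts G \<Longrightarrow> (u, v) \<in> (adjacency G)\<^sup>*"
    "\<And>i. 1 \<le> i \<Longrightarrow> i \<le> n \<Longrightarrow> mark G i \<in> verts G"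
proof -
  show "finite (ends G e)" "ends G e \<noteq> {}" if "e \<in> edges G" for e
    using assms that by (auto simp: marked_weighted_graph_def intro: card_ge_0_finite)
qed (use assms in \<open>auto simp: marked_weighted_graph_def\<close>)

lemma collapsed_image:
  assumes G: "marked_weighted_graph n G" and c: "contraction n r \<psi> S G H" and e: "e \<in> S"
  obtains x where "x \<in> verts H" "r ` ends G e = {x}"
proof -
  have "e \<in> edges G" using contractionD(1)[OF c] e by auto
  from marked_weighted_graphD(4,7)[OF G this] obtain u where u: "u \<in> ends G e" "u \<in> verts G"
    by blast
  then have "r ` ends G e = {r u}"
    using contractionD(5)[OF c e] by blast
  then show thesis
    using that u contractionD(2)[OF c] by blast
qed

text \<open>\<open>genus G - 1\<close> is the number of edges plus the sum of
  \<open>weight - 1\<close> over the vertices, and in this form the weight rule adds up over fibres.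
  For \<open>Y = verts H\<close> it gives invariance of the genus, for \<open>Y\<close> a fibre of a
  second contraction the composition rule.\<close>

lemma contraction_weight_sum:
  assumes G: "marked_weighted_graph n G" and c: "contraction n r \<psi> S G H" and Y: "Y \<subseteq> verts H"
  shows "(\<Sum>x\<in>Y. int (weight H x) - 1) =
     (\<Sum>u | u \<in> verts G \<and> r u \<in> Y. int (weight G u) - 1) + int (card {e \<in> S. r ` ends G e \<subseteq> Y})"
proof -
  have fin: "finite (verts G)" "finite S" "finite Y"
    using marked_weighted_graphD(1,3)[OF G] contractionD(1,2)[OF c] Y
    by (simp, metis finite_subset, metis finite_imageI finite_subset)
  have "(\<Sum>x\<in>Y. int (weight H x) - 1) =
     (\<Sum>x\<in>Y. (\<Sum>u | u \<in> verts G \<and> r u = x. int (weight G u) - 1)) +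
     (\<Sum>x\<in>Y. int (card {e \<in> S. r ` ends G e = {x}}))"
    using contractionD(7)[OF c] Y by (simp add: subset_iff flip: sum.distrib)
  also have "(\<Sum>x\<in>Y. (\<Sum>u | u \<in> verts G \<and> r u = x. int (weight G u) - 1)) =
      (\<Sum>x\<in>Y. (\<Sum>u \<in> {u \<in> {u. u \<in> verts G \<and> r u \<in> Y}. r u = x}. int (weight G u) - 1))"
    by (intro sum.cong refl) auto
  also have "\<dots> = (\<Sum>u | u \<in> verts G \<and> r u \<in> Y. int (weight G u) - 1)"
    using fin by (intro sum.group) auto
  also have "(\<Sum>x\<in>Y. int (card {e \<in> S. r ` ends G e = {x}})) =
      (\<Sum>x\<in>Y. (\<Sum>e \<in> {e \<in> {e \<in> S. r ` ends G e \<subseteq> Y}. the_elem (r ` ends G e) = x}. 1))"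
  proof (intro sum.cong refl)
    fix x assume x: "x \<in> Y"
    have "{e \<in> S. r ` ends G e = {x}} = {e \<in> {e \<in> S. r ` ends G e \<subseteq> Y}. the_elem (r ` ends G e) = x}"
    proof (rule Set.set_eqI)
      fix e
      show "e \<in> {e \<in> S. r ` ends G e = {x}} \<longleftrightarrow>
          e \<in> {e \<in> {e \<in> S. r ` ends G e \<subseteq> Y}. the_elem (r ` ends G e) = x}"
      proof (cases "e \<in> S")
        case True
        then obtain y where "r ` ends G e = {y}"
          by (rule collapsed_image[OF G c])
        then show ?thesis using x by auto
      qed simp
    qed
    then show "int (card {e \<in> S. r ` ends G e = {x}}) =
        (\<Sum>e \<in> {e \<in> {e \<in> S. r ` ends G e \<subseteq> Y}. the_elem (r ` ends G e) = x}. 1)"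
      by simp
  qed
  also have "\<dots> = (\<Sum>e \<in> {e \<in> S. r ` ends G e \<subseteq> Y}. 1)"
    using fin by (intro sum.group) (auto elim: collapsed_image[OF G c])
  finally show ?thesis by simp
qed

lemma contraction_marked_weighted_graph:
  assumes G: "marked_weighted_graph n G" and c: "contraction n r \<psi> S G H"
  shows "marked_weighted_graph n H"
  unfolding marked_weighted_graph_def
proof (intro conjI ballI)
  note g = marked_weighted_graphD[OF G] and d = contractionD[OF c]
  show "finite (verts H)" "verts H \<noteq> {}"
    using g(1,2) unfolding d(2)[symmetric] by auto
  show "finite (edges H)"
    using g(3) bij_betw_finite[OF d(3)] by auto
  show "mark H i \<in> verts H" if "i \<in> {1..n}" for i
    using d(2,8) g(9) that by auto
  fix e' assume "e' \<in> edges H"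
  then obtain e where e: "e \<in> edges G - S" "e' = \<psi> e"
    using d(3) by (auto simp: bij_betw_def)
  then show "ends H e' \<subseteq> verts H"
    using d(2) d(4)[OF e(1)] g(4)[of e] by auto
  have e0: "e \<in> edges G"
    using e(1) by simp
  have "card (r ` ends G e) \<le> card (ends G e)" "card (r ` ends G e) > 0"
    using card_image_le[OF g(6)[OF e0]] g(6,7)[OF e0] by (simp_all add: card_gt_0_iff)
  then show "card (ends H e') \<in> {1, 2}"
    using g(5)[OF e0] unfolding e(2) d(4)[OF e(1)] by auto
next
  note g = marked_weighted_graphD[OF G] and d = contractionD[OF c]
  have step: "(r u, r v) \<in> (adjacency H)\<^sup>*" if uv: "(u, v) \<in> adjacency G" for u v
  proof -
    obtain e where e: "e \<in> edges G" "ends G e = {u, v}"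
      using uv by (auto simp: adjacency_def)
    show ?thesis
    proof (cases "e \<in> S")
      case True
      then show ?thesis
        using d(5)[of e u v] e by simp
    next
      case False
      then have "ends H (\<psi> e) = {r u, r v}" "\<psi> e \<in> edges H"
        using d(4)[of e] e bij_betwE[OF d(3)] by auto
      then show ?thesis
        by (auto simp: adjacency_def intro: r_into_rtrancl)
    qed
  qed
  have "(r u, r v) \<in> (adjacency H)\<^sup>*" if "(u, v) \<in> (adjacency G)\<^sup>*" for u v
    using that by induction (auto intro: rtrancl_trans step)
  then show "(x, y) \<in> (adjacency H)\<^sup>*" if "x \<in> verts H" "y \<in> verts H" for x y
    using that g(8) unfolding d(2)[symmetric] by auto
qed

lemma contraction_genus:
  assumes G: "marked_weighted_graph n G" and c: "contraction n r \<psi> S G H"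
  shows "genus H = genus G"
proof -
  note g = marked_weighted_graphD[OF G] and d = contractionD[OF c]
  have fin: "finite S"
    using d(1) g(3) by (rule finite_subset)
  have eq: "{u. u \<in> verts G \<and> r u \<in> verts H} = verts G" "{e \<in> S. r ` ends G e \<subseteq> verts H} = S"
    using d(1,2) g(4) by blast+
  have "card (edges H) = card (edges G - S)"
    using bij_betw_same_card[OF d(3)] by simp
  then have "int (card (edges H)) = int (card (edges G)) - int (card S)"
    using card_Diff_subset[OF fin d(1)] card_mono[OF g(3) d(1)] by simp
  moreover have "(\<Sum>x\<in>verts H. int (weight H x) - 1) = (\<Sum>u\<in>verts G. int (weight G u) - 1) + int (card S)"
    using contraction_weight_sum[OF G c order_refl] unfolding eq .
  ultimately show ?thesis
    by (simp add: genus_def sum_subtractf)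
qed

section \<open>Composition and uniqueness of contractions\<close>

lemma contraction_comp:
  assumes G: "marked_weighted_graph n G" and c: "contraction n r \<psi> S G H"
    and c': "contraction n r' \<psi>' S' H K"
  shows "contraction n (r' \<circ> r) (\<psi>' \<circ> \<psi>) (S \<union> {e \<in> edges G - S. \<psi> e \<in> S'}) G K"
    (is "contraction n _ _ ?S G K")
proof (rule contractionI)
  note g = marked_weighted_graphD[OF G] and d = contractionD[OF c] and d' = contractionD[OF c']
  show "?S \<subseteq> edges G"
    using d(1) by auto
  show "(r' \<circ> r) ` verts G = verts K"
    by (metis d(2) d'(2) image_comp)
  have im: "\<psi> ` (edges G - ?S) = edges H - S'"
    using d(3) unfolding bij_betw_def by auto
  have "bij_betw \<psi> (edges G - ?S) (edges H - S')"
    using bij_betw_subset[OF d(3) _ im] by auto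
  then show "bij_betw (\<psi>' \<circ> \<psi>) (edges G - ?S) (edges K)"
    using d'(3) by (rule bij_betw_trans)
  have \<psi>: "\<psi> e \<in> edges H" if "e \<in> edges G - S" for e
    using bij_betwE[OF d(3)] that by blast
  show "ends K ((\<psi>' \<circ> \<psi>) e) = (r' \<circ> r) ` ends G e" if "e \<in> edges G - ?S" for e
  proof -
    have e: "e \<in> edges G - S" "\<psi> e \<in> edges H - S'"
      using that \<psi> by auto
    show ?thesis
      using d(4)[OF e(1)] d'(4)[OF e(2)] by (simp add: image_comp)
  qed
  show "(r' \<circ> r) u = (r' \<circ> r) v" if "e \<in> ?S" "u \<in> ends G e" "v \<in> ends G e" for e u v
  proof (cases "e \<in> S")
    case True
    then show ?thesis
      using d(5)[OF True that(2,3)] by simp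
  next
    case False
    then have "e \<in> edges G - S" "\<psi> e \<in> S'"
      using that by auto
    then show ?thesis
      using d(4)[of e] d'(5)[of "\<psi> e" "r u" "r v"] that by auto
  qed
  show "f u = f v" if f: "\<And>e u v. \<lbrakk>e \<in> ?S; u \<in> ends G e; v \<in> ends G e\<rbrakk> \<Longrightarrow> f u = f v"
    and uv: "u \<in> verts G" "v \<in> verts G" "(r' \<circ> r) u = (r' \<circ> r) v" for f :: "nat \<Rightarrow> nat" and u v
  proof -
    have fr: "f u = f v" if "u \<in> verts G" "v \<in> verts G" "r u = r v" for u v
      using d(6)[of f u v] f that by blast
    \<comment> \<open>By minimality of \<open>r\<close> the function \<open>f\<close> is constant on
      the fibres of \<open>r\<close>; \<open>h\<close> is the induced function on the vertices of
      \<open>H\<close>, to which minimality of \<open>r'\<close> applies.\<close>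
    define h where "h x = f (SOME u. u \<in> verts G \<and> r u = x)" for x
    have h: "h (r u) = f u" if "u \<in> verts G" for u
    proof -
      have "\<exists>v. v \<in> verts G \<and> r v = r u" using that by blast
      from someI_ex[OF this] show ?thesis
        unfolding h_def using that by (intro fr) auto
    qed
    have "h (r u) = h (r v)"
    proof (rule d'(6)[of h "r u" "r v"])
      fix e' x y assume e': "e' \<in> S'" "x \<in> ends H e'" "y \<in> ends H e'"
      then have "e' \<in> edges H" using d'(1) by auto
      then obtain e where e: "e \<in> edges G - S" "e' = \<psi> e"
        using d(3) by (auto simp: bij_betw_def)
      then obtain u v where uv: "u \<in> ends G e" "v \<in> ends G e" "x = r u" "y = r v"
        using d(4)[OF e(1)] e' by auto
      have "u \<in> verts G" "v \<in> verts G"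
        using uv e(1) g(4)[of e] by auto
      moreover have "f u = f v"
        using f[of e u v] e e'(1) uv by auto
      ultimately show "h x = h y"
        using h uv by simp
    qed (use uv d(2) in auto)
    then show ?thesis
      using h uv by simp
  qed
  show "mark K i = (r' \<circ> r) (mark G i)" if "1 \<le> i" "i \<le> n" for i
    using d(8) d'(8) that by simp
  fix y assume y: "y \<in> verts K"
  \<comment> \<open>The weight at \<open>y\<close> arises by summing the rule of the first
    contraction over the fibre of the second one. An edge collapsed to \<open>y\<close> either
    collapses to a point of \<open>?Y\<close> already in \<open>H\<close>, or survives there and is
    contracted by the second map.\<close>
  let ?Y = "{x \<in> verts H. r' x = y}"
  have fin: "finite S" "finite (edges G)"
    using d(1) g(3) finite_subset by auto
  have "(\<Sum>x\<in>?Y. int (weight H x) - 1) =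
     (\<Sum>u | u \<in> verts G \<and> r u \<in> ?Y. int (weight G u) - 1) + int (card {e \<in> S. r ` ends G e \<subseteq> ?Y})"
    by (rule contraction_weight_sum[OF G c]) auto
  moreover have "{u. u \<in> verts G \<and> r u \<in> ?Y} = {u. u \<in> verts G \<and> (r' \<circ> r) u = y}"
    using d(2) by auto
  moreover have "{e \<in> S. r ` ends G e \<subseteq> ?Y} = {e \<in> S. (r' \<circ> r) ` ends G e = {y}}"
  proof (rule Collect_cong)
    fix e
    show "e \<in> S \<and> r ` ends G e \<subseteq> ?Y \<longleftrightarrow> e \<in> S \<and> (r' \<circ> r) ` ends G e = {y}"
    proof (cases "e \<in> S")
      case True
      then obtain x where x: "x \<in> verts H" "r ` ends G e = {x}"
        by (rule collapsed_image[OF G c])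
      then have "(r' \<circ> r) ` ends G e = {r' x}"
        by (metis image_comp image_empty image_insert)
      then show ?thesis
        using x by auto
    qed simp
  qed
  moreover have "card {e \<in> S'. r' ` ends H e = {y}} =
      card {e \<in> edges G - S. \<psi> e \<in> S' \<and> (r' \<circ> r) ` ends G e = {y}}"
  proof -
    have "{e \<in> S'. r' ` ends H e = {y}} = \<psi> ` {e \<in> edges G - S. \<psi> e \<in> S' \<and> (r' \<circ> r) ` ends G e = {y}}"
    proof (intro equalityI subsetI)
      fix e' assume e': "e' \<in> {e \<in> S'. r' ` ends H e = {y}}"
      then have "e' \<in> edges H" using d'(1) by auto
      then obtain e where e: "e \<in> edges G - S" "e' = \<psi> e"
        using d(3) by (auto simp: bij_betw_def)
      with e' show "e' \<in> \<psi> ` {e \<in> edges G - S. \<psi> e \<in> S' \<and> (r' \<circ> r) ` ends G e = {y}}"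
        using d(4)[OF e(1)] by (auto simp: image_comp)
    next
      fix e' assume "e' \<in> \<psi> ` {e \<in> edges G - S. \<psi> e \<in> S' \<and> (r' \<circ> r) ` ends G e = {y}}"
      then obtain e where e: "e \<in> edges G - S" "e' = \<psi> e" "\<psi> e \<in> S'" "(r' \<circ> r) ` ends G e = {y}"
        by blast
      then show "e' \<in> {e \<in> S'. r' ` ends H e = {y}}"
        using d(4)[OF e(1)] by (auto simp: image_comp)
    qed
    moreover have "inj_on \<psi> {e \<in> edges G - S. \<psi> e \<in> S' \<and> (r' \<circ> r) ` ends G e = {y}}"
      using d(3) unfolding bij_betw_def by (elim conjE inj_on_subset) auto
    ultimately show ?thesis
      by (simp add: card_image)
  qed
  moreover have "card {e \<in> ?S. (r' \<circ> r) ` ends G e = {y}} =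
      card {e \<in> S. (r' \<circ> r) ` ends G e = {y}} +
      card {e \<in> edges G - S. \<psi> e \<in> S' \<and> (r' \<circ> r) ` ends G e = {y}}"
    using fin by (subst card_Un_disjoint[symmetric]) (auto intro!: arg_cong[of _ _ card])
  ultimately show "int (weight K y) - 1 = (\<Sum>u | u \<in> verts G \<and> (r' \<circ> r) u = y. int (weight G u) - 1) +
      int (card {e \<in> ?S. (r' \<circ> r) ` ends G e = {y}})"
    using d'(7)[OF y] by simp
qed

text \<open>With nothing to contract, minimality for the identity function forces \<open>r\<close>
  to be injective. Isomorphisms are thus contractions of the empty set, and composition and
  uniqueness apply to them as well.\<close>

lemma contraction_empty_iff:
  "contraction n r \<psi> {} G H \<longleftrightarrow> bij_betw r (verts G) (verts H) \<and> bij_betw \<psi> (edges G) (edges H) \<and>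
     (\<forall>e \<in> edges G. ends H (\<psi> e) = r ` ends G e) \<and>
     (\<forall>v \<in> verts G. weight H (r v) = weight G v) \<and> (\<forall>i \<in> {1..n}. mark H i = r (mark G i))"
    (is "?L \<longleftrightarrow> ?R")
proof
  assume L: ?L
  note d = contractionD[OF L]
  have inj: "inj_on r (verts G)"
    using d(6)[of "\<lambda>x. x"] by (auto simp: inj_on_def)
  have "weight H (r v) = weight G v" if v: "v \<in> verts G" for v
  proof -
    have "{u. u \<in> verts G \<and> r u = r v} = {v}"
      using inj v by (auto simp: inj_on_def)
    then show ?thesis
      using d(7)[of "r v"] d(2) v by auto
  qed
  then show ?R
    using d inj by (auto simp: bij_betw_def)
next
  assume R: ?R
  show ?L
  proof (rule contractionI)
    fix x assume "x \<in> verts H"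
    then obtain v where v: "v \<in> verts G" "x = r v"
      using R unfolding bij_betw_def by blast
    have "{u. u \<in> verts G \<and> r u = r v} = {v}"
      using R v by (auto simp: bij_betw_def inj_on_def)
    then show "int (weight H x) - 1 = (\<Sum>u | u \<in> verts G \<and> r u = x. int (weight G u) - 1) +
        int (card {e \<in> {}. r ` ends G e = {x}})"
      using R v by simp
  qed (use R in \<open>auto simp: bij_betw_def inj_on_def\<close>)
qed

text \<open>Both \<open>r\<close> and \<open>r'\<close> are minimal among the vertex maps constant
  on the edges of \<open>S\<close>. Applying the minimality of each to the other shows that they
  have the same fibres.\<close>

lemma contraction_unique:
  assumes G: "marked_weighted_graph n G" and c: "contraction n r \<psi> S G H"
    and c': "contraction n r' \<psi>' S G K"
  obtains \<phi> where "contraction n \<phi> (\<psi>' \<circ> inv_into (edges G - S) \<psi>) {} H K"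
proof -
  note g = marked_weighted_graphD[OF G] and d = contractionD[OF c] and d' = contractionD[OF c']
  define \<phi> where "\<phi> x = r' (SOME u. u \<in> verts G \<and> r u = x)" for x
  have \<phi>: "\<phi> (r u) = r' u" if "u \<in> verts G" for u
  proof -
    have "\<exists>v. v \<in> verts G \<and> r v = r u" using that by blast
    note v = someI_ex[OF this]
    show ?thesis
      unfolding \<phi>_def
      by (rule d(6)[of r', OF d'(5) conjunct1[OF v] that conjunct2[OF v]])
  qed
  have inj: "r u = r v" if "u \<in> verts G" "v \<in> verts G" "r' u = r' v" for u v
    by (rule d'(6)[of r, OF d(5) that])
  have bij: "bij_betw \<phi> (verts H) (verts K)"
    unfolding bij_betw_def
  proof
    show "inj_on \<phi> (verts H)"
    proof (rule inj_onI)
      fix x y assume "x \<in> verts H" "y \<in> verts H" and eq: "\<phi> x = \<phi> y"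
      then obtain u v where uv: "u \<in> verts G" "v \<in> verts G" "x = r u" "y = r v"
        unfolding d(2)[symmetric] by blast
      with eq have "r' u = r' v"
        by (simp add: \<phi>)
      from inj[OF uv(1,2) this] show "x = y"
        by (simp add: uv)
    qed
    show "\<phi> ` verts H = verts K"
      unfolding d(2)[symmetric] d'(2)[symmetric] image_image using \<phi> by (intro image_cong) auto
  qed
  have "contraction n \<phi> (\<psi>' \<circ> inv_into (edges G - S) \<psi>) {} H K"
    unfolding contraction_empty_iff
  proof (intro conjI ballI bij)
    show "bij_betw (\<psi>' \<circ> inv_into (edges G - S) \<psi>) (edges H) (edges K)"
      by (rule bij_betw_trans[OF bij_betw_inv_into[OF d(3)] d'(3)])
    show "mark K i = \<phi> (mark H i)" if "i \<in> {1..n}" for i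
      using d(8) d'(8) \<phi> g(9) that by auto
    fix e' assume "e' \<in> edges H"
    then obtain e where e: "e \<in> edges G - S" "e' = \<psi> e"
      using d(3) by (auto simp: bij_betw_def)
    have "inv_into (edges G - S) \<psi> e' = e"
      using d(3) e by (simp add: bij_betw_def)
    moreover have "\<phi> ` r ` ends G e = r' ` ends G e"
      using \<phi> g(4)[of e] e by (auto simp: image_comp intro!: image_cong)
    ultimately show "ends K ((\<psi>' \<circ> inv_into (edges G - S) \<psi>) e') = \<phi> ` ends H e'"
      using d(4)[OF e(1)] d'(4)[OF e(1)] e by simp
  next
    fix x assume "x \<in> verts H"
    then obtain v where v: "v \<in> verts G" "x = r v"
      using d(2) by auto
    have "{u. u \<in> verts G \<and> r' u = r' v} = {u. u \<in> verts G \<and> r u = r v}"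
      using v \<phi> inj by metis
    moreover have "{e \<in> S. r' ` ends G e = {r' v}} = {e \<in> S. r ` ends G e = {r v}}"
    proof (rule Collect_cong, rule conj_cong[OF refl])
      fix e assume "e \<in> S"
      then have e: "e \<in> edges G" using d(1) by auto
      then obtain u where u: "u \<in> ends G e" "u \<in> verts G"
        using g(4,7)[OF e] by blast
      have "r ` ends G e = {r u}" "r' ` ends G e = {r' u}"
        using d(5)[OF \<open>e \<in> S\<close>] d'(5)[OF \<open>e \<in> S\<close>] u by blast+
      then show "r' ` ends G e = {r' v} \<longleftrightarrow> r ` ends G e = {r v}"
        using \<phi> inj u(2) v(1) by (metis singleton_insert_inj_eq)
    qed
    ultimately have "int (weight K (r' v)) - 1 = int (weight H (r v)) - 1"
      using d(7)[of "r v"] d'(7)[of "r' v"] imageI[OF v(1), of r] imageI[OF v(1), of r']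
      unfolding d(2) d'(2) by simp
    then show "weight K (\<phi> x) = weight H x"
      using \<phi> v by simp
  qed
  then show thesis by (rule that)
qed

section \<open>Cells of the tropical moduli space\<close>

text \<open>In terms of \<open>weight - 1\<close> both kinds of edge obey one rule: for two ends the
  sum of the \<open>w - 1\<close> is the total weight minus 2, and the edge adds 1; for a loop it is
  \<open>w - 1\<close>, and the edge adds 1.\<close>

lemma contraction_contract_edge:
  assumes G: "marked_weighted_graph n G" and e: "e \<in> edges G"
  shows "contraction n (\<lambda>v. if v \<in> ends G e then Min (ends G e) else v) id {e} G (contract_edge e G)"
    (is "contraction n ?r id {e} G ?H")
proof -
  note g = marked_weighted_graphD[OF G]
  let ?a = "Min (ends G e)"
  have a: "?a \<in> ends G e" "?a \<in> verts G"
    using Min_in[OF g(6,7)[OF e]] g(4)[OF e] by auto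
  have H: "verts ?H = ?r ` verts G" "edges ?H = edges G - {e}" "ends ?H = (\<lambda>f. ?r ` ends G f)"
    "weight ?H = (weight G)
          (?a := (\<Sum>v \<in> ends G e. weight G v) + (if card (ends G e) = 1 then 1 else 0))"
    "mark ?H = (\<lambda>i. ?r (mark G i))"
    by (simp_all add: contract_edge_def Let_def)
  have im: "?r ` ends G e = {?a}"
    using a(1) by auto
  show ?thesis
  proof (rule contractionI)
    show "f u = f v" if f: "\<And>e' u v. \<lbrakk>e' \<in> {e}; u \<in> ends G e'; v \<in> ends G e'\<rbrakk> \<Longrightarrow> f u = f v"
      and uv: "u \<in> verts G" "v \<in> verts G" "?r u = ?r v" for f :: "nat \<Rightarrow> nat" and u v
    proof -
      have fr: "f (?r w) = f w" for w
        using f[of e ?a w] a(1) by simp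
      show ?thesis
        using fr[of u] fr[of v] unfolding uv(3) by simp
    qed
    fix x assume "x \<in> verts ?H"
    then obtain v where v: "v \<in> verts G" "x = ?r v"
      unfolding H by auto
    show "int (weight ?H x) - 1 = (\<Sum>u | u \<in> verts G \<and> ?r u = x. int (weight G u) - 1) +
        int (card {e' \<in> {e}. ?r ` ends G e' = {x}})"
    proof (cases "x = ?a")
      case True
      have "{u. u \<in> verts G \<and> ?r u = x} = ends G e"
        using True a g(4)[OF e] by auto
      moreover have "{e' \<in> {e}. ?r ` ends G e' = {x}} = {e}"
        using im True by auto
      moreover have "(\<Sum>u\<in>ends G e. int (weight G u) - 1) =
          int (\<Sum>u\<in>ends G e. weight G u) - int (card (ends G e))"
        by (simp add: sum_subtractf)
      ultimately show ?thesis
        using True g(5)[OF e] unfolding H(4) by auto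
    next
      case False
      then have "v \<notin> ends G e"
        using v(2) by auto
      then have "x \<notin> ends G e" "v = x"
        using v(2) by simp_all
      moreover from this have "x \<in> verts G"
        using v(1) by simp
      ultimately have "{u. u \<in> verts G \<and> ?r u = x} = {x}"
        using not_sym[OF False] by (auto split: if_split_asm)
      moreover have "{e' \<in> {e}. ?r ` ends G e' = {x}} = {}"
        using im False by auto
      ultimately show ?thesis
        using False unfolding H(4) by simp
    qed
  qed (use e H in \<open>auto simp: bij_betw_def\<close>)
qed

section \<open>Half-edge counts and stability under contraction\<close>

definition end_multiplicity :: "nat set \<Rightarrow> nat \<Rightarrow> nat" where
  "end_multiplicity A v = (if A = {v} then 2 else if v \<in> A then 1 else 0)"

lemma valence_eq_sum:
  assumes "finite (edges G)"
  shows "valence G v = (\<Sum>e\<in>edges G. end_multiplicity (ends G e) v)"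
  unfolding valence_def using assms
  by (intro sum.mono_neutral_cong_left) (auto simp: end_multiplicity_def)

lemma end_multiplicity_image:
  assumes V: "finite V" "A \<subseteq> V" and A: "card A \<in> {1, 2}"
  shows "end_multiplicity (r ` A) x = (\<Sum>u | u \<in> V \<and> r u = x. end_multiplicity A u)"
proof -
  let ?F = "{u. u \<in> V \<and> r u = x}"
  have fin: "finite ?F" using V by auto
  obtain a b where ab: "A = {a, b}"
    using A by (auto simp: card_1_singleton_iff card_2_iff)
  have mem: "a \<in> ?F \<longleftrightarrow> r a = x" "b \<in> ?F \<longleftrightarrow> r b = x"
    using V ab by auto
  have "end_multiplicity A u = (if u = a then 1 else 0) + (if u = b then 1 else 0)" for u
    unfolding ab by (auto simp: end_multiplicity_def)
  then have "(\<Sum>u\<in>?F. end_multiplicity A u) = (if r a = x then 1 else 0) + (if r b = x then 1 else 0)"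
    using fin mem by (simp only: sum.distrib sum.delta)
  then show ?thesis
    unfolding ab by (auto simp: end_multiplicity_def)
qed

text \<open>\<open>end_multiplicity\<close> counts the half-edges of an edge at a vertex, and
  \<open>r\<close> carries half-edges along. Over \<open>x\<close> they belong either to surviving
  edges, forming the valence of \<open>x\<close>, or in pairs to edges collapsed to
  \<open>x\<close>.\<close>

lemma contraction_valence:
  assumes G: "marked_weighted_graph n G" and c: "contraction n r \<psi> S G H"
  shows "(\<Sum>u | u \<in> verts G \<and> r u = x. valence G u) =
     valence H x + 2 * card {e \<in> S. r ` ends G e = {x}}"
proof -
  note g = marked_weighted_graphD[OF G] and d = contractionD[OF c]
  let ?m = "\<lambda>e. end_multiplicity (r ` ends G e) x"
  have fin: "finite (edges G)" "finite S" "finite (edges H)"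
    using g(3) d(1) finite_subset bij_betw_finite[OF d(3)] by auto
  have "(\<Sum>u | u \<in> verts G \<and> r u = x. valence G u) =
      (\<Sum>e\<in>edges G. \<Sum>u | u \<in> verts G \<and> r u = x. end_multiplicity (ends G e) u)"
    unfolding valence_eq_sum[OF fin(1)] by (rule sum.swap)
  also have "\<dots> = (\<Sum>e\<in>edges G. ?m e)"
    using end_multiplicity_image[OF g(1) g(4) g(5), symmetric] by (rule sum.cong[OF refl])
  also have "\<dots> = (\<Sum>e\<in>edges G - S. ?m e) + (\<Sum>e\<in>S. ?m e)"
    by (rule sum.subset_diff[OF d(1) fin(1)])
  also have "(\<Sum>e\<in>edges G - S. ?m e) = (\<Sum>e\<in>edges G - S. end_multiplicity (ends H (\<psi> e)) x)"
    using d(4) by simp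
  also have "\<dots> = valence H x"
    unfolding valence_eq_sum[OF fin(3)] by (rule sum.reindex_bij_betw[OF d(3)])
  also have "(\<Sum>e\<in>S. ?m e) = (\<Sum>e\<in>{e \<in> S. r ` ends G e = {x}}. 2)"
  proof (rule sum.mono_neutral_cong_right[OF fin(2)])
    show "\<forall>e\<in>S - {e \<in> S. r ` ends G e = {x}}. ?m e = 0"
    proof
      fix e assume e: "e \<in> S - {e \<in> S. r ` ends G e = {x}}"
      then have "e \<in> S" by simp
      then obtain y where "y \<in> verts H" and y: "r ` ends G e = {y}"
        by (rule collapsed_image[OF G c])
      have "{y} \<noteq> {x}"
        using e unfolding y[symmetric] by simp
      then show "?m e = 0"
        unfolding y end_multiplicity_def by simp
    qed
  qed (auto simp: end_multiplicity_def)
  finally show ?thesis by simp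
qed

lemma contraction_mark_count:
  assumes G: "marked_weighted_graph n G" and c: "contraction n r \<psi> S G H"
  shows "card {i \<in> {1..n}. mark H i = x} =
     (\<Sum>u | u \<in> verts G \<and> r u = x. card {i \<in> {1..n}. mark G i = u})"
proof -
  note g = marked_weighted_graphD[OF G] and d = contractionD[OF c]
  have "{i \<in> {1..n}. mark H i = x} = (\<Union>u\<in>{u. u \<in> verts G \<and> r u = x}. {i \<in> {1..n}. mark G i = u})"
    using d(8) g(9) by auto
  then show ?thesis
    using g(1) by (simp, subst card_UN_disjoint) auto
qed

lemma stable_graphD:
  assumes "stable_graph g n G"
  shows "marked_weighted_graph n G" "genus G = int g"
    "\<And>v. \<lbrakk>v \<in> verts G; weight G v = 0\<rbrakk> \<Longrightarrow> valence G v + card {i \<in> {1..n}. mark G i = v} \<ge> 3"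
  using assms by (auto simp: stable_graph_def)

text \<open>Only the merged vertex is critical. If its weight is 0, then \<open>e\<close> was no
  loop and both ends had weight 0, so valence plus markings is at least \<open>3 + 3 - 2\<close>
  there.\<close>

lemma stable_contract_edge:
  assumes st: "stable_graph g n G" and e: "e \<in> edges G"
  shows "stable_graph g n (contract_edge e G)"
proof -
  note s = stable_graphD[OF st]
  note g = marked_weighted_graphD[OF s(1)]
  define r where "r = (\<lambda>v. if v \<in> ends G e then Min (ends G e) else v)"
  let ?H = "contract_edge e G" and ?a = "Min (ends G e)"
  have c: "contraction n r id {e} G ?H"
    unfolding r_def by (rule contraction_contract_edge[OF s(1) e])
  note d = contractionD[OF c]
  have a: "?a \<in> ends G e"
    by (rule Min_in[OF g(6,7)[OF e]])
  have im: "r ` ends G e = {?a}"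
    using a by (auto simp: r_def)
  let ?M = "\<lambda>G v. card {i \<in> {1..n}. mark G i = v}"
  have "valence ?H x + ?M ?H x \<ge> 3" if x: "x \<in> verts ?H" "weight ?H x = 0" for x
  proof (cases "x = ?a")
    case True
    have F: "{u. u \<in> verts G \<and> r u = x} = ends G e"
      using True a g(4)[OF e] by (auto simp: r_def)
    have E: "{e' \<in> {e}. r ` ends G e' = {x}} = {e}"
      using im True by auto
    \<comment> \<open>The total weight of the ends equals their number minus 2. It is nonnegative
      and there are at most two ends, so there are exactly two, both of weight 0.\<close>
    have w: "(\<Sum>u\<in>ends G e. int (weight G u)) - int (card (ends G e)) + 1 = -1"
      using d(7)[OF x(1)] x(2) unfolding F E by (simp add: sum_subtractf)
    have "0 \<le> (\<Sum>u\<in>ends G e. int (weight G u))"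
      by (rule sum_nonneg) simp
    with w g(5)[OF e] have "card (ends G e) = 2" "(\<Sum>u\<in>ends G e. int (weight G u)) = 0"
      by auto
    then obtain u v where uv: "ends G e = {u, v}" "u \<noteq> v" "weight G u = 0" "weight G v = 0"
      by (auto simp: card_2_iff)
    then have "u \<in> verts G" "v \<in> verts G"
      using g(4)[OF e] by auto
    from s(3)[OF this(1) uv(3)] s(3)[OF this(2) uv(4)]
    have "valence G u + ?M G u \<ge> 3" "valence G v + ?M G v \<ge> 3" by auto
    moreover have "valence G u + valence G v = valence ?H x + 2"
      using contraction_valence[OF s(1) c, of x] uv unfolding F E by simp
    moreover have "?M ?H x = ?M G u + ?M G v"
      using contraction_mark_count[OF s(1) c, of x] uv unfolding F by simp
    ultimately show ?thesis by linarith
  next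
    case False
    obtain v where "v \<in> verts G" "x = r v"
      using x(1) d(2) by auto
    then have v: "x \<in> verts G" "x \<notin> ends G e"
      using False by (auto simp: r_def split: if_splits)
    then have F: "{u. u \<in> verts G \<and> r u = x} = {x}"
      using False by (auto simp: r_def)
    have E: "{e' \<in> {e}. r ` ends G e' = {x}} = {}"
      using im False by auto
    have "weight G x = 0"
      using d(7)[OF x(1)] x(2) unfolding F E by simp
    from s(3)[OF v(1) this] show ?thesis
      using contraction_valence[OF s(1) c, of x] contraction_mark_count[OF s(1) c, of x]
      unfolding F E by simp
  qed
  then show ?thesis
    using contraction_marked_weighted_graph[OF s(1) c] contraction_genus[OF s(1) c] s(2)
    by (simp add: stable_graph_def)
qed

lemma stable_isomorphic:
  assumes st: "stable_graph g n G" and c: "contraction n r \<psi> {} G H"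
  shows "stable_graph g n H"
proof -
  note s = stable_graphD[OF st]
  let ?M = "\<lambda>G v. card {i \<in> {1..n}. mark G i = v}"
  have i: "bij_betw r (verts G) (verts H)" "\<And>v. v \<in> verts G \<Longrightarrow> weight H (r v) = weight G v"
    using c unfolding contraction_empty_iff by auto
  have "valence H x + ?M H x \<ge> 3" if x: "x \<in> verts H" "weight H x = 0" for x
  proof -
    obtain v where v: "v \<in> verts G" "x = r v"
      using x(1) i(1) by (auto simp: bij_betw_def)
    have F: "{u. u \<in> verts G \<and> r u = x} = {v}"
      using v i(1) by (auto simp: bij_betw_def inj_on_def)
    show ?thesis
      using s(3)[OF v(1)] x(2) i(2)[OF v(1)] v(2) contraction_valence[OF s(1) c, of x]
        contraction_mark_count[OF s(1) c, of x]
      unfolding F by simp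
  qed
  then show ?thesis
    using contraction_marked_weighted_graph[OF s(1) c] contraction_genus[OF s(1) c] s(2)
    by (simp add: stable_graph_def)
qed

lemma contraction_id: "contraction n id id {} G G"
  by (simp add: contraction_empty_iff)

lemma contraction_fold:
  assumes "stable_graph g n G" "distinct xs" "set xs \<subseteq> edges G"
  shows "stable_graph g n (fold contract_edge xs G) \<and>
     (\<exists>r. contraction n r id (set xs) G (fold contract_edge xs G))"
  using assms
proof (induction xs arbitrary: G)
  case Nil
  then show ?case
    using contraction_id[of n G] by (auto simp: id_def)
next
  case (Cons e xs)
  let ?H = "contract_edge e G"
  have e: "e \<in> edges G" using Cons.prems by auto
  have G: "marked_weighted_graph n G"
    using Cons.prems by (simp add: stable_graph_def)
  have "edges ?H = edges G - {e}"
    by (simp add: contract_edge_def Let_def)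
  then have "set xs \<subseteq> edges ?H"
    using Cons.prems by auto
  with Cons.IH[OF stable_contract_edge[OF Cons.prems(1) e]] Cons.prems
  obtain r where "stable_graph g n (fold contract_edge xs ?H)"
      "contraction n r id (set xs) ?H (fold contract_edge xs ?H)"
    by (metis distinct.simps(2))
  then have IH: "stable_graph g n (fold contract_edge (e # xs) G)"
      "contraction n r id (set xs) ?H (fold contract_edge (e # xs) G)"
    by simp_all
  have "{e} \<union> {e' \<in> edges G - {e}. id e' \<in> set xs} = set (e # xs)"
    using Cons.prems by auto
  then have "contraction n (r \<circ> (\<lambda>v. if v \<in> ends G e then Min (ends G e) else v)) id (set (e # xs)) G
      (fold contract_edge (e # xs) G)"
    using contraction_comp[OF G contraction_contract_edge[OF G e] IH(2)] by (simp only: id_comp)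
  with IH(1) show ?case
    by (intro conjI exI)
qed

lemma contraction_contract_edges:
  assumes "stable_graph g n G" "S \<subseteq> edges G"
  obtains r where "contraction n r id S G (contract_edges S G)" "stable_graph g n (contract_edges S G)"
proof -
  have "finite S"
    using finite_subset[OF assms(2) marked_weighted_graphD(3)[OF stable_graphD(1)[OF assms(1)]]] .
  then show thesis
    using contraction_fold[OF assms(1), of "sorted_list_of_set S"] assms(2) that
    by (auto simp: contract_edges_def)
qed

text \<open>By uniqueness any contraction agrees up to isomorphism with the iterated
  \<open>contract_edge\<close>, for which stability has been checked edge by edge.\<close>

lemma stable_contraction:
  assumes st: "stable_graph g n G" and c: "contraction n r \<psi> S G H"
  shows "stable_graph g n H"
proof -
  have "S \<subseteq> edges G"
    using contractionD(1)[OF c] .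
  then obtain r' where c': "contraction n r' id S G (contract_edges S G)"
      and st': "stable_graph g n (contract_edges S G)"
    by (rule contraction_contract_edges[OF st])
  obtain \<phi> where "contraction n \<phi> (\<psi> \<circ> inv_into (edges G - S) id) {} (contract_edges S G) H"
    by (rule contraction_unique[OF stable_graphD(1)[OF st] c' c])
  then show ?thesis
    by (rule stable_isomorphic[OF st'])
qed

section \<open>Isomorphism classes and face maps\<close>

lemma isomorphic_iff:
  "isomorphic n (G, \<tau>) (H, \<sigma>) \<longleftrightarrow>
     (\<exists>\<phi> \<psi>. contraction n \<phi> \<psi> {} G H \<and> (\<forall>e \<in> edges G. \<sigma> (\<psi> e) = \<tau> e))"
  by (simp add: isomorphic_def contraction_empty_iff conj_assoc)

lemma labelled_graphsD:
  assumes "(G, \<tau>) \<in> labelled_graphs g n p"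
  shows "stable_graph g n G" "card (edges G) = p + 1" "bij_betw \<tau> (edges G) {..p}"
    "marked_weighted_graph n G"
  using assms by (auto simp: labelled_graphs_def stable_graph_def)

lemma equiv_iso_rel: "equiv (labelled_graphs g n p) (iso_rel g n p)"
proof (rule equivI)
  show "iso_rel g n p \<subseteq> labelled_graphs g n p \<times> labelled_graphs g n p"
    by (auto simp: iso_rel_def)
  show "refl_on (labelled_graphs g n p) (iso_rel g n p)"
  proof (rule refl_onI)
    fix x assume "x \<in> labelled_graphs g n p"
    moreover have "isomorphic n x x"
      by (cases x) (auto simp: isomorphic_iff intro!: exI[of _ id] contraction_id)
    ultimately show "(x, x) \<in> iso_rel g n p"
      by (simp add: iso_rel_def)
  qed
  show "sym (iso_rel g n p)"
  proof (rule symI)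
    fix x y assume xy: "(x, y) \<in> iso_rel g n p"
    obtain G \<tau> H \<sigma> where eq: "x = (G, \<tau>)" "y = (H, \<sigma>)"
      by (cases x; cases y) auto
    obtain \<phi> \<psi> where c: "contraction n \<phi> \<psi> {} G H" and l: "\<And>e. e \<in> edges G \<Longrightarrow> \<sigma> (\<psi> e) = \<tau> e"
      using xy by (auto simp: iso_rel_def eq isomorphic_iff)
    have G: "marked_weighted_graph n G"
      using xy labelled_graphsD(4) by (auto simp: iso_rel_def eq)
    \<comment> \<open>The inverse isomorphism comes from comparing \<open>c\<close> with the
      identity of \<open>G\<close>, both being contractions of the empty set.\<close>
    obtain \<phi>' where c': "contraction n \<phi>' (id \<circ> inv_into (edges G - {}) \<psi>) {} H G"
      by (rule contraction_unique[OF G c contraction_id])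
    have b: "bij_betw \<psi> (edges G) (edges H)"
      using c by (simp add: contraction_empty_iff)
    have "\<tau> ((id \<circ> inv_into (edges G - {}) \<psi>) e) = \<sigma> e" if e: "e \<in> edges H" for e
    proof -
      have "inv_into (edges G) \<psi> e \<in> edges G" "\<psi> (inv_into (edges G) \<psi> e) = e"
        using b e by (auto simp: bij_betw_def inv_into_into f_inv_into_f)
      then show ?thesis
        using l[of "inv_into (edges G) \<psi> e"] by simp
    qed
    then have "isomorphic n y x"
      using c' unfolding eq isomorphic_iff by blast
    then show "(y, x) \<in> iso_rel g n p"
      using xy by (simp add: iso_rel_def)
  qed
  show "trans (iso_rel g n p)"
  proof (rule transI)
    fix x y z assume xy: "(x, y) \<in> iso_rel g n p" and yz: "(y, z) \<in> iso_rel g n p"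
    obtain G \<tau> H \<sigma> K \<rho> where eq: "x = (G, \<tau>)" "y = (H, \<sigma>)" "z = (K, \<rho>)"
      by (cases x; cases y; cases z) auto
    obtain \<phi> \<psi> where c: "contraction n \<phi> \<psi> {} G H" and l: "\<And>e. e \<in> edges G \<Longrightarrow> \<sigma> (\<psi> e) = \<tau> e"
      using xy by (auto simp: iso_rel_def eq isomorphic_iff)
    obtain \<phi>' \<psi>' where c': "contraction n \<phi>' \<psi>' {} H K" and l': "\<And>e. e \<in> edges H \<Longrightarrow> \<rho> (\<psi>' e) = \<sigma> e"
      using yz by (auto simp: iso_rel_def eq isomorphic_iff)
    have G: "marked_weighted_graph n G"
      using xy labelled_graphsD(4) by (auto simp: iso_rel_def eq)
    have "contraction n (\<phi>' \<circ> \<phi>) (\<psi>' \<circ> \<psi>) {} G K"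
      using contraction_comp[OF G c c'] by simp
    moreover have "\<rho> ((\<psi>' \<circ> \<psi>) e) = \<tau> e" if "e \<in> edges G" for e
    proof -
      have "\<psi> e \<in> edges H"
        using c that bij_betwE unfolding contraction_empty_iff by blast
      then show ?thesis
        using l[OF that] l'[of "\<psi> e"] by simp
    qed
    ultimately have "isomorphic n x z"
      unfolding eq isomorphic_iff by blast
    then show "(x, z) \<in> iso_rel g n p"
      using xy yz by (simp add: iso_rel_def)
  qed
qed

definition cell_of :: "nat \<Rightarrow> nat \<Rightarrow> nat \<Rightarrow> labelled_graph \<Rightarrow> labelled_graph set" where
  "cell_of g n p x = iso_rel g n p `` {x}"

lemma cell_of_in_cells: "x \<in> labelled_graphs g n p \<Longrightarrow> cell_of g n p x \<in> cells g n p"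
  unfolding cell_of_def cells_def by (rule quotientI)

lemma cells_cases:
  assumes "c \<in> cells g n p"
  obtains G \<tau> where "(G, \<tau>) \<in> labelled_graphs g n p" "c = cell_of g n p (G, \<tau>)"
  using assms unfolding cells_def cell_of_def by (auto elim!: quotientE)

lemma cell_of_eqI:
  assumes "(x, y) \<in> iso_rel g n p"
  shows "cell_of g n p x = cell_of g n p y"
  unfolding cell_of_def by (rule equiv_class_eq[OF equiv_iso_rel assms])

lemma cell_of_eqD:
  assumes "cell_of g n p x = cell_of g n p y" "y \<in> labelled_graphs g n p"
  shows "(x, y) \<in> iso_rel g n p"
  using assms eq_equiv_class[OF _ equiv_iso_rel] unfolding cell_of_def by blast

lemma contraction_labelled:
  assumes x: "(G, \<tau>) \<in> labelled_graphs g n q" and \<theta>: "inj_on \<theta> {..p}" "\<theta> ` {..p} \<subseteq> {..q}"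
    and c: "contraction n r \<psi> {e \<in> edges G. \<tau> e \<notin> \<theta> ` {..p}} G H"
    and l: "\<And>e. \<lbrakk>e \<in> edges G; \<tau> e \<in> \<theta> ` {..p}\<rbrakk> \<Longrightarrow> \<sigma> (\<psi> e) \<le> p \<and> \<theta> (\<sigma> (\<psi> e)) = \<tau> e"
  shows "(H, \<sigma>) \<in> labelled_graphs g n p"
proof -
  note x' = labelled_graphsD[OF x]
  let ?E = "edges G - {e \<in> edges G. \<tau> e \<notin> \<theta> ` {..p}}"
  have E: "e \<in> ?E \<longleftrightarrow> e \<in> edges G \<and> \<tau> e \<in> \<theta> ` {..p}" for e
    by auto
  note b = contractionD(3)[OF c]
  have "bij_betw \<sigma> (edges H) {..p}"
    unfolding bij_betw_def
  proof
    show "inj_on \<sigma> (edges H)"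
    proof (rule inj_onI)
      fix e1 e2 assume "e1 \<in> edges H" "e2 \<in> edges H" and eq: "\<sigma> e1 = \<sigma> e2"
      then obtain f1 f2 where f: "f1 \<in> ?E" "e1 = \<psi> f1" "f2 \<in> ?E" "e2 = \<psi> f2"
        using b unfolding bij_betw_def by blast
      then have "\<tau> f1 = \<tau> f2"
        using l[of f1] l[of f2] eq E by metis
      then show "e1 = e2"
        using f x'(3) by (auto simp: bij_betw_def inj_on_def)
    qed
    show "\<sigma> ` edges H = {..p}"
    proof (intro equalityI subsetI)
      fix i assume "i \<in> \<sigma> ` edges H"
      then show "i \<in> {..p}"
        using b l E unfolding bij_betw_def by force
    next
      fix i assume i: "i \<in> {..p}"
      then have "\<theta> i \<in> \<tau> ` edges G"
        using \<theta>(2) x'(3) by (auto simp: bij_betw_def)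
      then obtain e where e: "e \<in> edges G" "\<tau> e = \<theta> i" by auto
      then have "\<sigma> (\<psi> e) \<le> p" "\<theta> (\<sigma> (\<psi> e)) = \<theta> i"
        using l[of e] i by auto
      then have "\<sigma> (\<psi> e) = i"
        using \<theta>(1) i by (auto simp: inj_on_def)
      moreover have "\<psi> e \<in> edges H"
        using bij_betwE[OF b] e i by auto
      ultimately show "i \<in> \<sigma> ` edges H" by blast
    qed
  qed
  moreover from bij_betw_same_card[OF this] have "card (edges H) = p + 1" by simp
  ultimately show ?thesis
    using stable_contraction[OF x'(1) c] by (simp add: labelled_graphs_def)
qed

lemma contract_labels:
  assumes "inj_on \<theta> {..p}" "\<tau> e \<in> \<theta> ` {..p}"
  shows "(the_inv_into {..p} \<theta> \<circ> \<tau>) (id e) \<le> p \<and> \<theta> ((the_inv_into {..p} \<theta> \<circ> \<tau>) (id e)) = \<tau> e"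
  using the_inv_into_into[OF assms(1) assms(2) order_refl] f_the_inv_into_f[OF assms] by simp

text \<open>Frees all later face computations from the vertex names produced by
  \<open>contract_edges\<close>: any contraction of the right edges with matching labels represents
  the face, since two contractions of the same edge set differ by an isomorphism.\<close>

lemma pull_cell_eq:
  assumes x: "(G, \<tau>) \<in> labelled_graphs g n q" and \<theta>: "inj_on \<theta> {..p}" "\<theta> ` {..p} \<subseteq> {..q}"
    and c: "contraction n r \<psi> {e \<in> edges G. \<tau> e \<notin> \<theta> ` {..p}} G H"
    and l: "\<And>e. \<lbrakk>e \<in> edges G; \<tau> e \<in> \<theta> ` {..p}\<rbrakk> \<Longrightarrow> \<sigma> (\<psi> e) \<le> p \<and> \<theta> (\<sigma> (\<psi> e)) = \<tau> e"
  shows "pull_cell g n p \<theta> (cell_of g n q (G, \<tau>)) = cell_of g n p (H, \<sigma>)"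
proof -
  let ?P = "\<lambda>(G, \<tau>). cell_of g n p
        (contract_edges {e \<in> edges G. \<tau> e \<notin> \<theta> ` {..p}} G, the_inv_into {..p} \<theta> \<circ> \<tau>)"
  note x' = labelled_graphsD[OF x]
  have H: "(H, \<sigma>) \<in> labelled_graphs g n p"
    by (rule contraction_labelled[OF x \<theta> c l])
  have "?P y = cell_of g n p (H, \<sigma>)" if y: "y \<in> cell_of g n q (G, \<tau>)" for y
  proof -
    obtain G' \<tau>' where eq: "y = (G', \<tau>')" by (cases y)
    then obtain \<phi> \<xi> where c0: "contraction n \<phi> \<xi> {} G G'" and l0: "\<And>e. e \<in> edges G \<Longrightarrow> \<tau>' (\<xi> e) = \<tau> e"
      using y by (auto simp: cell_of_def iso_rel_def isomorphic_iff)
    have y': "(G', \<tau>') \<in> labelled_graphs g n q"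
      using y eq by (auto simp: cell_of_def iso_rel_def)
    let ?S = "{e \<in> edges G. \<tau> e \<notin> \<theta> ` {..p}}" and ?S' = "{e \<in> edges G'. \<tau>' e \<notin> \<theta> ` {..p}}"
    let ?K = "contract_edges ?S' G'" and ?\<rho> = "the_inv_into {..p} \<theta> \<circ> \<tau>'"
    obtain r' where c1: "contraction n r' id ?S' G' ?K"
      by (rule contraction_contract_edges[OF labelled_graphsD(1)[OF y'], of ?S']) auto
    have K: "(?K, ?\<rho>) \<in> labelled_graphs g n p"
      by (rule contraction_labelled[OF y' \<theta> c1 contract_labels[OF \<theta>(1)]])
    have \<xi>: "\<xi> e \<in> edges G'" if "e \<in> edges G" for e
      using c0 that by (auto simp: contraction_empty_iff bij_betw_def)
    have "{} \<union> {e \<in> edges G - {}. \<xi> e \<in> ?S'} = ?S"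
      using \<xi> l0 by auto
    then have cc: "contraction n (r' \<circ> \<phi>) (id \<circ> \<xi>) ?S G ?K"
      using contraction_comp[OF x'(4) c0 c1] by (simp only:)
    obtain \<phi>' where c2: "contraction n \<phi>' ((id \<circ> \<xi>) \<circ> inv_into (edges G - ?S) \<psi>) {} H ?K"
      by (rule contraction_unique[OF x'(4) c cc])
    have "?\<rho> (((id \<circ> \<xi>) \<circ> inv_into (edges G - ?S) \<psi>) e') = \<sigma> e'" if "e' \<in> edges H" for e'
    proof -
      have "e' \<in> \<psi> ` (edges G - ?S)"
        using contractionD(3)[OF c] that by (simp only: bij_betw_def)
      then obtain e where e: "e \<in> edges G - ?S" "e' = \<psi> e"
        by (elim imageE)
      then have "inv_into (edges G - ?S) \<psi> e' = e"
        using contractionD(3)[OF c] by (simp add: bij_betw_def)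
      moreover have "\<sigma> e' \<le> p" "\<theta> (\<sigma> e') = \<tau> e"
        using l[of e] e by auto
      then have "the_inv_into {..p} \<theta> (\<tau> e) = \<sigma> e'"
        using the_inv_into_f_f[OF \<theta>(1), of "\<sigma> e'"] by simp
      ultimately show ?thesis
        using l0 e by simp
    qed
    then have "isomorphic n (H, \<sigma>) (?K, ?\<rho>)"
      using c2 unfolding isomorphic_iff by blast
    then have "cell_of g n p (H, \<sigma>) = cell_of g n p (?K, ?\<rho>)"
      using H K by (intro cell_of_eqI) (simp add: iso_rel_def)
    then show ?thesis
      by (simp add: eq)
  qed
  moreover have "(G, \<tau>) \<in> cell_of g n q (G, \<tau>)"
    unfolding cell_of_def using equiv_class_self[OF equiv_iso_rel x] .
  ultimately have "(\<Union>y \<in> cell_of g n q (G, \<tau>). ?P y) = cell_of g n p (H, \<sigma>)"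
    by blast
  then show ?thesis
    by (simp add: pull_cell_def cell_of_def)
qed

interpretation tropical: symmetric_delta_complex "cells g n" "pull_cell g n" for g n
proof
  fix \<theta> :: "nat \<Rightarrow> nat" and p q :: nat and c assume \<theta>: "inj_on \<theta> {..p}" "\<theta> ` {..p} \<subseteq> {..q}" and "c \<in> cells g n q"
  then obtain G \<tau> where x: "(G, \<tau>) \<in> labelled_graphs g n q" "c = cell_of g n q (G, \<tau>)"
    by (auto elim: cells_cases)
  let ?S = "{e \<in> edges G. \<tau> e \<notin> \<theta> ` {..p}}"
  obtain r where c: "contraction n r id ?S G (contract_edges ?S G)"
    by (rule contraction_contract_edges[OF labelled_graphsD(1)[OF x(1)], of ?S]) auto
  show "pull_cell g n p \<theta> c \<in> cells g n p"
  proof -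
    have "pull_cell g n p \<theta> c = cell_of g n p (contract_edges ?S G, the_inv_into {..p} \<theta> \<circ> \<tau>)"
      unfolding x(2) by (rule pull_cell_eq[OF x(1) \<theta> c contract_labels[OF \<theta>(1)]])
    moreover have "(contract_edges ?S G, the_inv_into {..p} \<theta> \<circ> \<tau>) \<in> labelled_graphs g n p"
      by (rule contraction_labelled[OF x(1) \<theta> c contract_labels[OF \<theta>(1)]])
    ultimately show ?thesis
      by (simp add: cell_of_in_cells)
  qed
next
  fix \<eta> \<theta> :: "nat \<Rightarrow> nat" and p q s :: nat and c
  assume \<eta>: "inj_on \<eta> {..p}" "\<eta> ` {..p} \<subseteq> {..q}" and \<theta>: "inj_on \<theta> {..q}" "\<theta> ` {..q} \<subseteq> {..s}"
    and "c \<in> cells g n s"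
  then obtain G \<tau> where x: "(G, \<tau>) \<in> labelled_graphs g n s" "c = cell_of g n s (G, \<tau>)"
    by (auto elim: cells_cases)
  let ?S = "{e \<in> edges G. \<tau> e \<notin> \<theta> ` {..q}}"
  let ?H = "contract_edges ?S G" and ?\<sigma> = "the_inv_into {..q} \<theta> \<circ> \<tau>"
  obtain r where c: "contraction n r id ?S G ?H"
    by (rule contraction_contract_edges[OF labelled_graphsD(1)[OF x(1)], of ?S]) auto
  have y: "(?H, ?\<sigma>) \<in> labelled_graphs g n q"
    by (rule contraction_labelled[OF x(1) \<theta> c contract_labels[OF \<theta>(1)]])
  let ?S' = "{e \<in> edges ?H. ?\<sigma> e \<notin> \<eta> ` {..p}}"
  let ?K = "contract_edges ?S' ?H" and ?\<rho> = "the_inv_into {..p} \<eta> \<circ> ?\<sigma>"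
  obtain r' where c': "contraction n r' id ?S' ?H ?K"
    by (rule contraction_contract_edges[OF labelled_graphsD(1)[OF y], of ?S']) auto
  have E: "edges ?H = edges G - ?S"
    using contractionD(3)[OF c] by (simp add: bij_betw_def)
  have \<sigma>: "?\<sigma> e = i \<longleftrightarrow> \<tau> e = \<theta> i" if "\<tau> e \<in> \<theta> ` {..q}" "i \<le> q" for e i
    using that inj_onD[OF \<theta>(1), of "?\<sigma> e" i] contract_labels[of \<theta> q \<tau> e, OF \<theta>(1) that(1)]
    by auto
  have \<tau>: "\<tau> e \<in> (\<theta> \<circ> \<eta>) ` {..p} \<longleftrightarrow> \<tau> e \<in> \<theta> ` {..q} \<and> ?\<sigma> e \<in> \<eta> ` {..p}" for e
  proof
    assume "\<tau> e \<in> (\<theta> \<circ> \<eta>) ` {..p}"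
    then obtain i where i: "i \<le> p" "\<tau> e = \<theta> (\<eta> i)" by auto
    then have "\<eta> i \<le> q" using \<eta>(2) by auto
    then show "\<tau> e \<in> \<theta> ` {..q} \<and> ?\<sigma> e \<in> \<eta> ` {..p}"
      using \<sigma>[of e "\<eta> i"] i by auto
  next
    assume *: "\<tau> e \<in> \<theta> ` {..q} \<and> ?\<sigma> e \<in> \<eta> ` {..p}"
    then obtain i where "i \<le> p" "?\<sigma> e = \<eta> i" by blast
    then show "\<tau> e \<in> (\<theta> \<circ> \<eta>) ` {..p}"
      using contract_labels[OF \<theta>(1), of \<tau> e] * by (auto intro!: image_eqI[of _ _ i])
  qed
  have "?S \<union> {e \<in> edges G - ?S. id e \<in> ?S'} = {e \<in> edges G. \<tau> e \<notin> (\<theta> \<circ> \<eta>) ` {..p}}"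
    unfolding \<tau> E by auto
  then have cc: "contraction n (r' \<circ> r) (id \<circ> id) {e \<in> edges G. \<tau> e \<notin> (\<theta> \<circ> \<eta>) ` {..p}} G ?K"
    using contraction_comp[OF labelled_graphsD(4)[OF x(1)] c c'] by simp
  have \<theta>\<eta>: "inj_on (\<theta> \<circ> \<eta>) {..p}" "(\<theta> \<circ> \<eta>) ` {..p} \<subseteq> {..s}"
    using \<eta> \<theta> by (auto intro: comp_inj_on inj_on_subset)
  have "pull_cell g n p (\<theta> \<circ> \<eta>) c = cell_of g n p (?K, ?\<rho>)"
    unfolding x(2)
  proof (rule pull_cell_eq[OF x(1) \<theta>\<eta> cc])
    fix e assume "e \<in> edges G" "\<tau> e \<in> (\<theta> \<circ> \<eta>) ` {..p}"
    then have "\<tau> e \<in> \<theta> ` {..q}" "?\<sigma> e \<in> \<eta> ` {..p}"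
      using \<tau> by auto
    then show "?\<rho> ((id \<circ> id) e) \<le> p \<and> (\<theta> \<circ> \<eta>) (?\<rho> ((id \<circ> id) e)) = \<tau> e"
      using contract_labels[OF \<theta>(1), of \<tau> e] contract_labels[OF \<eta>(1), of ?\<sigma> e] by simp
  qed
  moreover have "pull_cell g n q \<theta> c = cell_of g n q (?H, ?\<sigma>)"
    unfolding x(2) by (rule pull_cell_eq[OF x(1) \<theta> c contract_labels[OF \<theta>(1)]])
  moreover have "pull_cell g n p \<eta> (cell_of g n q (?H, ?\<sigma>)) = cell_of g n p (?K, ?\<rho>)"
    by (rule pull_cell_eq[OF y \<eta> c' contract_labels[OF \<eta>(1)]])
  ultimately show "pull_cell g n p \<eta> (pull_cell g n q \<theta> c) = pull_cell g n p (\<theta> \<circ> \<eta>) c"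
    by simp
qed

lemma tropical_moduli_space_eq: "tropical_moduli_space g n = tropical.realization g n"
  by (simp add: tropical_moduli_space_def tropical.realization_def coproduct_space_def
      tropical.coproduct_def tropical.point_def[abs_def] glue_def[abs_def] tropical.glued_def[abs_def])

section \<open>Positive genus\<close>

lemma vertex_face:
  assumes x: "(G, \<tau>) \<in> labelled_graphs g n q" and e: "e \<in> edges G"
    and c: "contraction n r \<psi> (edges G - {e}) G H" and \<sigma>: "\<sigma> (\<psi> e) = 0"
  shows "tropical.cell_vertex g n (cell_of g n q (G, \<tau>)) (\<tau> e) = cell_of g n 0 (H, \<sigma>)"
    and "(H, \<sigma>) \<in> labelled_graphs g n 0"
proof -
  have b: "bij_betw \<tau> (edges G) {..q}"
    by (rule labelled_graphsD(3)[OF x])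
  have \<theta>: "inj_on (\<lambda>_::nat. \<tau> e) {..0}" "(\<lambda>_::nat. \<tau> e) ` {..0} \<subseteq> {..q}"
    using bij_betwE[OF b] e by auto
  have S: "{e' \<in> edges G. \<tau> e' \<notin> (\<lambda>_. \<tau> e) ` {..0::nat}} = edges G - {e}"
    using bij_betw_imp_inj_on[OF b] e by (auto simp: inj_on_def)
  have l: "\<sigma> (\<psi> e') \<le> 0 \<and> \<tau> e = \<tau> e'" if "e' \<in> edges G" "\<tau> e' \<in> (\<lambda>_. \<tau> e) ` {..0::nat}" for e'
    using that inj_onD[OF bij_betw_imp_inj_on[OF b], of e' e] e \<sigma> by auto
  note c' = c[folded S]
  show "tropical.cell_vertex g n (cell_of g n q (G, \<tau>)) (\<tau> e) = cell_of g n 0 (H, \<sigma>)"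
    unfolding tropical.cell_vertex_def by (rule pull_cell_eq[OF x \<theta> c' l])
  show "(H, \<sigma>) \<in> labelled_graphs g n 0"
    by (rule contraction_labelled[OF x \<theta> c' l])
qed

lemma edge_face:
  fixes \<tau> :: "nat \<Rightarrow> nat"
  assumes x: "(G, \<tau>) \<in> labelled_graphs g n q" and e: "e \<in> edges G" "f \<in> edges G" "e \<noteq> f"
    and c: "contraction n r \<psi> (edges G - {e, f}) G H" and \<sigma>: "\<sigma> (\<psi> e) = 0" "\<sigma> (\<psi> f) = 1"
  defines "\<theta> \<equiv> \<lambda>i::nat. if i = 0 then \<tau> e else \<tau> f"
  shows "inj_on \<theta> {..1}" "\<theta> ` {..1} \<subseteq> {..q}"
    "pull_cell g n 1 \<theta> (cell_of g n q (G, \<tau>)) = cell_of g n 1 (H, \<sigma>)"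
    "(H, \<sigma>) \<in> labelled_graphs g n 1"
proof -
  have b: "bij_betw \<tau> (edges G) {..q}"
    by (rule labelled_graphsD(3)[OF x])
  note inj = bij_betw_imp_inj_on[OF b]
  have "\<tau> e \<noteq> \<tau> f"
    using inj_onD[OF inj _ e(1,2)] e(3) by blast
  then show \<theta>: "inj_on \<theta> {..1}" "\<theta> ` {..1} \<subseteq> {..q}"
    using bij_betwE[OF b] e by (auto simp: \<theta>_def inj_on_def)
  have im: "\<theta> ` {..1} = {\<tau> e, \<tau> f}"
    by (auto simp: \<theta>_def image_iff intro: bexI[of _ 0] bexI[of _ 1])
  have S: "{e' \<in> edges G. \<tau> e' \<notin> \<theta> ` {..1}} = edges G - {e, f}"
    unfolding im using inj e by (auto simp: inj_on_def)
  have l: "\<sigma> (\<psi> e') \<le> 1 \<and> \<theta> (\<sigma> (\<psi> e')) = \<tau> e'" if "e' \<in> edges G" "\<tau> e' \<in> \<theta> ` {..1}" for e'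
  proof -
    have "e' = e \<or> e' = f"
      using that inj_onD[OF inj] e unfolding im by blast
    then show ?thesis
      using \<sigma> by (auto simp: \<theta>_def)
  qed
  note c' = c[folded S]
  show "pull_cell g n 1 \<theta> (cell_of g n q (G, \<tau>)) = cell_of g n 1 (H, \<sigma>)"
    by (rule pull_cell_eq[OF x \<theta> c' l])
  show "(H, \<sigma>) \<in> labelled_graphs g n 1"
    by (rule contraction_labelled[OF x \<theta> c' l])
qed

locale tropical_vertex_paths = vertex_paths "cells g n" "pull_cell g n" d0 Q for g n d0 Q
begin

lemma good_face:
  assumes x: "(G, \<tau>) \<in> labelled_graphs g n q" and e: "e \<in> edges G" "f \<in> edges G" "e \<noteq> f"
    and c: "contraction n r \<psi> (edges G - {e, f}) G H" and \<sigma>: "\<sigma> (\<psi> e) = 0" "\<sigma> (\<psi> f) = 1"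
  shows "good q (cell_of g n q (G, \<tau>)) (\<tau> e) (\<tau> f) \<longleftrightarrow> good 1 (cell_of g n 1 (H, \<sigma>)) 0 1"
  using good_pull[OF edge_face(1,2)[OF assms] cell_of_in_cells[OF x], of 0 1]
  unfolding edge_face(3)[OF assms] by simp

end

lemma connected_closed:
  assumes G: "marked_weighted_graph n G" and A: "a \<in> A" "a \<in> verts G"
    and closed: "\<And>e. e \<in> edges G \<Longrightarrow> ends G e \<inter> A \<noteq> {} \<Longrightarrow> ends G e \<subseteq> A"
  shows "verts G \<subseteq> A"
proof
  fix v assume "v \<in> verts G"
  then have "(a, v) \<in> (adjacency G)\<^sup>*"
    using marked_weighted_graphD(8)[OF G] A by blast
  then show "v \<in> A"
  proof induction
    case (step y z)
    then obtain e where "e \<in> edges G" "ends G e = {y, z}"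
      by (auto simp: adjacency_def)
    then show ?case
      using closed[of e] step.IH by auto
  qed (rule A)
qed

lemma vertex_incident:
  assumes G: "marked_weighted_graph n G" and ne: "edges G \<noteq> {}" and v: "v \<in> verts G"
  obtains e where "e \<in> edges G" "v \<in> ends G e"
proof (rule ccontr)
  assume "\<not> thesis"
  then have "\<And>e. e \<in> edges G \<Longrightarrow> v \<notin> ends G e"
    using that by blast
  then have "verts G \<subseteq> {v}"
    by (intro connected_closed[OF G _ v]) auto
  moreover obtain e where "e \<in> edges G" using ne by blast
  ultimately show False
    using marked_weighted_graphD(4,7)[OF G, of e] \<open>\<And>e. e \<in> edges G \<Longrightarrow> v \<notin> ends G e\<close>[of e] by blast
qed

text \<open>Inverse to contracting a loop: one unit of weight at \<open>v\<close> becomes the loop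
  \<open>k\<close>. The subtraction is truncated, so it is meaningful for vertices of positive
  weight.\<close>

definition add_loop :: "mwgraph \<Rightarrow> nat \<Rightarrow> nat \<Rightarrow> mwgraph" where
  "add_loop G v k = G\<lparr>edges := insert k (edges G), ends := (ends G)(k := {v}),
     weight := (weight G)(v := weight G v - 1)\<rparr>"

lemma add_loop_simps [simp]:
  "verts (add_loop G v k) = verts G" "edges (add_loop G v k) = insert k (edges G)"
  "ends (add_loop G v k) = (ends G)(k := {v})"
  "weight (add_loop G v k) = (weight G)(v := weight G v - 1)" "mark (add_loop G v k) = mark G"
  by (simp_all add: add_loop_def)

lemma contraction_add_loop:
  assumes k: "k \<notin> edges G" and v: "v \<in> verts G" "weight G v > 0"
  shows "contraction n id id {k} (add_loop G v k) G"
proof (rule contractionI)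
  fix x assume x: "x \<in> verts G"
  then have "{u. u \<in> verts (add_loop G v k) \<and> id u = x} = {x}"
    by auto
  moreover have "{e \<in> {k}. id ` ends (add_loop G v k) e = {x}} = (if x = v then {k} else {})"
    by auto
  ultimately show "int (weight G x) - 1 =
      (\<Sum>u | u \<in> verts (add_loop G v k) \<and> id u = x. int (weight (add_loop G v k) u) - 1) +
      int (card {e \<in> {k}. id ` ends (add_loop G v k) e = {x}})"
    using v(2) by auto
qed (use k in \<open>auto simp: bij_betw_def\<close>)

text \<open>The weight of \<open>v\<close> may drop to 0. The loop then contributes 2 to the
  valence, and by connectedness one of the old edges contributes at least 1.\<close>

lemma stable_add_loop:
  assumes st: "stable_graph g n G" and k: "k \<notin> edges G" and v: "v \<in> verts G" "weight G v > 0"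
    and ne: "edges G \<noteq> {}"
  shows "stable_graph g n (add_loop G v k)"
proof -
  note s = stable_graphD[OF st]
  note m = marked_weighted_graphD[OF s(1)]
  let ?T = "add_loop G v k"
  have "adjacency G \<subseteq> adjacency ?T"
    using k by (auto simp: adjacency_def)
  then have "(adjacency G)\<^sup>* \<subseteq> (adjacency ?T)\<^sup>*"
    by (rule rtrancl_mono)
  then have "\<forall>x \<in> verts ?T. \<forall>y \<in> verts ?T. (x, y) \<in> (adjacency ?T)\<^sup>*"
    using m(8) by auto
  then have T: "marked_weighted_graph n ?T"
    using s(1) v(1) by (simp add: marked_weighted_graph_def)
  have "(\<Sum>u\<in>verts G. int (weight ?T u)) = (\<Sum>u\<in>verts G. int (weight G u)) - 1"
    using sum.remove[OF m(1) v(1), of "\<lambda>u. int (weight ?T u)"]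
      sum.remove[OF m(1) v(1), of "\<lambda>u. int (weight G u)"] v(2) by simp
  then have genus: "genus ?T = int g"
    using s(2) k m(3) by (simp add: genus_def)
  have val: "valence ?T u = (if u = v then 2 else 0) + valence G u" for u
  proof -
    have "valence ?T u = end_multiplicity {v} u + (\<Sum>e\<in>edges G. end_multiplicity (ends ?T e) u)"
      using k m(3) by (simp add: valence_eq_sum)
    also have "(\<Sum>e\<in>edges G. end_multiplicity (ends ?T e) u) = valence G u"
      using k m(3) by (auto simp: valence_eq_sum intro!: sum.cong)
    finally show ?thesis
      by (simp add: end_multiplicity_def)
  qed
  have "valence G v \<ge> 1"
  proof -
    obtain e where e: "e \<in> edges G" "v \<in> ends G e"
      by (rule vertex_incident[OF s(1) ne v(1)])
    then have "1 \<le> end_multiplicity (ends G e) v"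
      by (simp add: end_multiplicity_def)
    also have "\<dots> \<le> valence G v"
      unfolding valence_eq_sum[OF m(3)] using m(3) e by (intro member_le_sum) auto
    finally show ?thesis .
  qed
  then have "valence ?T u + card {i \<in> {1..n}. mark ?T i = u} \<ge> 3"
    if "u \<in> verts ?T" "weight ?T u = 0" for u
    using that s(3)[of u] by (cases "u = v") (auto simp: val)
  then show ?thesis
    using T genus by (simp add: stable_graph_def)
qed

section \<open>The base vertex and the 1-cells that leave it\<close>

definition loop_cell :: "nat \<Rightarrow> nat \<Rightarrow> labelled_graph set" where
  "loop_cell g n = {(G, \<tau>). (G, \<tau>) \<in> labelled_graphs g n 0 \<and> card (verts G) = 1}"

lemma labelled_graphs_0D:
  assumes "(G, \<tau>) \<in> labelled_graphs g n 0"
  obtains e where "edges G = {e}" "\<tau> e = 0" "verts G = ends G e"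
proof -
  note d = labelled_graphsD[OF assms]
  note m = marked_weighted_graphD[OF d(4)]
  obtain e where e: "edges G = {e}"
    using d(2) by (auto simp: card_1_singleton_iff)
  then obtain a where a: "a \<in> ends G e" "a \<in> verts G"
    using m(4,7)[of e] by blast
  have "verts G \<subseteq> ends G e"
    using e by (intro connected_closed[OF d(4) a]) auto
  then show thesis
    using that[OF e] d(3) m(4)[of e] e by (auto simp: bij_betw_def)
qed

text \<open>One vertex and one edge leave no freedom: the genus fixes the weight, and all markings
  sit at the vertex.\<close>

lemma cell_of_one_vertex:
  assumes x: "(G, \<tau>) \<in> labelled_graphs g n 0" and one: "card (verts G) = 1"
  shows "cell_of g n 0 (G, \<tau>) = loop_cell g n"
proof (intro equalityI subsetI)
  fix y assume y: "y \<in> cell_of g n 0 (G, \<tau>)"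
  obtain H \<sigma> where eq: "y = (H, \<sigma>)" by (cases y)
  then obtain \<phi> \<psi> where "contraction n \<phi> \<psi> {} G H"
    using y by (auto simp: cell_of_def iso_rel_def isomorphic_iff)
  then have "card (verts H) = 1"
    using one bij_betw_same_card by (fastforce simp: contraction_empty_iff)
  then show "y \<in> loop_cell g n"
    using y by (auto simp: eq cell_of_def iso_rel_def loop_cell_def)
next
  fix y assume "y \<in> loop_cell g n"
  then obtain H \<sigma> where y: "y = (H, \<sigma>)" "(H, \<sigma>) \<in> labelled_graphs g n 0" "card (verts H) = 1"
    by (auto simp: loop_cell_def)
  obtain v w where v: "verts G = {v}" and w: "verts H = {w}"
    using one y(3) by (auto simp: card_1_singleton_iff)
  obtain e where e: "edges G = {e}" "\<tau> e = 0" "verts G = ends G e"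
    by (rule labelled_graphs_0D[OF x])
  obtain f where f: "edges H = {f}" "\<sigma> f = 0" "verts H = ends H f"
    by (rule labelled_graphs_0D[OF y(2)])
  have weights: "weight H w = weight G v"
    using stable_graphD(2)[OF labelled_graphsD(1)[OF x]] stable_graphD(2)[OF labelled_graphsD(1)[OF y(2)]]
    by (simp add: genus_def v w e(1) f(1))
  have "mark H i = w" if "i \<in> {1..n}" for i
    using marked_weighted_graphD(9)[OF labelled_graphsD(4)[OF y(2)]] that w by auto
  then have "contraction n (\<lambda>_. w) (\<lambda>_. f) {} G H"
    unfolding contraction_empty_iff using v w e f weights by (auto simp: bij_betw_def)
  then have "isomorphic n (G, \<tau>) (H, \<sigma>)"
    unfolding isomorphic_iff using e f by (intro exI conjI) auto
  then show "y \<in> cell_of g n 0 (G, \<tau>)"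
    using x y by (simp add: cell_of_def iso_rel_def)
qed

lemma cell_of_eq_loop_cellD:
  assumes x: "(G, \<tau>) \<in> labelled_graphs g n 0" and "cell_of g n 0 (G, \<tau>) = loop_cell g n"
  shows "card (verts G) = 1"
proof -
  have "(G, \<tau>) \<in> cell_of g n 0 (G, \<tau>)"
    unfolding cell_of_def by (rule equiv_class_self[OF equiv_iso_rel x])
  then show ?thesis
    using assms(2) by (simp add: loop_cell_def)
qed

lemma loop_cell_in_cells:
  assumes "g \<ge> 1" "2 * int g - 2 + int n > 0"
  shows "loop_cell g n \<in> cells g n 0"
proof -
  \<comment> \<open>The loop accounts for one unit of genus, hence the weight \<open>g - 1\<close>.
    For \<open>g = 1\<close> the weight is 0 and stability needs a marking, which the inequality
    provides.\<close>
  let ?G = "\<lparr>verts = {0}, edges = {0}, ends = \<lambda>_. {0}, weight = \<lambda>_. g - 1, mark = \<lambda>_. 0\<rparr> :: mwgraph"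
  have "marked_weighted_graph n ?G"
    by (auto simp: marked_weighted_graph_def)
  moreover have "genus ?G = int g"
    using assms by (simp add: genus_def)
  moreover have "valence ?G 0 = 2"
    by (simp add: valence_eq_sum end_multiplicity_def)
  moreover have "{i \<in> {1..n}. mark ?G i = 0} = {1..n}"
    by auto
  ultimately have "(?G, \<lambda>_. 0) \<in> labelled_graphs g n 0"
    using assms by (auto simp: labelled_graphs_def stable_graph_def bij_betw_def)
  from cell_of_in_cells[OF this] cell_of_one_vertex[OF this] show ?thesis by simp
qed

lemma labelled_graphs_1D:
  assumes "(G, \<tau>) \<in> labelled_graphs g n 1"
  obtains e f where "edges G = {e, f}" "e \<noteq> f" "\<tau> e = 0" "\<tau> f = 1"
proof -
  have b: "bij_betw \<tau> (edges G) {..1}" and c: "card (edges G) = 2"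
    using labelled_graphsD[OF assms] by auto
  have "0 \<in> \<tau> ` edges G" "1 \<in> \<tau> ` edges G"
    using b by (simp_all add: bij_betw_def)
  then obtain e f where ef: "e \<in> edges G" "\<tau> e = 0" "f \<in> edges G" "\<tau> f = 1"
    by force
  then have "e \<noteq> f" by auto
  moreover have "{e, f} = edges G"
    using c ef \<open>e \<noteq> f\<close> by (intro card_subset_eq) (auto intro: card_ge_0_finite)
  ultimately show thesis
    using that[of e f] ef by simp
qed

text \<open>The contraction collapses all vertices when one contracted edge meets all of them.\<close>

lemma vertex_face_loop:
  assumes x: "(G, \<tau>) \<in> labelled_graphs g n q" and e: "e \<in> edges G"
    and f: "f \<in> edges G" "f \<noteq> e" "verts G \<subseteq> ends G f"
  shows "tropical.cell_vertex g n (cell_of g n q (G, \<tau>)) (\<tau> e) = loop_cell g n"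
proof -
  note d = labelled_graphsD[OF x]
  let ?H = "contract_edges (edges G - {e}) G"
  obtain r where c: "contraction n r id (edges G - {e}) G ?H"
    by (rule contraction_contract_edges[OF d(1), of "edges G - {e}"]) auto
  have "f \<in> edges G - {e}" using f by simp
  then have "\<And>u v. u \<in> verts G \<Longrightarrow> v \<in> verts G \<Longrightarrow> r u = r v"
    using contractionD(5)[OF c] f(3) by blast
  moreover obtain v where "v \<in> verts G"
    using marked_weighted_graphD(2)[OF d(4)] by blast
  ultimately have "verts ?H = {r v}"
    unfolding contractionD(2)[OF c, symmetric] by blast
  then have "card (verts ?H) = 1" by simp
  then show ?thesis
    using vertex_face[OF x e c, of "\<lambda>_. 0"] cell_of_one_vertex[of ?H "\<lambda>_. 0" g n] by simp
qed

text \<open>Each of the two edges meets all vertices, so contracting either leaves a single loop at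
  one vertex. Exchanging the edges is an automorphism of the graph, which reverses the 1-cell. Two
  loops at the same vertex are included.\<close>

lemma parallel_edges:
  assumes x: "(G, \<tau>) \<in> labelled_graphs g n 1"
    and e: "edges G = {e, f}" "e \<noteq> f" "\<tau> e = 0" "\<tau> f = 1" and eq: "ends G e = ends G f"
  shows "tropical.cell_vertex g n (cell_of g n 1 (G, \<tau>)) 0 = loop_cell g n"
    "tropical.cell_vertex g n (cell_of g n 1 (G, \<tau>)) 1 = loop_cell g n"
    "pull_cell g n 1 (\<lambda>i. 1 - i) (cell_of g n 1 (G, \<tau>)) = cell_of g n 1 (G, \<tau>)"
proof -
  note d = labelled_graphsD[OF x]
  note m = marked_weighted_graphD[OF d(4)]
  obtain a where a: "a \<in> ends G e" "a \<in> verts G"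
    using m(4,7)[of e] e by blast
  have V: "verts G \<subseteq> ends G e"
    using e eq by (intro connected_closed[OF d(4) a]) auto
  show "tropical.cell_vertex g n (cell_of g n 1 (G, \<tau>)) 0 = loop_cell g n"
    "tropical.cell_vertex g n (cell_of g n 1 (G, \<tau>)) 1 = loop_cell g n"
    using vertex_face_loop[OF x, of e f] vertex_face_loop[OF x, of f e] V e eq by simp_all
  let ?\<theta> = "\<lambda>i::nat. 1 - i" and ?\<psi> = "\<lambda>x. if x = e then f else e"
  have \<theta>: "inj_on ?\<theta> {..1}" "?\<theta> ` {..1} \<subseteq> {..1}"
    by (auto simp: inj_on_def)
  have im: "?\<theta> ` {..1} = {0, 1}"
    by (simp add: atMost_Suc insert_commute)
  have S: "{x \<in> edges G. \<tau> x \<notin> ?\<theta> ` {..1}} = {}"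
    unfolding im using e by auto
  have "contraction n id ?\<psi> {} G G"
    unfolding contraction_empty_iff using e eq by (auto simp: bij_betw_def)
  then show "pull_cell g n 1 ?\<theta> (cell_of g n 1 (G, \<tau>)) = cell_of g n 1 (G, \<tau>)"
    unfolding S[symmetric] using e by (intro pull_cell_eq[OF x \<theta>]) auto
qed

text \<open>A vertex of a cell keeps the edge with its label and contracts the rest. With 0 on the
  loop and 1 on the bridge, the 1-cell starts at the base vertex.\<close>

abbreviation loop_label :: "nat \<Rightarrow> nat \<Rightarrow> nat" where
  "loop_label k \<equiv> \<lambda>x. if x = k then 0 else 1"

lemma add_loop_labelled:
  assumes B: "(B, \<sigma>) \<in> labelled_graphs g n 0" and k: "k \<notin> edges B"
    and v: "v \<in> verts B" "weight B v > 0"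
  shows "(add_loop B v k, loop_label k) \<in> labelled_graphs g n 1"
proof -
  obtain f where f: "edges B = {f}"
    by (rule labelled_graphs_0D[OF B])
  have "stable_graph g n (add_loop B v k)"
    by (rule stable_add_loop[OF labelled_graphsD(1)[OF B] k v]) (simp add: f)
  moreover have "bij_betw (loop_label k) {k, f} {..1}"
    using k f by (simp add: bij_betw_def atMost_Suc insert_commute)
  ultimately show ?thesis
    using k f by (simp add: labelled_graphs_def)
qed

text \<open>The class depends only on the bridge graph with its distinguished end, not on the name
  of the loop; this permits moving all loops to one representative graph.\<close>

lemma add_loop_cell_cong:
  assumes B: "(B, \<sigma>) \<in> labelled_graphs g n 0" and B': "(B', \<sigma>') \<in> labelled_graphs g n 0"
    and c: "contraction n \<phi> \<psi> {} B B'" and k: "k \<notin> edges B" "k' \<notin> edges B'"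
    and v: "v \<in> verts B" "weight B v > 0"
  shows "cell_of g n 1 (add_loop B v k, loop_label k) = cell_of g n 1 (add_loop B' (\<phi> v) k', loop_label k')"
proof (rule cell_of_eqI)
  note i = c[unfolded contraction_empty_iff]
  have v': "\<phi> v \<in> verts B'" "weight B' (\<phi> v) > 0"
    using i v bij_betwE by fastforce+
  have inj: "\<phi> u = \<phi> v \<longleftrightarrow> u = v" if "u \<in> verts B" for u
    using i v(1) that by (auto simp: bij_betw_def inj_on_def)
  have \<psi>: "\<psi> e \<noteq> k'" if "e \<in> edges B" for e
    using i k(2) that bij_betwE by fastforce
  have "bij_betw (\<psi>(k := k')) (insert k (edges B)) (insert k' (edges B'))"
  proof -
    have "bij_betw (\<psi>(k := k')) (edges B) (edges B')"
      using i k(1) by (subst bij_betw_cong[of _ _ \<psi>]) auto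
    then show ?thesis
      using k notIn_Un_bij_betw[of k "edges B" "\<psi>(k := k')" "edges B'"] by simp
  qed
  then have "contraction n \<phi> (\<psi>(k := k')) {} (add_loop B v k) (add_loop B' (\<phi> v) k')"
    unfolding contraction_empty_iff using i k inj \<psi> by auto
  moreover have "loop_label k' ((\<psi>(k := k')) e) = loop_label k e" if "e \<in> edges (add_loop B v k)" for e
    using that \<psi> by auto
  ultimately have "isomorphic n (add_loop B v k, loop_label k) (add_loop B' (\<phi> v) k', loop_label k')"
    unfolding isomorphic_iff by blast
  then show "((add_loop B v k, loop_label k), (add_loop B' (\<phi> v) k', loop_label k')) \<in> iso_rel g n 1"
    using add_loop_labelled[OF B k(1) v] add_loop_labelled[OF B' k(2) v'] by (simp add: iso_rel_def)
qed

definition loop_bridge_cells :: "nat \<Rightarrow> nat \<Rightarrow> labelled_graph set set" where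
  "loop_bridge_cells g n = {cell_of g n 1 (G, \<tau>) | G \<tau> e f. (G, \<tau>) \<in> labelled_graphs g n 1 \<and>
     edges G = {e, f} \<and> e \<noteq> f \<and> \<tau> e = 0 \<and> \<tau> f = 1 \<and> card (ends G e) = 1 \<and> card (ends G f) = 2}"

lemma loop_bridge_cells_subset: "loop_bridge_cells g n \<subseteq> cells g n 1"
  by (auto simp: loop_bridge_cells_def intro: cell_of_in_cells)

lemma loop_bridge_cellE:
  assumes "c \<in> loop_bridge_cells g n"
  obtains B v k where "(B, \<lambda>_. 0) \<in> labelled_graphs g n 0" "card (verts B) = 2" "v \<in> verts B"
    "weight B v > 0" "k \<notin> edges B" "c = cell_of g n 1 (add_loop B v k, loop_label k)"
    "tropical.cell_vertex g n c 0 = loop_cell g n"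
    "tropical.cell_vertex g n c 1 = cell_of g n 0 (B, \<lambda>_. 0)"
proof -
  obtain G \<tau> e f where x: "(G, \<tau>) \<in> labelled_graphs g n 1" and e: "edges G = {e, f}" "e \<noteq> f"
      "\<tau> e = 0" "\<tau> f = 1" and ce: "card (ends G e) = 1" and cf: "card (ends G f) = 2"
      and c: "c = cell_of g n 1 (G, \<tau>)"
    using assms by (auto simp: loop_bridge_cells_def)
  note d = labelled_graphsD[OF x]
  note m = marked_weighted_graphD[OF d(4)]
  obtain v where v: "ends G e = {v}"
    using ce by (auto simp: card_1_singleton_iff)
  have vV: "v \<in> verts G"
    using m(4)[of e] v e by auto
  \<comment> \<open>The loop \<open>e\<close> is turned back into weight, so that \<open>G\<close>
    is recovered by attaching a loop to \<open>B\<close>.\<close>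
  define B where "B = G\<lparr>edges := {f}, weight := (weight G)(v := Suc (weight G v))\<rparr>"
  have B: "verts B = verts G" "edges B = {f}" "ends B = ends G"
      "weight B = (weight G)(v := Suc (weight G v))" "mark B = mark G"
    by (simp_all add: B_def)
  obtain a where a: "a \<in> ends G f" "a \<in> verts G"
    using m(4,7)[of f] e by blast
  have "verts G \<subseteq> ends G f"
    using e v by (intro connected_closed[OF d(4) a]) auto
  then have V: "verts G = ends G f"
    using m(4)[of f] e by auto
  have iso: "contraction n id id {} G (add_loop B v e)"
    unfolding contraction_empty_iff using e v by (auto simp: B bij_betw_def)
  have "contraction n id id {e} (add_loop B v e) B"
    by (rule contraction_add_loop) (use e vV in \<open>auto simp: B\<close>)
  then have "contraction n (id \<circ> id) (id \<circ> id) ({} \<union> {x \<in> edges G - {}. id x \<in> {e}}) G B"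
    by (rule contraction_comp[OF d(4) iso])
  moreover have "{} \<union> {x \<in> edges G - {}. id x \<in> {e}} = edges G - {f}"
    using e by auto
  ultimately have cB: "contraction n id id (edges G - {f}) G B"
    by simp
  have face: "tropical.cell_vertex g n (cell_of g n 1 (G, \<tau>)) (\<tau> f) = cell_of g n 0 (B, \<lambda>_. 0)"
      "(B, \<lambda>_. 0) \<in> labelled_graphs g n 0"
    using vertex_face[OF x _ cB, of "\<lambda>_. 0"] e by auto
  have eB: "e \<notin> edges B" and vB: "v \<in> verts B" "weight B v > 0"
    using e vV by (auto simp: B)
  have "isomorphic n (G, \<tau>) (add_loop B v e, loop_label e)"
    unfolding isomorphic_iff using iso e by (intro exI[of _ id] exI[of _ id]) auto
  then have "c = cell_of g n 1 (add_loop B v e, loop_label e)"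
    unfolding c using x add_loop_labelled[OF face(2) eB vB]
    by (intro cell_of_eqI) (simp add: iso_rel_def)
  moreover have "tropical.cell_vertex g n c 0 = loop_cell g n"
    using vertex_face_loop[OF x, of e f] e V c by simp
  ultimately show thesis
    using that[OF face(2) _ vB eB] face(1) cf V e c by (simp add: B)
qed

section \<open>Homotopy between the 1-cells from the base vertex to a given bridge vertex\<close>

lemma tropical_segment_face:
  assumes x: "(G, \<tau>) \<in> labelled_graphs g n q" and e: "e \<in> edges G" "f \<in> edges G" "e \<noteq> f"
    and c: "contraction n r \<psi> (edges G - {e, f}) G H" and \<sigma>: "\<sigma> (\<psi> e) = 0" "\<sigma> (\<psi> f) = 1"
  shows "path_hom (tropical.realization g n)
      (tropical.vertex_point g n (tropical.cell_vertex g n (cell_of g n 1 (H, \<sigma>)) 0))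
      (tropical.vertex_point g n (tropical.cell_vertex g n (cell_of g n 1 (H, \<sigma>)) 1))
      (tropical.segment g n q (cell_of g n q (G, \<tau>)) (vert (\<tau> e)) (vert (\<tau> f)))
      (tropical.segment g n 1 (cell_of g n 1 (H, \<sigma>)) (vert 0) (vert 1))"
proof -
  let ?\<theta> = "\<lambda>i::nat. if i = 0 then \<tau> e else \<tau> f"
  note fc = edge_face[OF assms]
  have "push_simplex 1 ?\<theta> (vert 0) = vert (\<tau> e)" "push_simplex 1 ?\<theta> (vert 1) = vert (\<tau> f)"
    using push_simplex_vert[OF fc(1), of 0] push_simplex_vert[OF fc(1), of 1] by simp_all
  then have "path_hom (tropical.realization g n)
      (tropical.point g n (q, cell_of g n q (G, \<tau>), vert (\<tau> e)))
      (tropical.point g n (q, cell_of g n q (G, \<tau>), vert (\<tau> f)))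
      (tropical.segment g n q (cell_of g n q (G, \<tau>)) (vert (\<tau> e)) (vert (\<tau> f)))
      (tropical.segment g n 1 (cell_of g n 1 (H, \<sigma>)) (vert 0) (vert 1))"
    using tropical.segment_push[OF fc(1,2) cell_of_in_cells[OF x], of "vert 0" "vert 1"]
    by (simp add: vert_in_simplex fc(3)[simplified])
  moreover have "tropical.cell_vertex g n (cell_of g n q (G, \<tau>)) (\<tau> e) =
        tropical.cell_vertex g n (cell_of g n 1 (H, \<sigma>)) 0"
      "tropical.cell_vertex g n (cell_of g n q (G, \<tau>)) (\<tau> f) =
        tropical.cell_vertex g n (cell_of g n 1 (H, \<sigma>)) 1"
    using tropical.cell_vertex_pull[OF fc(1,2) cell_of_in_cells[OF x], of 0]
      tropical.cell_vertex_pull[OF fc(1,2) cell_of_in_cells[OF x], of 1] unfolding fc(3) by simp_all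
  moreover have "\<tau> e \<le> q" "\<tau> f \<le> q"
    using bij_betwE[OF labelled_graphsD(3)[OF x]] e by auto
  ultimately show ?thesis
    by (simp add: tropical.point_vertex[OF cell_of_in_cells[OF x]])
qed

text \<open>Two such 1-cells differ at most in the end of the bridge that carries the loop. If the
  ends are different, both 1-cells are sides of the 2-cell with a loop at each end, and the third
  side is folded and hence null-homotopic.\<close>

lemma loop_bridge_segment_unique:
  assumes c: "c \<in> loop_bridge_cells g n" and c': "c' \<in> loop_bridge_cells g n"
    and eq: "tropical.cell_vertex g n c 1 = tropical.cell_vertex g n c' 1"
  shows "path_hom (tropical.realization g n) (tropical.vertex_point g n (loop_cell g n))
      (tropical.vertex_point g n (tropical.cell_vertex g n c 1))
      (tropical.segment g n 1 c (vert 0) (vert 1)) (tropical.segment g n 1 c' (vert 0) (vert 1))"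
    (is "path_hom ?X ?b ?d (?seg c) (?seg c')")
proof -
  obtain B v k where B: "(B, \<lambda>_. 0) \<in> labelled_graphs g n 0" "card (verts B) = 2" "v \<in> verts B"
    "weight B v > 0" "k \<notin> edges B" "c = cell_of g n 1 (add_loop B v k, loop_label k)"
    "tropical.cell_vertex g n c 0 = loop_cell g n"
    "tropical.cell_vertex g n c 1 = cell_of g n 0 (B, \<lambda>_. 0)"
    by (rule loop_bridge_cellE[OF c])
  obtain B' v' k' where B': "(B', \<lambda>_. 0) \<in> labelled_graphs g n 0" "card (verts B') = 2" "v' \<in> verts B'"
    "weight B' v' > 0" "k' \<notin> edges B'" "c' = cell_of g n 1 (add_loop B' v' k', loop_label k')"
    "tropical.cell_vertex g n c' 0 = loop_cell g n"
    "tropical.cell_vertex g n c' 1 = cell_of g n 0 (B', \<lambda>_. 0)"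
    by (rule loop_bridge_cellE[OF c'])
  have "((B, \<lambda>_. 0), (B', \<lambda>_. 0)) \<in> iso_rel g n 0"
    using eq B(8) B'(8) B'(1) by (intro cell_of_eqD) simp_all
  then obtain \<phi> \<psi> where iso: "contraction n \<phi> \<psi> {} B B'"
    by (auto simp: iso_rel_def isomorphic_iff)
  note i = iso[unfolded contraction_empty_iff]
  have "v' \<in> \<phi> ` verts B"
    using bij_betw_imp_surj_on[OF conjunct1[OF i]] B'(3) by simp
  \<comment> \<open>The end used by the second 1-cell is moved to \<open>B\<close> along the
    isomorphism, so both loops are attached to the same graph.\<close>
  then obtain w where w: "w \<in> verts B" "\<phi> w = v'"
    by auto
  have ww: "weight B w > 0"
    using i w B'(4) by auto
  obtain f where f: "edges B = {f}" "verts B = ends B f"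
    by (rule labelled_graphs_0D[OF B(1)])
  define k1 where "k1 = Suc f"
  define k2 where "k2 = Suc (Suc f)"
  have k: "k1 \<notin> edges B" "k2 \<notin> edges B" "k1 \<noteq> k2" "k1 \<noteq> f" "k2 \<noteq> f"
    by (auto simp: k1_def k2_def f)
  have cv: "c = cell_of g n 1 (add_loop B v k1, loop_label k1)"
    using add_loop_cell_cong[OF B(1) B(1) contraction_id B(5) k(1) B(3,4)] B(6) by simp
  have cw: "c' = cell_of g n 1 (add_loop B w k2, loop_label k2)"
    using add_loop_cell_cong[OF B(1) B'(1) iso k(2) B'(5) w(1) ww] B'(6) w(2) by simp
  show ?thesis
  proof (cases "v = w")
    case True
    have "c = c'"
      unfolding cv cw True
      using add_loop_cell_cong[OF B(1) B(1) contraction_id k(1,2) w(1) ww] by simp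
    moreover have cc: "c \<in> cells g n 1"
      using c loop_bridge_cells_subset by blast
    moreover have "path_from_to ?X (tropical.point g n (1, c, vert 0)) (tropical.point g n (1, c, vert 1)) (?seg c)"
      by (intro tropical.segment_path[OF cc] vert_in_simplex) simp_all
    ultimately show ?thesis
      using tropical.point_vertex[OF cc, of 0] tropical.point_vertex[OF cc, of 1] B(7)
      by (simp add: path_hom_refl)
  next
    case False
    \<comment> \<open>\<open>T\<close> carries both loops. Its vertices 0 and 2 contract to the base
      vertex, vertex 1 to the bridge graph.\<close>
    define T where "T = add_loop (add_loop B v k1) w k2"
    define \<tau> :: "nat \<Rightarrow> nat" where "\<tau> x = (if x = k1 then 0 else if x = f then 1 else 2)" for x
    have T': "T = add_loop (add_loop B w k2) v k1"
      using False k(3) by (simp add: T_def add_loop_def fun_upd_twist insert_commute)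
    note st = labelled_graphsD(1)[OF B(1)]
    have sv: "stable_graph g n (add_loop B v k1)" and sw: "stable_graph g n (add_loop B w k2)"
      using stable_add_loop[OF st k(1) B(3,4)] stable_add_loop[OF st k(2) w(1) ww] f by auto
    have ET: "edges T = {k1, f, k2}"
      by (auto simp: T_def f)
    have "stable_graph g n T"
      unfolding T_def by (rule stable_add_loop[OF sv]) (use k f w ww False in auto)
    moreover have "bij_betw \<tau> {k1, f, k2} {..2}"
      using k by (auto simp: bij_betw_def \<tau>_def numeral_2_eq_2 atMost_Suc inj_on_def)
    ultimately have x: "(T, \<tau>) \<in> labelled_graphs g n 2"
      using k by (simp add: labelled_graphs_def ET)
    have e: "k1 \<in> edges T" "f \<in> edges T" "k2 \<in> edges T"
      by (auto simp: ET)
    have c1: "contraction n id id (edges T - {k1, f}) T (add_loop B v k1)"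
    proof -
      have "edges T - {k1, f} = {k2}" using k by (auto simp: ET)
      then show ?thesis
        unfolding T_def using k f w ww False by (simp add: contraction_add_loop)
    qed
    have c2: "contraction n id id (edges T - {k2, f}) T (add_loop B w k2)"
    proof -
      have "edges T - {k2, f} = {k1}" using k by (auto simp: ET)
      then show ?thesis
        unfolding T' using k f B False by (simp add: contraction_add_loop)
    qed
    let ?H = "contract_edges {f} T"
    have sT: "stable_graph g n T" by (rule labelled_graphsD(1)[OF x])
    obtain r where r: "contraction n r id {f} T ?H"
      by (rule contraction_contract_edges[OF sT, of "{f}"]) (auto simp: ET)
    have Ef: "edges T - {k1, k2} = {f}" using k by (auto simp: ET)
    have c3: "contraction n r id (edges T - {k1, k2}) T ?H"
      unfolding Ef by (rule r)
    let ?\<sigma> = "\<lambda>x::nat. if x = k1 then 0 else 1 :: nat"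
    have face3: "(?H, ?\<sigma>) \<in> labelled_graphs g n 1"
      by (rule edge_face(4)[OF x e(1,3) k(3) c3]) (use k in auto)
    have EH: "edges ?H = {k1, k2}"
      using contractionD(3)[OF r] k by (auto simp: bij_betw_def ET)
    \<comment> \<open>Contracting the bridge merges its ends, and the two loops come to lie at the
      same vertex.\<close>
    have "r v = r w"
      using contractionD(5)[OF r, of f v w] f B(3) w(1) k by (simp add: T_def)
    then have par: "ends ?H k1 = ends ?H k2"
      using contractionD(4)[OF r, of k1] contractionD(4)[OF r, of k2] k ET by (simp add: T_def)
    let ?c = "cell_of g n 1 (?H, ?\<sigma>)" and ?cT = "cell_of g n 2 (T, \<tau>)"
    let ?sT = "\<lambda>i j. tropical.segment g n 2 ?cT (vert i) (vert j)"
    note p = parallel_edges[OF face3 EH k(3) _ _ par]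
    have p1: "tropical.cell_vertex g n ?c 0 = loop_cell g n" "tropical.cell_vertex g n ?c 1 = loop_cell g n"
      "pull_cell g n 1 (\<lambda>i. 1 - i) ?c = ?c"
      using p k by simp_all
    have null: "path_hom ?X ?b ?b (?seg ?c) (\<lambda>_. ?b)"
      using tropical.folded_edge_null[OF cell_of_in_cells[OF face3] p1(3)] p1(1) by simp
    have \<tau>: "\<tau> k1 = 0" "\<tau> f = 1" "\<tau> k2 = 2"
      using k by (auto simp: \<tau>_def)
    have h1: "path_hom ?X ?b ?d (?sT 0 1) (?seg c)"
      using tropical_segment_face[OF x e(1,2) k(4) c1, of "loop_label k1"] k B(7) \<tau> unfolding cv[symmetric] by simp
    have h2: "path_hom ?X ?b ?d (?sT 2 1) (?seg c')"
      using tropical_segment_face[OF x e(3,2) k(5) c2, of "loop_label k2"] k B'(7) \<tau> eq unfolding cw[symmetric] by simp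
    have h3: "path_hom ?X ?b ?b (?sT 0 2) (?seg ?c)"
      using tropical_segment_face[OF x e(1,3) k(3) c3, of ?\<sigma>] k p1 \<tau> by simp
    have "path_hom ?X ?b ?d (path_join (?sT 0 2) (?sT 2 1)) (?sT 0 1)"
    proof -
      have ends: "tropical.point g n (2, ?cT, vert 0) = ?b" "tropical.point g n (2, ?cT, vert 1) = ?d"
        using path_hom_imp_path(1)[OF h1] tropical.segment_path[OF cell_of_in_cells[OF x], of "vert 0" "vert 1"]
        by (simp_all add: path_from_to_def vert_in_simplex)
      show ?thesis
        using tropical.segment_triangle[OF cell_of_in_cells[OF x], of "vert 0" "vert 2" "vert 1"]
        unfolding ends by (simp add: vert_in_simplex)
    qed
    from path_hom_trans[OF path_hom_sym[OF h1] path_hom_sym[OF this]]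
    have "path_hom ?X ?b ?d (?seg c) (path_join (?sT 0 2) (?sT 2 1))" .
    also have "path_hom ?X ?b ?d \<dots> (path_join (\<lambda>_. ?b) (?seg c'))"
      by (rule path_hom_join[OF path_hom_trans[OF h3 null] h2])
    also have "path_hom ?X ?b ?d \<dots> (?seg c')"
      by (rule path_hom_const_left[OF path_hom_imp_path(2)[OF h2]])
    finally show ?thesis .
  qed
qed

lemma obtain_positive_weight:
  fixes w :: "nat \<Rightarrow> nat"
  assumes "(\<Sum>v\<in>V. int (w v)) \<noteq> 0"
  obtains v where "v \<in> V" "w v > 0"
proof (rule ccontr)
  assume "\<not> thesis"
  then have "\<And>v. v \<in> V \<Longrightarrow> w v = 0"
    using that by blast
  then have "(\<Sum>v\<in>V. int (w v)) = 0"
    by (intro sum.neutral) simp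
  with assms show False by simp
qed

lemma card_verts_0:
  assumes "(B, \<sigma>) \<in> labelled_graphs g n 0"
  shows "card (verts B) \<in> {1, 2}"
proof -
  obtain f where "edges B = {f}" "verts B = ends B f"
    by (rule labelled_graphs_0D[OF assms])
  then show ?thesis
    using marked_weighted_graphD(5)[OF labelled_graphsD(4)[OF assms], of f] by simp
qed

text \<open>A single non-loop edge contributes nothing to the genus, so for \<open>g \<ge> 1\<close>
  some end has positive weight and can give up a loop.\<close>

lemma loop_bridge_cell_exists:
  assumes "g \<ge> 1" and d: "d \<in> cells g n 0" "d \<noteq> loop_cell g n"
  obtains c where "c \<in> loop_bridge_cells g n" "tropical.cell_vertex g n c 1 = d"
proof -
  obtain B \<sigma> where B: "(B, \<sigma>) \<in> labelled_graphs g n 0" "d = cell_of g n 0 (B, \<sigma>)"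
    using d(1) by (rule cells_cases)
  obtain f where f: "edges B = {f}" "\<sigma> f = 0" "verts B = ends B f"
    by (rule labelled_graphs_0D[OF B(1)])
  have two: "card (verts B) = 2"
    using card_verts_0[OF B(1)] cell_of_one_vertex[OF B(1)] d(2) B(2) by auto
  have "(\<Sum>v\<in>verts B. int (weight B v)) = int g"
    using stable_graphD(2)[OF labelled_graphsD(1)[OF B(1)]] two f by (simp add: genus_def)
  then have "(\<Sum>v\<in>verts B. int (weight B v)) \<noteq> 0"
    using assms(1) by simp
  then obtain v where v: "v \<in> verts B" "weight B v > 0"
    by (rule obtain_positive_weight)
  have k: "Suc f \<notin> edges B" by (simp add: f)
  let ?G = "add_loop B v (Suc f)"
  note x = add_loop_labelled[OF B(1) k v]
  have "cell_of g n 1 (?G, loop_label (Suc f)) \<in> loop_bridge_cells g n"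
    unfolding loop_bridge_cells_def using x f two
    by (intro CollectI exI[of _ ?G] exI[of _ "loop_label (Suc f)"] exI[of _ "Suc f"] exI[of _ f]) simp
  moreover have "edges ?G - {f} = {Suc f}"
    by (auto simp: f)
  then have "contraction n id id (edges ?G - {f}) ?G B"
    using contraction_add_loop[OF k v] by simp
  from vertex_face(1)[OF x _ this, of \<sigma>]
  have "tropical.cell_vertex g n (cell_of g n 1 (?G, loop_label (Suc f))) 1 = d"
    using f B(2) by simp
  ultimately show thesis by (rule that)
qed

text \<open>Two edges have equal end sets, or are a loop and a bridge, or are two bridges. The
  second kind supplies the chosen paths, the first is folded, and the third is a side of a triangle
  whose other sides are of the second kind.\<close>

theorem simply_connected_positive_genus:
  assumes g: "g \<ge> 1" and st: "2 * int g - 2 + int n > 0"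
  shows "simply_connected_space (tropical_moduli_space g n)"
proof -
  let ?b = "tropical.vertex_point g n (loop_cell g n)" and ?X = "tropical.realization g n"
  let ?seg = "\<lambda>c. tropical.segment g n 1 c (vert 0) (vert 1)"
  \<comment> \<open>The choice among the 1-cells ending at \<open>d\<close> does not matter up to
    homotopy, by \<open>loop_bridge_segment_unique\<close>.\<close>
  define Q where "Q d = (if d = loop_cell g n then (\<lambda>_. ?b)
      else ?seg (SOME c. c \<in> loop_bridge_cells g n \<and> tropical.cell_vertex g n c 1 = d))" for d
  have Lb: "loop_cell g n \<in> cells g n 0"
    by (rule loop_cell_in_cells[OF g st])
  have b: "?b \<in> topspace ?X"
    unfolding tropical.vertex_point_def by (rule tropical.point_in_realization[OF Lb vert_in_simplex]) simp
  have seg: "path_from_to ?X ?b (tropical.vertex_point g n (tropical.cell_vertex g n c 1)) (?seg c)"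
    if c: "c \<in> loop_bridge_cells g n" for c
    by (rule path_hom_imp_path(1)[OF loop_bridge_segment_unique[OF c c refl]])
  have Qd: "path_hom ?X ?b (tropical.vertex_point g n (tropical.cell_vertex g n c 1)) (?seg c)
      (Q (tropical.cell_vertex g n c 1))" if c: "c \<in> loop_bridge_cells g n" for c
  proof -
    let ?d = "tropical.cell_vertex g n c 1"
    have "\<exists>c. c \<in> loop_bridge_cells g n \<and> tropical.cell_vertex g n c 1 = ?d"
      using c by blast
    note s = someI_ex[OF this]
    obtain B where "(B, \<lambda>_. 0) \<in> labelled_graphs g n 0" "card (verts B) = 2"
        "?d = cell_of g n 0 (B, \<lambda>_. 0)"
      by (rule loop_bridge_cellE[OF c])
    then have "?d \<noteq> loop_cell g n"
      using cell_of_eq_loop_cellD[of B "\<lambda>_. 0" g n] by auto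
    then show ?thesis
      using loop_bridge_segment_unique[OF c conjunct1[OF s] conjunct2[OF s, symmetric]]
      by (simp add: Q_def)
  qed
  have Q: "path_from_to ?X ?b (tropical.vertex_point g n d) (Q d)" if d: "d \<in> cells g n 0" for d
  proof (cases "d = loop_cell g n")
    case True
    then show ?thesis
      using path_from_to_const[OF b] by (simp add: Q_def)
  next
    case False
    obtain c where "c \<in> loop_bridge_cells g n" "tropical.cell_vertex g n c 1 = d"
      by (rule loop_bridge_cell_exists[OF g d False])
    then show ?thesis
      using path_hom_imp_path(2)[OF Qd] by blast
  qed
  interpret tropical_vertex_paths g n "loop_cell g n" Q
    by unfold_locales (use Lb Q in auto)
  have good_loop: "good 1 c 0 1" if c: "c \<in> loop_bridge_cells g n" for c
  proof -
    obtain B where v0: "tropical.cell_vertex g n c 0 = loop_cell g n"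
      by (rule loop_bridge_cellE[OF c])
    have "path_hom ?X ?b (tropical.vertex_point g n (tropical.cell_vertex g n c 1))
        (path_join (\<lambda>_. ?b) (?seg c)) (?seg c)"
      by (rule path_hom_const_left[OF seg[OF c]])
    from path_hom_trans[OF this Qd[OF c]]
    show ?thesis
      by (simp add: good_def v0) (simp add: Q_def)
  qed
  have good_parallel: "good 1 (cell_of g n 1 (G, \<tau>)) 0 1"
    if x: "(G, \<tau>) \<in> labelled_graphs g n 1" and e: "edges G = {e, f}" "e \<noteq> f" "\<tau> e = 0" "\<tau> f = 1"
      and eq: "ends G e = ends G f" for G \<tau> e f
  proof -
    note p = parallel_edges[OF x e eq]
    have n: "path_hom ?X ?b ?b (?seg (cell_of g n 1 (G, \<tau>))) (\<lambda>_. ?b)"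
      using tropical.folded_edge_null[OF cell_of_in_cells[OF x] p(3)] p(1) by simp
    have "path_hom ?X ?b ?b (path_join (\<lambda>_. ?b) (?seg (cell_of g n 1 (G, \<tau>)))) (?seg (cell_of g n 1 (G, \<tau>)))"
      by (rule path_hom_const_left[OF path_hom_imp_path(1)[OF n]])
    from path_hom_trans[OF this n] show ?thesis
      using p(1,2) by (simp add: good_def Q_def)
  qed
  have good_loop_bridge: "good 1 (cell_of g n 1 (G, \<tau>)) 0 1"
    if x: "(G, \<tau>) \<in> labelled_graphs g n 1" and e: "edges G = {e, f}" "e \<noteq> f" "\<tau> e = 0" "\<tau> f = 1"
      and "card (ends G e) = 1" "card (ends G f) = 2" for G \<tau> e f
    by (rule good_loop) (use that in \<open>auto simp: loop_bridge_cells_def\<close>)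
  have good_two_bridges: "good 1 (cell_of g n 1 (G, \<tau>)) 0 1"
    if x: "(G, \<tau>) \<in> labelled_graphs g n 1" and e: "edges G = {e, f}" "e \<noteq> f" "\<tau> e = 0" "\<tau> f = 1"
      and ce: "card (ends G e) = 2" and cf: "card (ends G f) = 2" and ne: "ends G e \<noteq> ends G f" for G \<tau> e f
  proof -
    note d = labelled_graphsD[OF x]
    note m = marked_weighted_graphD[OF d(4)]
    have "card (verts G) \<ge> 3"
    proof -
      have sub: "ends G e \<subseteq> verts G" "ends G f \<subseteq> verts G"
        using m(4) e by auto
      have "ends G e \<noteq> verts G"
      proof
        assume "ends G e = verts G"
        then have "ends G f = ends G e"
          using sub m(6)[of e] e ce cf by (intro card_subset_eq) auto
        then show False using ne by simp
      qed
      then have "ends G e \<subset> verts G" using sub by auto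
      from psubset_card_mono[OF m(1) this] show ?thesis
        using ce by simp
    qed
    moreover have "genus G = int g"
      by (rule stable_graphD(2)[OF d(1)])
    \<comment> \<open>With two edges and at least three vertices the first Betti number is at most
      0, so the total weight is at least \<open>g\<close>.\<close>
    ultimately have "(\<Sum>v\<in>verts G. int (weight G v)) \<noteq> 0"
      using d(2) g by (simp add: genus_def)
    then obtain u where u: "u \<in> verts G" "weight G u > 0"
      by (rule obtain_positive_weight)
    define k where "k = Suc (max e f)"
    have k: "k \<notin> edges G" "k \<noteq> e" "k \<noteq> f"
      by (auto simp: k_def e)
    define T where "T = add_loop G u k"
    define \<tau>' where "\<tau>' = \<tau>(k := 2)"
    have ET: "edges T = {k, e, f}" by (auto simp: T_def e)
    have sT: "stable_graph g n T"
      unfolding T_def by (rule stable_add_loop[OF d(1) k(1) u]) (simp add: e)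
    moreover have "bij_betw \<tau>' {k, e, f} {..2}"
      using k e by (auto simp: bij_betw_def \<tau>'_def numeral_2_eq_2 atMost_Suc inj_on_def)
    ultimately have xT: "(T, \<tau>') \<in> labelled_graphs g n 2"
      using k e by (simp add: labelled_graphs_def ET)
    have eT: "k \<in> edges T" "e \<in> edges T" "f \<in> edges T" by (auto simp: ET)
    \<comment> \<open>Contracting one bridge of \<open>T\<close> leaves the loop and the other
      bridge, so the side of the triangle joining \<open>k\<close> to \<open>a\<close> is of the
      kind already treated.\<close>
    have side: "good 2 (cell_of g n 2 (T, \<tau>')) (\<tau>' k) (\<tau>' a)"
      if ab: "edges G = {a, b}" "a \<noteq> b" "card (ends G a) = 2" "card (ends G b) = 2"
        "ends G a \<noteq> ends G b" for a b
    proof -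
      have kab: "k \<noteq> a" "k \<noteq> b" "edges T = {k, a, b}"
        using k ab by (auto simp: T_def)
      let ?H = "contract_edges {b} T" and ?\<sigma> = "\<lambda>x::nat. if x = k then 0 else 1 :: nat"
      obtain r where r: "contraction n r id {b} T ?H"
        by (rule contraction_contract_edges[OF sT, of "{b}"]) (auto simp: kab)
      have "edges T - {k, a} = {b}" using kab ab by auto
      then have c: "contraction n r id (edges T - {k, a}) T ?H"
        using r by simp
      have aT: "a \<in> edges T" by (simp add: kab)
      have x': "(?H, ?\<sigma>) \<in> labelled_graphs g n 1"
        by (rule edge_face(4)[OF xT eT(1) aT kab(1) c]) (use kab in auto)
      have EH: "edges ?H = {k, a}"
        using contractionD(3)[OF r] kab ab by (auto simp: bij_betw_def)
      have "ends ?H k = {r u}"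
        using contractionD(4)[OF r, of k] kab by (simp add: T_def)
      then have "card (ends ?H k) = 1" by simp
      moreover have "card (ends ?H a) = 2"
      proof -
        obtain y z where yz: "ends G a = {y, z}" "y \<noteq> z"
          using ab(3) by (auto simp: card_2_iff)
        have V: "y \<in> verts T" "z \<in> verts T"
          using m(4)[of a] ab(1) yz by (auto simp: T_def)
        have "\<not> {y, z} \<subseteq> ends G b"
        proof
          assume "{y, z} \<subseteq> ends G b"
          then have "ends G a = ends G b"
            using yz m(6)[of b] ab by (intro card_subset_eq) auto
          then show False using ab(5) by simp
        qed
        then have "r y \<noteq> r z"
        proof (rule contrapos_nn)
          assume ryz: "r y = r z"
          \<comment> \<open>\<open>h\<close> is constant on the ends of the contracted edge
            \<open>b\<close> and injective elsewhere. By minimality \<open>r\<close> identifies no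
            more than \<open>h\<close>, so \<open>a\<close> stays a bridge.\<close>
          define h where "h x = (if x \<in> ends G b then 0 else Suc x)" for x
          have "h y = h z"
            by (rule contractionD(6)[OF r _ V ryz]) (use kab in \<open>auto simp: h_def T_def\<close>)
          then show "{y, z} \<subseteq> ends G b"
            using yz(2) by (auto simp: h_def split: if_splits)
        qed
        then show ?thesis
          using contractionD(4)[OF r, of a] kab ab(1,2) yz by (simp add: T_def)
      qed
      ultimately have "good 1 (cell_of g n 1 (?H, ?\<sigma>)) 0 1"
        using kab by (intro good_loop_bridge[OF x' EH kab(1)]) auto
      then show ?thesis
        using good_face[OF xT eT(1) aT kab(1) c, of ?\<sigma>] kab by simp
    qed
    have "good 2 (cell_of g n 2 (T, \<tau>')) 2 0" "good 2 (cell_of g n 2 (T, \<tau>')) 2 1"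
      using side[of e f] side[of f e] e ce cf ne k by (auto simp: \<tau>'_def insert_commute)
    then have "good 2 (cell_of g n 2 (T, \<tau>')) 0 1"
      using good_trans[OF cell_of_in_cells[OF xT], of 0 2 1] good_sym[OF cell_of_in_cells[OF xT], of 2 0]
      by simp
    moreover have "contraction n id id (edges T - {e, f}) T G"
    proof -
      have "edges T - {e, f} = {k}" using k by (auto simp: ET)
      then show ?thesis
        unfolding T_def using contraction_add_loop[OF k(1) u] by simp
    qed
    from good_face[OF xT eT(2,3) e(2) this, of \<tau>]
    have "good 2 (cell_of g n 2 (T, \<tau>')) 0 1 \<longleftrightarrow> good 1 (cell_of g n 1 (G, \<tau>)) 0 1"
      using e k by (simp add: \<tau>'_def)
    ultimately show ?thesis by simp
  qed
  interpret simply_connected_complex "cells g n" "pull_cell g n" "loop_cell g n" Q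
  proof
    fix c assume c: "c \<in> cells g n 1"
    then obtain G \<tau> where x: "(G, \<tau>) \<in> labelled_graphs g n 1" "c = cell_of g n 1 (G, \<tau>)"
      by (rule cells_cases)
    obtain e f where e: "edges G = {e, f}" "e \<noteq> f" "\<tau> e = 0" "\<tau> f = 1"
      by (rule labelled_graphs_1D[OF x(1)])
    note d = labelled_graphsD[OF x(1)]
    note m = marked_weighted_graphD[OF d(4)]
    have ce: "card (ends G e) \<in> {1, 2}" "card (ends G f) \<in> {1, 2}"
      using m(5)[of e] m(5)[of f] e by auto
    consider "ends G e = ends G f" | "card (ends G e) = 1" "card (ends G f) = 2"
      | "card (ends G e) = 2" "card (ends G f) = 1"
      | "card (ends G e) = 2" "card (ends G f) = 2" "ends G e \<noteq> ends G f"
      | "card (ends G e) = 1" "card (ends G f) = 1" "ends G e \<noteq> ends G f"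
      using ce by auto
    then show "good 1 c 0 1"
    proof cases
      case 1
      then show ?thesis using good_parallel x e by simp
    next
      case 2
      then show ?thesis using good_loop_bridge x e by simp
    next
      case 3
      \<comment> \<open>The graph is regarded as its own 1-face with the two labels exchanged, which
        reduces this case to the previous one.\<close>
      have "edges G - {f, e} = {}" using e by auto
      then have id: "contraction n id id (edges G - {f, e}) G G"
        by (simp only: contraction_id)
      let ?\<sigma> = "\<lambda>x::nat. if x = f then 0 else 1 :: nat"
      have ef: "f \<in> edges G" "e \<in> edges G" "f \<noteq> e" using e by auto
      have "(G, ?\<sigma>) \<in> labelled_graphs g n 1"
        by (rule edge_face(4)[OF x(1) ef id]) (use ef in auto)
      then have "good 1 (cell_of g n 1 (G, ?\<sigma>)) 0 1"
        using 3 e by (intro good_loop_bridge[of _ _ f e]) auto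
      then have "good 1 c 1 0"
        using good_face[OF x(1) ef id, of ?\<sigma>] e x(2) by simp
      then show ?thesis
        using good_sym[OF c, of 1 0] by simp
    next
      case 4
      then show ?thesis using good_two_bridges x e by simp
    next
      case 5
      then obtain a b where ab: "ends G e = {a}" "ends G f = {b}" "a \<noteq> b"
        by (auto simp: card_1_singleton_iff)
      then have ab': "a \<in> verts G" "b \<in> verts G"
        using m(4) e by auto
      \<comment> \<open>Loops at different vertices leave no edge to connect them.\<close>
      have "verts G \<subseteq> {a}"
        using e ab by (intro connected_closed[OF d(4) _ ab'(1)]) auto
      then show ?thesis
        using ab ab' by auto
    qed
  qed
  show ?thesis
    unfolding tropical_moduli_space_eq by (rule simply_connected_realization)
qed

section \<open>Genus zero\<close>

text \<open>A leaf and the edge joining it to the centre \<open>m\<close> share their number, so the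
  identity can serve as edge labelling.\<close>

definition star_graph :: "nat \<Rightarrow> (nat \<Rightarrow> nat) \<Rightarrow> mwgraph" where
  "star_graph m \<mu> =
     \<lparr>verts = {..m}, edges = {..<m}, ends = \<lambda>e. {e, m}, weight = \<lambda>_. 0, mark = \<mu>\<rparr>"

lemma star_graph_simps [simp]:
  "verts (star_graph m \<mu>) = {..m}" "edges (star_graph m \<mu>) = {..<m}"
  "ends (star_graph m \<mu>) = (\<lambda>e. {e, m})" "weight (star_graph m \<mu>) = (\<lambda>_. 0)"
  "mark (star_graph m \<mu>) = \<mu>"
  by (simp_all add: star_graph_def)

lemma connected_via:
  assumes "\<And>v. v \<in> V \<Longrightarrow> (v, c) \<in> (adjacency G)\<^sup>*"
    and "x \<in> V" "y \<in> V"
  shows "(x, y) \<in> (adjacency G)\<^sup>*"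
proof -
  have "sym (adjacency G)"
    by (auto simp: adjacency_def sym_def insert_commute)
  then have "sym ((adjacency G)\<^sup>*)"
    by (rule sym_rtrancl)
  then have "(c, y) \<in> (adjacency G)\<^sup>*"
    using assms by (auto dest: symD)
  then show ?thesis
    using assms by (meson rtrancl_trans)
qed

lemma star_graph_labelled:
  assumes \<mu>: "\<And>i. 1 \<le> i \<Longrightarrow> i \<le> n \<Longrightarrow> \<mu> i \<le> Suc p"
    and leaf: "\<And>j. j \<le> p \<Longrightarrow> card {i \<in> {1..n}. \<mu> i = j} \<ge> 2"
    and centre: "Suc p + card {i \<in> {1..n}. \<mu> i = Suc p} \<ge> 3"
  shows "(star_graph (Suc p) \<mu>, id) \<in> labelled_graphs 0 n p"
proof -
  let ?G = "star_graph (Suc p) \<mu>"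
  have "(v, Suc p) \<in> (adjacency ?G)\<^sup>*" if "v \<in> {..Suc p}" for v
    using that by (cases "v = Suc p") (auto simp: adjacency_def intro!: r_into_rtrancl)
  then have "\<forall>u\<in>{..Suc p}. \<forall>v\<in>{..Suc p}. (u, v) \<in> (adjacency ?G)\<^sup>*"
    using connected_via by blast
  then have "marked_weighted_graph n ?G"
    using \<mu> by (auto simp: marked_weighted_graph_def)
  moreover have "genus ?G = 0"
    by (simp add: genus_def)
  moreover have "valence ?G v + card {i \<in> {1..n}. mark ?G i = v} \<ge> 3" if v: "v \<le> Suc p" for v
  proof (cases "v = Suc p")
    case True
    have "valence ?G v = (\<Sum>e<Suc p. 1)"
      unfolding True by (subst valence_eq_sum) (auto simp: end_multiplicity_def intro!: sum.cong)
    then show ?thesis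
      using centre True by simp
  next
    case False
    have "valence ?G v = (\<Sum>e<Suc p. if e = v then 1 else 0)"
      using False by (subst valence_eq_sum) (auto simp: end_multiplicity_def intro!: sum.cong)
    also have "\<dots> = 1"
      using False v by (subst sum.delta) auto
    finally show ?thesis
      using leaf[of v] False v by simp
  qed
  moreover have "bij_betw id {..<Suc p} {..p}"
    by (auto simp: bij_betw_def)
  ultimately show ?thesis
    by (simp add: labelled_graphs_def stable_graph_def)
qed

text \<open>The leaves in \<open>K\<close> survive and are renumbered by \<open>\<psi>\<close>;
  every other leaf falls into the centre along its own edge.\<close>

lemma star_graph_contraction:
  assumes K: "K \<subseteq> {..<m}" and \<psi>: "bij_betw \<psi> K {..<p}"
    and \<mu>: "\<And>i. 1 \<le> i \<Longrightarrow> i \<le> n \<Longrightarrow> \<mu> i \<le> m \<and> \<mu>' i = (if \<mu> i \<in> K then \<psi> (\<mu> i) else p)"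
  shows "contraction n (\<lambda>v. if v \<in> K then \<psi> v else p) \<psi> ({..<m} - K) (star_graph m \<mu>) (star_graph p \<mu>')"
    (is "contraction n ?r \<psi> ?S _ _")
proof (rule contractionI)
  have less: "\<psi> v < p" if "v \<in> K" for v
    using bij_betwE[OF \<psi>] that by auto
  have m: "m \<notin> K" using K by auto
  show "?S \<subseteq> edges (star_graph m \<mu>)" by auto
  have eq: "{..<m} - ?S = K" using K by auto
  show "bij_betw \<psi> (edges (star_graph m \<mu>) - ?S) (edges (star_graph p \<mu>'))"
    using \<psi> eq by simp
  have "?r ` {..m} = {..p}"
  proof (intro equalityI subsetI)
    fix x assume "x \<in> {..p}"
    then consider "x = p" | "x \<in> \<psi> ` K"
      using bij_betw_imp_surj_on[OF \<psi>] by force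
    then show "x \<in> ?r ` {..m}"
    proof cases
      case 1
      then show ?thesis using m by (intro image_eqI[of _ _ m]) auto
    next
      case 2
      then obtain v where "v \<in> K" "x = \<psi> v" by blast
      then show ?thesis using K by (intro image_eqI[of _ _ v]) auto
    qed
  qed (use less in \<open>auto intro: less_imp_le\<close>)
  then show "?r ` verts (star_graph m \<mu>) = verts (star_graph p \<mu>')" by simp
  show "ends (star_graph p \<mu>') (\<psi> e) = ?r ` ends (star_graph m \<mu>) e"
    if "e \<in> edges (star_graph m \<mu>) - ?S" for e
    using that m by auto
  show "?r u = ?r v" if "e \<in> ?S" "u \<in> ends (star_graph m \<mu>) e" "v \<in> ends (star_graph m \<mu>) e" for e u v
    using that m by auto
  show "f u = f v" if f: "\<And>e u v. \<lbrakk>e \<in> ?S; u \<in> ends (star_graph m \<mu>) e; v \<in> ends (star_graph m \<mu>) e\<rbrakk> \<Longrightarrow> f u = f v"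
    and uv: "u \<in> verts (star_graph m \<mu>)" "v \<in> verts (star_graph m \<mu>)" "?r u = ?r v"
    for f :: "nat \<Rightarrow> nat" and u v
  proof -
    have fm: "f x = f m" if "x \<le> m" "x \<notin> K" for x
      using f[of x x m] that by (cases "x = m") auto
    show ?thesis
    proof (cases "u \<in> K")
      case True
      then have "v \<in> K"
        using uv(3) less[of u] by (auto split: if_splits)
      then have "u = v"
        using True uv(3) bij_betw_imp_inj_on[OF \<psi>] by (simp add: inj_on_eq_iff)
      then show ?thesis by simp
    next
      case False
      then have "v \<notin> K"
        using uv(3) less[of v] by (auto split: if_splits)
      then show ?thesis
        using False fm[of u] fm[of v] uv by simp
    qed
  qed
  show "mark (star_graph p \<mu>') i = ?r (mark (star_graph m \<mu>) i)" if "1 \<le> i" "i \<le> n" for i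
    using \<mu> that by simp
  fix x assume x: "x \<in> verts (star_graph p \<mu>')"
  show "int (weight (star_graph p \<mu>') x) - 1 =
      (\<Sum>u | u \<in> verts (star_graph m \<mu>) \<and> ?r u = x. int (weight (star_graph m \<mu>) u) - 1) +
      int (card {e \<in> ?S. ?r ` ends (star_graph m \<mu>) e = {x}})"
  proof (cases "x = p")
    case True
    have F: "{u. u \<in> verts (star_graph m \<mu>) \<and> ?r u = x} = insert m ?S"
      using True less m by (auto simp: le_less)
    have E: "{e \<in> ?S. ?r ` ends (star_graph m \<mu>) e = {x}} = ?S"
      using True m by auto
    \<comment> \<open>The fibre of the new centre has one vertex more than contracted edges. All
      weights are 0, so the count is \<open>-1\<close>, as it should be for weight 0.\<close>
    have "card (insert m ?S) = Suc (card ?S)"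
      by (rule card_insert_disjoint) auto
    then show ?thesis
      unfolding F E by simp
  next
    case False
    then have "x < p" using x by simp
    then obtain v where v: "v \<in> K" "x = \<psi> v"
      using bij_betw_imp_surj_on[OF \<psi>] by blast
    have F: "{u. u \<in> verts (star_graph m \<mu>) \<and> ?r u = x} = {v}"
      using v False K bij_betw_imp_inj_on[OF \<psi>] by (auto simp: inj_on_eq_iff)
    have E: "{e \<in> ?S. ?r ` ends (star_graph m \<mu>) e = {x}} = {}"
      using False m by auto
    show ?thesis
      unfolding F E by simp
  qed
qed

section \<open>Genus zero: bipartitions of the markings as vertices, two-edge trees as
  1-cells\<close>

definition split_cell :: "nat \<Rightarrow> nat set \<Rightarrow> labelled_graph set" where
  "split_cell n A = cell_of 0 n 0 (star_graph 1 (\<lambda>i. if i \<in> A then 0 else 1), id)"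

definition double_split_cell :: "nat \<Rightarrow> nat set \<Rightarrow> nat set \<Rightarrow> labelled_graph set" where
  "double_split_cell n A C =
     cell_of 0 n 1 (star_graph 2 (\<lambda>i. if i \<in> A then 0 else if i \<in> C then 1 else 2), id)"

lemma star_graph_vertex:
  assumes m: "m = Suc p" and x: "(star_graph m \<mu>, id) \<in> labelled_graphs 0 n p" and j: "j \<le> p"
    and A: "\<And>i. 1 \<le> i \<Longrightarrow> i \<le> n \<Longrightarrow> i \<in> A \<longleftrightarrow> \<mu> i = j"
  shows "tropical.cell_vertex 0 n (cell_of 0 n p (star_graph m \<mu>, id)) j = split_cell n A"
proof -
  note x = x[unfolded m]
  have "\<mu> i \<le> Suc p" if "1 \<le> i" "i \<le> n" for i
    using marked_weighted_graphD(9)[OF labelled_graphsD(4)[OF x] that] by simp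
  then have "contraction n (\<lambda>v. if v \<in> {j} then 0 else 1) (\<lambda>_. 0) ({..<Suc p} - {j})
      (star_graph (Suc p) \<mu>) (star_graph 1 (\<lambda>i. if i \<in> A then 0 else 1))"
    using j A by (intro star_graph_contraction) (auto simp: bij_betw_def)
  then have "contraction n (\<lambda>v. if v \<in> {j} then 0 else 1) (\<lambda>_. 0) (edges (star_graph (Suc p) \<mu>) - {j})
      (star_graph (Suc p) \<mu>) (star_graph 1 (\<lambda>i. if i \<in> A then 0 else 1))"
    by simp
  from vertex_face(1)[OF x _ this, of id] j show ?thesis
    by (simp add: split_cell_def m)
qed

lemma split_labelled:
  assumes "A \<subseteq> {1..n}" "card A \<ge> 2" "card ({1..n} - A) \<ge> 2"
  shows "(star_graph 1 (\<lambda>i. if i \<in> A then 0 else 1), id) \<in> labelled_graphs 0 n 0"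
proof -
  let ?\<mu> = "\<lambda>i. if i \<in> A then 0 else 1::nat"
  have F: "{i \<in> {1..n}. ?\<mu> i = 0} = A" "{i \<in> {1..n}. ?\<mu> i = Suc 0} = {1..n} - A"
    using assms(1) by auto
  have "(star_graph (Suc 0) ?\<mu>, id) \<in> labelled_graphs 0 n 0"
    by (rule star_graph_labelled) (use F assms in auto)
  then show ?thesis by simp
qed

lemma split_cell_in_cells:
  "A \<subseteq> {1..n} \<Longrightarrow> card A \<ge> 2 \<Longrightarrow> card ({1..n} - A) \<ge> 2 \<Longrightarrow> split_cell n A \<in> cells 0 n 0"
  unfolding split_cell_def by (rule cell_of_in_cells[OF split_labelled])

lemma split_cell_Compl:
  assumes A: "A \<subseteq> {1..n}" "card A \<ge> 2" "card ({1..n} - A) \<ge> 2"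
  shows "split_cell n ({1..n} - A) = split_cell n A"
proof -
  have eq: "{1..n} - ({1..n} - A) = A" using A by auto
  let ?\<mu> = "\<lambda>A i. if i \<in> A then 0 else 1::nat"
  have x: "(star_graph 1 (?\<mu> ({1..n} - A)), id) \<in> labelled_graphs 0 n 0"
      "(star_graph 1 (?\<mu> A), id) \<in> labelled_graphs 0 n 0"
    by (intro split_labelled; use A eq in auto)+
  have "contraction n (\<lambda>v. 1 - v) id {} (star_graph 1 (?\<mu> ({1..n} - A))) (star_graph 1 (?\<mu> A))"
    unfolding contraction_empty_iff by (auto simp: bij_betw_def inj_on_def image_iff atMost_Suc)
  then have "isomorphic n (star_graph 1 (?\<mu> ({1..n} - A)), id) (star_graph 1 (?\<mu> A), id)"
    unfolding isomorphic_iff by (intro exI conjI) auto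
  then show ?thesis
    unfolding split_cell_def using x by (intro cell_of_eqI) (simp add: iso_rel_def)
qed

lemma split_cell_eqD:
  assumes A: "A \<subseteq> {1..n}" and B: "B \<subseteq> {1..n}" "card B \<ge> 2" "card ({1..n} - B) \<ge> 2"
    and eq: "split_cell n A = split_cell n B"
  shows "A = B \<or> A = {1..n} - B"
proof -
  let ?\<mu> = "\<lambda>A i. if i \<in> A then 0 else 1::nat"
  have "((star_graph 1 (?\<mu> A), id), (star_graph 1 (?\<mu> B), id)) \<in> iso_rel 0 n 0"
    using eq split_labelled[OF B] unfolding split_cell_def by (rule cell_of_eqD)
  then obtain \<phi> \<psi> where "contraction n \<phi> \<psi> {} (star_graph 1 (?\<mu> A)) (star_graph 1 (?\<mu> B))"
    by (auto simp: iso_rel_def isomorphic_iff)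
  then have b: "bij_betw \<phi> {..1} {..1}" and m: "\<And>i. i \<in> {1..n} \<Longrightarrow> ?\<mu> B i = \<phi> (?\<mu> A i)"
    by (auto simp: contraction_empty_iff)
  have "\<phi> 0 \<le> 1" "\<phi> 1 \<le> 1" "\<phi> 0 \<noteq> \<phi> 1"
    using bij_betwE[OF b] bij_betw_imp_inj_on[OF b] by (auto simp: inj_on_def)
  then consider "\<phi> 0 = 0" "\<phi> 1 = 1" | "\<phi> 0 = 1" "\<phi> 1 = 0" by linarith
  then show ?thesis
  proof cases
    case 1
    have "i \<in> A \<longleftrightarrow> i \<in> B" if "i \<in> {1..n}" for i
      using m[OF that] by (cases "i \<in> A"; cases "i \<in> B") (simp_all add: 1[simplified])
    then show ?thesis using A B by blast
  next
    case 2
    have "i \<in> A \<longleftrightarrow> i \<notin> B" if "i \<in> {1..n}" for i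
      using m[OF that] by (cases "i \<in> A"; cases "i \<in> B") (simp_all add: 2[simplified])
    then have "A = {1..n} - B" using A by blast
    then show ?thesis by simp
  qed
qed

lemma genus_0_vertexE:
  assumes d: "d \<in> cells 0 n 0" and n: "n \<ge> 1"
  obtains A where "A \<subseteq> {1..<n}" "card A \<ge> 2" "card ({1..n} - A) \<ge> 2" "d = split_cell n A"
proof -
  obtain B \<sigma> where B: "(B, \<sigma>) \<in> labelled_graphs 0 n 0" "d = cell_of 0 n 0 (B, \<sigma>)"
    using d by (rule cells_cases)
  note s = stable_graphD[OF labelled_graphsD(1)[OF B(1)]]
  note m = marked_weighted_graphD[OF s(1)]
  obtain f where f: "edges B = {f}" "\<sigma> f = 0" "verts B = ends B f"
    by (rule labelled_graphs_0D[OF B(1)])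
  have nn: "(\<Sum>v\<in>verts B. int (weight B v)) \<ge> 0"
    by (rule sum_nonneg) simp
  have g: "2 - int (card (verts B)) + (\<Sum>v\<in>verts B. int (weight B v)) = 0"
    using s(2) f by (simp add: genus_def)
  \<comment> \<open>One edge has at most two ends, so the genus equation leaves only the bridge with
    both weights 0.\<close>
  then have two: "card (verts B) = 2" and sum0: "(\<Sum>v\<in>verts B. int (weight B v)) = 0"
    using card_verts_0[OF B(1)] nn by auto
  have w0: "weight B v = 0" if "v \<in> verts B" for v
    using sum_nonneg_0[OF m(1) _ sum0 that] by simp
  define w where "w = mark B n"
  have w: "w \<in> verts B"
    using m(9) n by (simp add: w_def)
  obtain a b where ab: "verts B = {a, b}" "a \<noteq> b"
    using two by (auto simp: card_2_iff)
  \<comment> \<open>\<open>w\<close> carries the marking \<open>n\<close>; the bipartition is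
    represented by the side of the other end \<open>u\<close>.\<close>
  obtain u where u: "verts B = {u, w}" "u \<noteq> w"
  proof (cases "w = a")
    case True
    then show thesis using that[of b] ab by (simp add: insert_commute)
  next
    case False
    then show thesis using that[of a] ab w by auto
  qed
  let ?A = "{i \<in> {1..n}. mark B i = u}"
  have val: "valence B u = 1" "valence B w = 1"
    using f u by (auto simp: valence_eq_sum end_multiplicity_def)
  have "mark B i = w \<longleftrightarrow> mark B i \<noteq> u" if "i \<in> {1..n}" for i
    using m(9)[of i] that u by auto
  then have compl: "{1..n} - ?A = {i \<in> {1..n}. mark B i = w}"
    by blast
  have cards: "card ?A \<ge> 2" "card ({1..n} - ?A) \<ge> 2"
    using s(3)[of u] s(3)[of w] val w0 u unfolding compl by auto
  have sub: "?A \<subseteq> {1..n}" "?A \<subseteq> {1..<n}"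
    using u(2) by (auto simp: w_def le_less)
  have "contraction n (\<lambda>v. if v = u then 0 else 1) (\<lambda>_. 0) {} B (star_graph 1 (\<lambda>i. if i \<in> ?A then 0 else 1))"
    unfolding contraction_empty_iff using u f w0 by (auto simp: bij_betw_def atMost_Suc)
  then have "isomorphic n (B, \<sigma>) (star_graph 1 (\<lambda>i. if i \<in> ?A then 0 else 1), id)"
    unfolding isomorphic_iff using f by (intro exI conjI) auto
  then have "d = split_cell n ?A"
    unfolding B(2) split_cell_def using B(1) split_labelled[OF sub(1) cards]
    by (intro cell_of_eqI) (simp add: iso_rel_def)
  then show thesis
    using that sub(2) cards by blast
qed

lemma double_split_labelled:
  assumes "A \<subseteq> {1..n}" "C \<subseteq> {1..n}" "card A \<ge> 2" "card C \<ge> 2" "A \<inter> C = {}" "A \<union> C \<noteq> {1..n}"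
  shows "(star_graph 2 (\<lambda>i. if i \<in> A then 0 else if i \<in> C then 1 else 2), id) \<in> labelled_graphs 0 n 1"
proof -
  let ?\<mu> = "\<lambda>i. if i \<in> A then 0 else if i \<in> C then 1 else 2::nat"
  have F: "{i \<in> {1..n}. ?\<mu> i = 0} = A" "{i \<in> {1..n}. ?\<mu> i = 1} = C"
      "{i \<in> {1..n}. ?\<mu> i = 2} = {1..n} - (A \<union> C)"
    using assms by auto
  have "card ({1..n} - (A \<union> C)) > 0"
    using assms by (subst card_gt_0_iff) auto
  then have "card {i \<in> {1..n}. ?\<mu> i = 2} \<ge> 1"
    unfolding F by simp
  moreover have "card {i \<in> {1..n}. ?\<mu> i = j} \<ge> 2" if "j \<le> 1" for j
  proof -
    from that consider "j = 0" | "j = 1" by linarith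
    then show ?thesis
      by cases (simp_all only: F assms)
  qed
  ultimately have "(star_graph (Suc 1) ?\<mu>, id) \<in> labelled_graphs 0 n 1"
    by (intro star_graph_labelled) (auto simp: numeral_2_eq_2)
  then show ?thesis by (simp add: numeral_2_eq_2)
qed

lemma double_split_vertices:
  assumes "A \<subseteq> {1..n}" "C \<subseteq> {1..n}" "card A \<ge> 2" "card C \<ge> 2" "A \<inter> C = {}" "A \<union> C \<noteq> {1..n}"
  shows "tropical.cell_vertex 0 n (double_split_cell n A C) 0 = split_cell n A"
    "tropical.cell_vertex 0 n (double_split_cell n A C) 1 = split_cell n C"
proof -
  note x = double_split_labelled[OF assms]
  show "tropical.cell_vertex 0 n (double_split_cell n A C) 0 = split_cell n A"
    unfolding double_split_cell_def
    by (rule star_graph_vertex[OF _ x]) auto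
  show "tropical.cell_vertex 0 n (double_split_cell n A C) 1 = split_cell n C"
    unfolding double_split_cell_def
    by (rule star_graph_vertex[OF _ x]) (use assms(5) in auto)
qed

text \<open>Connectedness makes the two edges share an end, and genus 0 then forces three vertices
  of weight 0: the graph is a path, with \<open>A\<close> and \<open>C\<close> at its outer
  vertices.\<close>

lemma genus_0_edgeE:
  assumes c: "c \<in> cells 0 n 1"
  obtains A C where "A \<subseteq> {1..n}" "C \<subseteq> {1..n}" "card A \<ge> 2" "card C \<ge> 2" "A \<inter> C = {}"
    "A \<union> C \<noteq> {1..n}" "c = double_split_cell n A C"
proof -
  obtain G \<tau> where x: "(G, \<tau>) \<in> labelled_graphs 0 n 1" "c = cell_of 0 n 1 (G, \<tau>)"
    using c by (rule cells_cases)
  obtain e f where e: "edges G = {e, f}" "e \<noteq> f" "\<tau> e = 0" "\<tau> f = 1"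
    by (rule labelled_graphs_1D[OF x(1)])
  note s = stable_graphD[OF labelled_graphsD(1)[OF x(1)]]
  note m = marked_weighted_graphD[OF s(1)]
  have ce: "card (ends G e) \<in> {1, 2}" "card (ends G f) \<in> {1, 2}" "finite (ends G e)" "finite (ends G f)"
      "ends G e \<noteq> {}"
    using m(5,6,7) e by auto
  have nn: "(\<Sum>v\<in>verts G. int (weight G v)) \<ge> 0"
    by (rule sum_nonneg) simp
  have g: "3 - int (card (verts G)) + (\<Sum>v\<in>verts G. int (weight G v)) = 0"
    using s(2) e by (simp add: genus_def)
  obtain a0 where a0: "a0 \<in> ends G e" "a0 \<in> verts G"
    using m(4)[of e] e ce(5) by blast
  have meet: "ends G e \<inter> ends G f \<noteq> {}"
  proof
    assume disj: "ends G e \<inter> ends G f = {}"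
    have "verts G \<subseteq> ends G e"
      by (rule connected_closed[OF s(1) a0]) (use e disj in auto)
    then have "ends G f \<subseteq> ends G e" "ends G f \<noteq> {}"
      using m(4,7)[of f] e by auto
    then show False using disj by blast
  qed
  have V: "verts G = ends G e \<union> ends G f"
  proof
    show "verts G \<subseteq> ends G e \<union> ends G f"
      by (rule connected_closed[OF s(1) _ a0(2)]) (use e a0 in auto)
    show "ends G e \<union> ends G f \<subseteq> verts G"
      using m(4) e by auto
  qed
  have "card (ends G e \<union> ends G f) + card (ends G e \<inter> ends G f) = card (ends G e) + card (ends G f)"
    using card_Un_Int[OF ce(3,4)] by simp
  moreover have "card (ends G e \<inter> ends G f) \<ge> 1"
    using meet ce(3) by (simp add: Suc_le_eq card_gt_0_iff)
  ultimately have cards: "card (ends G e) = 2" "card (ends G f) = 2" "card (ends G e \<inter> ends G f) = 1"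
      "card (verts G) = 3" and sum0: "(\<Sum>v\<in>verts G. int (weight G v)) = 0"
    using g nn ce(1,2) unfolding V by auto
  obtain z where z: "ends G e \<inter> ends G f = {z}"
    using cards(3) by (auto simp: card_1_singleton_iff)
  have "card (ends G e - {z}) = 1" "card (ends G f - {z}) = 1"
    using z cards ce by (auto simp: card_Diff_singleton_if)
  then obtain u v where "ends G e - {z} = {u}" "ends G f - {z} = {v}"
    by (auto simp: card_1_singleton_iff)
  then have uv: "ends G e = {u, z}" "ends G f = {v, z}" "u \<noteq> z" "v \<noteq> z" "u \<noteq> v"
    using z by blast+
  have VV: "verts G = {u, v, z}"
    unfolding V uv by auto
  have w0: "weight G x = 0" if "x \<in> verts G" for x
    using sum_nonneg_0[OF m(1) _ sum0 that] by simp
  let ?A = "{i \<in> {1..n}. mark G i = u}" and ?C = "{i \<in> {1..n}. mark G i = v}"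
  have val: "valence G u = 1" "valence G v = 1" "valence G z = 2"
    using e uv by (auto simp: valence_eq_sum end_multiplicity_def)
  \<comment> \<open>The outer vertices have valence 1 and need two markings each. The middle one has
    valence 2 and needs one, so \<open>?A\<close> and \<open>?C\<close> cannot exhaust
    \<open>{1..n}\<close>.\<close>
  have st: "card ?A \<ge> 2" "card ?C \<ge> 2" "card {i \<in> {1..n}. mark G i = z} \<ge> 1"
    using s(3)[of u] s(3)[of v] s(3)[of z] val w0 VV by auto
  have disj: "?A \<inter> ?C = {}"
    using uv by auto
  have "{i \<in> {1..n}. mark G i = z} \<noteq> {}"
    using st(3) by (metis card.empty not_one_le_zero)
  then obtain i where i: "i \<in> {1..n}" "mark G i = z"
    by blast
  then have "i \<notin> ?A \<union> ?C"
    using uv(3,4) by simp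
  with i(1) have un: "?A \<union> ?C \<noteq> {1..n}"
    by blast
  have sub: "?A \<subseteq> {1..n}" "?C \<subseteq> {1..n}" by auto
  let ?\<mu> = "\<lambda>i. if i \<in> ?A then 0 else if i \<in> ?C then 1 else 2::nat"
  let ?r = "\<lambda>x. if x = u then 0 else if x = v then 1 else 2::nat"
  have "contraction n ?r \<tau> {} G (star_graph 2 ?\<mu>)"
    unfolding contraction_empty_iff VV
    using uv e w0 VV m(9) by (auto simp: bij_betw_def numeral_2_eq_2 atMost_Suc lessThan_Suc)
  then have "isomorphic n (G, \<tau>) (star_graph 2 ?\<mu>, id)"
    unfolding isomorphic_iff by (intro exI conjI) auto
  then have "c = double_split_cell n ?A ?C"
    unfolding x(2) double_split_cell_def
    using x(1) double_split_labelled[OF sub st(1,2) disj un]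
    by (intro cell_of_eqI) (simp add: iso_rel_def)
  then show thesis
    using that[OF sub st(1,2) disj un] by blast
qed

section \<open>Path-shaped trees\<close>

definition path_graph :: "nat \<Rightarrow> (nat \<Rightarrow> nat) \<Rightarrow> mwgraph" where
  "path_graph m \<mu> =
     \<lparr>verts = {..m}, edges = {..<m}, ends = \<lambda>e. {e, Suc e}, weight = \<lambda>_. 0, mark = \<mu>\<rparr>"

lemma path_graph_simps [simp]:
  "verts (path_graph m \<mu>) = {..m}" "edges (path_graph m \<mu>) = {..<m}"
  "ends (path_graph m \<mu>) = (\<lambda>e. {e, Suc e})" "weight (path_graph m \<mu>) = (\<lambda>_. 0)"
  "mark (path_graph m \<mu>) = \<mu>"
  by (simp_all add: path_graph_def)

lemma path_graph_labelled:
  assumes \<mu>: "\<And>i. 1 \<le> i \<Longrightarrow> i \<le> n \<Longrightarrow> \<mu> i \<le> 3"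
    and "card {i \<in> {1..n}. \<mu> i = 0} \<ge> 2" "card {i \<in> {1..n}. \<mu> i = 1} \<ge> 1"
    and "card {i \<in> {1..n}. \<mu> i = 2} \<ge> 1" "card {i \<in> {1..n}. \<mu> i = 3} \<ge> 2"
  shows "(path_graph 3 \<mu>, id) \<in> labelled_graphs 0 n 2"
proof -
  let ?G = "path_graph 3 \<mu>"
  have E: "{..<3} = {0, 1, 2::nat}" by auto
  have adj: "(Suc v, v) \<in> adjacency ?G" if "v < 3" for v
    using that by (auto simp: adjacency_def insert_commute)
  have "(v, 0) \<in> (adjacency ?G)\<^sup>*" if "v \<le> 3" for v
    using that
  proof (induction v)
    case (Suc v)
    then show ?case
      using converse_rtrancl_into_rtrancl[OF adj[of v]] by simp
  qed simp
  then have "\<forall>u\<in>{..3}. \<forall>v\<in>{..3}. (u, v) \<in> (adjacency ?G)\<^sup>*"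
    using connected_via[of "{..3}" 0 ?G] by simp
  then have "marked_weighted_graph n ?G"
    using \<mu> by (auto simp: marked_weighted_graph_def)
  moreover have "genus ?G = 0"
    by (simp add: genus_def)
  moreover have "valence ?G v + card {i \<in> {1..n}. mark ?G i = v} \<ge> 3" if v: "v \<le> 3" for v
  proof -
    have val: "valence ?G v = end_multiplicity {0, 1} v + (end_multiplicity {1, 2} v + end_multiplicity {2, 3} v)"
      by (simp add: valence_eq_sum E numeral_2_eq_2 numeral_3_eq_3)
    from v consider "v = 0" | "v = 1" | "v = 2" | "v = 3" by linarith
    then show ?thesis
    proof cases
      case 1
      then show ?thesis unfolding val using assms(2) by (simp add: end_multiplicity_def doubleton_eq_iff)
    next
      case 2
      then show ?thesis unfolding val using assms(3) by (simp add: end_multiplicity_def doubleton_eq_iff)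
    next
      case 3
      then show ?thesis unfolding val using assms(4) by (simp add: end_multiplicity_def doubleton_eq_iff)
    next
      case 4
      then show ?thesis unfolding val using assms(5) by (simp add: end_multiplicity_def doubleton_eq_iff)
    qed
  qed
  moreover have "bij_betw id {..<3} {..2::nat}"
    by (auto simp: bij_betw_def)
  ultimately show ?thesis
    by (simp add: labelled_graphs_def stable_graph_def)
qed

text \<open>The remaining edge \<open>j\<close> cuts the path into the vertices up to
  \<open>j\<close> and those beyond it. For minimality, a function constant along the contracted
  edges is constant on each part by induction along the path.\<close>

lemma path_graph_contraction:
  assumes j: "j < m"
    and \<mu>: "\<And>i. 1 \<le> i \<Longrightarrow> i \<le> n \<Longrightarrow> \<mu> i \<le> m \<and> \<mu>' i = (if \<mu> i \<le> j then 0 else 1)"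
  shows "contraction n (\<lambda>v. if v \<le> j then 0 else 1) (\<lambda>_. 0) ({..<m} - {j}) (path_graph m \<mu>) (star_graph 1 \<mu>')"
    (is "contraction n ?r _ ?S ?G ?H")
proof (rule contractionI)
  show "?S \<subseteq> edges ?G" by auto
  show "?r ` verts ?G = verts ?H"
    using j by (auto simp: atMost_Suc image_iff intro: bexI[of _ 0] bexI[of _ m])
  have eq: "{..<m} - ?S = {j}" using j by auto
  show "bij_betw (\<lambda>_. 0) (edges ?G - ?S) (edges ?H)"
    by (simp add: eq bij_betw_def lessThan_Suc)
  show "ends ?H 0 = ?r ` ends ?G e" if "e \<in> edges ?G - ?S" for e
    using that by (auto simp: eq)
  show "?r u = ?r v" if "e \<in> ?S" "u \<in> ends ?G e" "v \<in> ends ?G e" for e u v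
    using that by auto
  show "f u = f v" if f: "\<And>e u v. \<lbrakk>e \<in> ?S; u \<in> ends ?G e; v \<in> ends ?G e\<rbrakk> \<Longrightarrow> f u = f v"
    and uv: "u \<in> verts ?G" "v \<in> verts ?G" "?r u = ?r v" for f :: "nat \<Rightarrow> nat" and u v
  proof -
    have step: "f (Suc x) = f x" if "x < m" "x \<noteq> j" for x
      using f[of x "Suc x" x] that by auto
    have low: "f x = f 0" if "x \<le> j" for x
      using that
    proof (induction x)
      case (Suc x)
      then show ?case using step[of x] j by simp
    qed simp
    have high: "f x = f (Suc j)" if "Suc j \<le> x" "x \<le> m" for x
      using that
    proof (induction x rule: dec_induct)
      case (step x)
      then show ?case using \<open>\<And>x. x < m \<Longrightarrow> x \<noteq> j \<Longrightarrow> f (Suc x) = f x\<close>[of x] by simp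
    qed simp
    show ?thesis
    proof (cases "u \<le> j")
      case True
      then have "v \<le> j" using uv(3) by (simp split: if_splits)
      then show ?thesis using True low[of u] low[of v] by simp
    next
      case False
      then have "\<not> v \<le> j" using uv(3) by (simp split: if_splits)
      then show ?thesis using False high[of u] high[of v] uv(1,2) by simp
    qed
  qed
  show "mark ?H i = ?r (mark ?G i)" if "1 \<le> i" "i \<le> n" for i
    using \<mu> that by simp
  have im: "?r ` ends ?G e = {?r e}" if "e \<in> ?S" for e
    using that by (cases "e < j") simp_all
  fix x assume x: "x \<in> verts ?H"
  have E': "{e \<in> ?S. ?r ` ends ?G e = {x}} = {e \<in> ?S. ?r e = x}"
    by (rule Collect_cong, rule conj_cong[OF refl]) (simp only: im singleton_inject, blast)
  show "int (weight ?H x) - 1 = (\<Sum>u | u \<in> verts ?G \<and> ?r u = x. int (weight ?G u) - 1) +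
      int (card {e \<in> ?S. ?r ` ends ?G e = {x}})"
  proof (cases "x = 0")
    case True
    have F: "{u. u \<in> verts ?G \<and> ?r u = x} = {..j}"
      using True j by auto
    have E: "{e \<in> ?S. ?r ` ends ?G e = {x}} = {..<j}"
      unfolding E' using True j by (auto split: if_split_asm)
    show ?thesis
      unfolding F E by simp
  next
    case False
    then have x1: "x = 1" using x by simp
    have F: "{u. u \<in> verts ?G \<and> ?r u = x} = {Suc j..m}"
      using x1 by auto
    have E: "{e \<in> ?S. ?r ` ends ?G e = {x}} = {Suc j..<m}"
      unfolding E' using x1 by (auto split: if_split_asm)
    show ?thesis
      unfolding F E using j by (simp add: of_nat_diff)
  qed
qed

lemma path_graph_vertex:
  assumes m: "m = Suc p" and x: "(path_graph m \<mu>, id) \<in> labelled_graphs 0 n p" and j: "j \<le> p"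
    and A: "\<And>i. 1 \<le> i \<Longrightarrow> i \<le> n \<Longrightarrow> i \<in> A \<longleftrightarrow> \<mu> i \<le> j"
  shows "tropical.cell_vertex 0 n (cell_of 0 n p (path_graph m \<mu>, id)) j = split_cell n A"
proof -
  have "\<mu> i \<le> m" if "1 \<le> i" "i \<le> n" for i
    using marked_weighted_graphD(9)[OF labelled_graphsD(4)[OF x] that] by simp
  then have "contraction n (\<lambda>v. if v \<le> j then 0 else 1) (\<lambda>_. 0) ({..<m} - {j})
      (path_graph m \<mu>) (star_graph 1 (\<lambda>i. if i \<in> A then 0 else 1))"
    using j A m by (intro path_graph_contraction) auto
  then have "contraction n (\<lambda>v. if v \<le> j then 0 else 1) (\<lambda>_. 0) (edges (path_graph m \<mu>) - {j})
      (path_graph m \<mu>) (star_graph 1 (\<lambda>i. if i \<in> A then 0 else 1))"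
    by simp
  from vertex_face(1)[OF x _ this, of id] j m show ?thesis
    by (simp add: split_cell_def)
qed

section \<open>2-cells in genus zero\<close>

definition split_triangle :: "nat \<Rightarrow> nat set \<Rightarrow> nat set \<Rightarrow> nat set \<Rightarrow> bool" where
  "split_triangle n A B C \<longleftrightarrow> (\<exists>T \<in> cells 0 n 2. \<exists>i\<le>2. \<exists>j\<le>2. \<exists>k\<le>2.
     tropical.cell_vertex 0 n T i = split_cell n A \<and> tropical.cell_vertex 0 n T j = split_cell n B \<and>
     tropical.cell_vertex 0 n T k = split_cell n C)"

lemma split_triangleI:
  assumes "T \<in> cells 0 n 2" "tropical.cell_vertex 0 n T 0 = split_cell n A"
    "tropical.cell_vertex 0 n T 1 = split_cell n B" "tropical.cell_vertex 0 n T 2 = split_cell n C"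
  shows "split_triangle n A B C"
  unfolding split_triangle_def
  by (rule bexI[OF _ assms(1)], rule exI[of _ 0], rule conjI, simp, rule exI[of _ 1], rule conjI,
      simp, rule exI[of _ 2]) (use assms in simp)

text \<open>A star with three leaves carries the sets. Its centre has valence 3 and needs no
  marking, so the three sets may exhaust \<open>{1..n}\<close>.\<close>

lemma split_triangle_star:
  assumes sub: "A \<subseteq> {1..n}" "B \<subseteq> {1..n}" "C \<subseteq> {1..n}" and card: "card A \<ge> 2" "card B \<ge> 2" "card C \<ge> 2"
    and disj: "A \<inter> B = {}" "A \<inter> C = {}" "B \<inter> C = {}"
  shows "split_triangle n A B C"
proof -
  let ?\<mu> = "\<lambda>i. if i \<in> A then 0 else if i \<in> B then 1 else if i \<in> C then 2 else 3::nat"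
  have F: "{i \<in> {1..n}. ?\<mu> i = 0} = A" "{i \<in> {1..n}. ?\<mu> i = 1} = B" "{i \<in> {1..n}. ?\<mu> i = 2} = C"
    using sub disj by auto
  have "card {i \<in> {1..n}. ?\<mu> i = j} \<ge> 2" if "j \<le> 2" for j
  proof -
    from that consider "j = 0" | "j = 1" | "j = 2" by linarith
    then show ?thesis
      by cases (simp_all only: F card)
  qed
  then have "(star_graph (Suc 2) ?\<mu>, id) \<in> labelled_graphs 0 n 2"
    by (intro star_graph_labelled) auto
  then have x: "(star_graph 3 ?\<mu>, id) \<in> labelled_graphs 0 n 2"
    by (simp only: eval_nat_numeral)
  let ?T = "cell_of 0 n 2 (star_graph 3 ?\<mu>, id)"
  have "tropical.cell_vertex 0 n ?T 0 = split_cell n A"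
    by (rule star_graph_vertex[OF _ x]) auto
  moreover have "tropical.cell_vertex 0 n ?T 1 = split_cell n B"
    by (rule star_graph_vertex[OF _ x]) (use disj in auto)
  moreover have "tropical.cell_vertex 0 n ?T 2 = split_cell n C"
    by (rule star_graph_vertex[OF _ x]) (use disj in auto)
  ultimately show ?thesis
    by (intro split_triangleI[OF cell_of_in_cells[OF x]]) simp_all
qed

text \<open>A path on four vertices with markings \<open>A\<close>, \<open>B - A\<close>, the rest,
  and \<open>C\<close>. The inner vertices have valence 2 and need a marking each, hence the strict
  inclusion and \<open>B \<union> C \<noteq> {1..n}\<close>. The third edge cuts off the complement
  of \<open>C\<close>, which is the same split.\<close>

lemma split_triangle_path:
  assumes sub: "A \<subset> B" "B \<subseteq> {1..n}" "C \<subseteq> {1..n}" and card: "card A \<ge> 2" "card C \<ge> 2"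
    and disj: "B \<inter> C = {}" "B \<union> C \<noteq> {1..n}"
  shows "split_triangle n A B C"
proof -
  let ?\<mu> = "\<lambda>i. if i \<in> A then 0 else if i \<in> B then 1 else if i \<in> C then 3 else 2::nat"
  have F: "{i \<in> {1..n}. ?\<mu> i = 0} = A" "{i \<in> {1..n}. ?\<mu> i = 1} = B - A" "{i \<in> {1..n}. ?\<mu> i = 3} = C"
      "{i \<in> {1..n}. ?\<mu> i = 2} = {1..n} - (B \<union> C)"
    using sub disj by auto
  have fin: "finite B" by (rule finite_subset[OF sub(2)]) simp
  have "card (B - A) > 0" "card ({1..n} - (B \<union> C)) > 0"
    unfolding card_gt_0_iff using sub disj fin by auto
  then have c: "card (B - A) \<ge> 1" "card ({1..n} - (B \<union> C)) \<ge> 1" by simp_all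
  have x: "(path_graph 3 ?\<mu>, id) \<in> labelled_graphs 0 n 2"
    by (rule path_graph_labelled) (simp_all only: F card c, auto)
  let ?T = "cell_of 0 n 2 (path_graph 3 ?\<mu>, id)"
  have "tropical.cell_vertex 0 n ?T 0 = split_cell n A"
    by (rule path_graph_vertex[OF _ x]) auto
  moreover have "tropical.cell_vertex 0 n ?T 1 = split_cell n B"
    by (rule path_graph_vertex[OF _ x]) (use sub in auto)
  moreover have "tropical.cell_vertex 0 n ?T 2 = split_cell n ({1..n} - C)"
    by (rule path_graph_vertex[OF _ x]) (use sub disj in auto)
  moreover have "split_cell n ({1..n} - C) = split_cell n C"
  proof (rule split_cell_Compl[OF sub(3) card(2)])
    have "card A \<le> card ({1..n} - C)"
      using sub disj by (intro card_mono) auto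
    then show "card ({1..n} - C) \<ge> 2" using card(1) by simp
  qed
  ultimately show ?thesis
    by (intro split_triangleI[OF cell_of_in_cells[OF x]]) simp_all
qed

section \<open>Compatibility of splits\<close>

text \<open>A bipartition of \<open>{1..n}\<close> is represented by its side not containing \<open>n\<close>.\<close>

definition splits :: "nat \<Rightarrow> nat set set" where
  "splits n = {A. A \<subseteq> {1..<n} \<and> 2 \<le> card A \<and> card A + 2 \<le> n}"

text \<open>Two bipartitions fit into one tree if a side of the one is disjoint from a side of the
  other. The sides represented here avoid \<open>n\<close>, so their complements meet; the three
  alternatives are the remaining pairs of sides.\<close>

definition compatible :: "nat set \<Rightarrow> nat set \<Rightarrow> bool" where
  "compatible A B \<longleftrightarrow> A \<noteq> B \<and> (A \<inter> B = {} \<or> A \<subset> B \<or> B \<subset> A)"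

lemma compatible_sym: "compatible A B \<Longrightarrow> compatible B A"
  by (auto simp: compatible_def)

lemma splitsD:
  assumes "A \<in> splits n"
  shows "A \<subseteq> {1..<n}" "A \<subseteq> {1..n}" "finite A" "card A \<ge> 2" "card A + 2 \<le> n" "n \<notin> A" "A \<noteq> {}"
    "card ({1..n} - A) \<ge> 2"
proof -
  show A: "A \<subseteq> {1..<n}" "card A \<ge> 2" "card A + 2 \<le> n"
    using assms by (auto simp: splits_def)
  then show "A \<subseteq> {1..n}" "n \<notin> A" "A \<noteq> {}" by auto
  show "finite A" by (rule finite_subset[OF A(1)]) simp
  then have "card ({1..n} - A) = n - card A"
    using \<open>A \<subseteq> {1..n}\<close> by (simp add: card_Diff_subset)
  then show "card ({1..n} - A) \<ge> 2" using A(3) by simp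
qed

lemma split_cell_inj:
  assumes "A \<in> splits n" "B \<in> splits n" "split_cell n A = split_cell n B"
  shows "A = B"
proof -
  have "A = B \<or> A = {1..n} - B"
    using splitsD[OF assms(1)] splitsD[OF assms(2)] assms(3) by (intro split_cell_eqD) auto
  moreover have "n \<ge> 1" "n \<notin> A" "n \<notin> B"
    using splitsD(5,6)[OF assms(1)] splitsD(6)[OF assms(2)] by auto
  ultimately show ?thesis by auto
qed

lemma vertex_split:
  assumes "d \<in> cells 0 n 0" "n \<ge> 1"
  obtains A where "A \<in> splits n" "d = split_cell n A"
proof -
  obtain A where A: "A \<subseteq> {1..<n}" "card A \<ge> 2" "card ({1..n} - A) \<ge> 2" "d = split_cell n A"
    by (rule genus_0_vertexE[OF assms])
  have "finite A" by (rule finite_subset[OF A(1)]) simp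
  then have "card ({1..n} - A) = n - card A"
    using A(1) by (subst card_Diff_subset) auto
  then have "A \<in> splits n"
    using A by (simp add: splits_def)
  then show thesis using that A(4) by blast
qed

text \<open>Oriented so that vertex 0 belongs to \<open>A\<close> and vertex 1 to \<open>B\<close>.
  In the nested cases the larger set is replaced by its complement to obtain two disjoint outer
  sides.\<close>

definition edge_cell :: "nat \<Rightarrow> nat set \<Rightarrow> nat set \<Rightarrow> labelled_graph set" where
  "edge_cell n A B = (if A \<inter> B = {} then double_split_cell n A B
     else if A \<subset> B then double_split_cell n A ({1..n} - B) else double_split_cell n ({1..n} - A) B)"

lemma double_split_cell_in_cells:
  assumes "A \<subseteq> {1..n}" "C \<subseteq> {1..n}" "card A \<ge> 2" "card C \<ge> 2" "A \<inter> C = {}" "A \<union> C \<noteq> {1..n}"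
  shows "double_split_cell n A C \<in> cells 0 n 1"
  unfolding double_split_cell_def by (rule cell_of_in_cells[OF double_split_labelled[OF assms]])

lemma edge_cell_vertices:
  assumes A: "A \<in> splits n" and B: "B \<in> splits n" and c: "compatible A B"
  shows "edge_cell n A B \<in> cells 0 n 1"
    "tropical.cell_vertex 0 n (edge_cell n A B) 0 = split_cell n A"
    "tropical.cell_vertex 0 n (edge_cell n A B) 1 = split_cell n B"
proof -
  note a = splitsD[OF A] and b = splitsD[OF B]
  have n: "n \<in> {1..n}" using a(5) by simp
  consider "A \<inter> B = {}" | "A \<inter> B \<noteq> {}" "A \<subset> B" | "A \<inter> B \<noteq> {}" "\<not> A \<subset> B" "B \<subset> A"
    using c by (auto simp: compatible_def)
  then have "edge_cell n A B \<in> cells 0 n 1 \<and>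
    tropical.cell_vertex 0 n (edge_cell n A B) 0 = split_cell n A \<and>
    tropical.cell_vertex 0 n (edge_cell n A B) 1 = split_cell n B"
  proof cases
    case 1
    have "A \<union> B \<noteq> {1..n}" using n a(6) b(6) by blast
    note h = a(2) b(2) a(4) b(4) 1 this
    show ?thesis
      using double_split_vertices[OF h] double_split_cell_in_cells[OF h] 1
      by (simp add: edge_cell_def)
  next
    case 2
    have "A \<inter> ({1..n} - B) = {}" "A \<union> ({1..n} - B) \<noteq> {1..n}" "{1..n} - B \<subseteq> {1..n}"
      using 2 b(2) by blast+
    note h = a(2) this(3) a(4) b(8) this(1,2)
    show ?thesis
      using double_split_vertices[OF h] double_split_cell_in_cells[OF h] 2
        split_cell_Compl[OF b(2,4,8)]
      by (simp add: edge_cell_def)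
  next
    case 3
    have "({1..n} - A) \<inter> B = {}" "({1..n} - A) \<union> B \<noteq> {1..n}" "{1..n} - A \<subseteq> {1..n}"
      using 3 a(2) by blast+
    note h = this(3) b(2) a(8) b(4) this(1,2)
    show ?thesis
      using double_split_vertices[OF h] double_split_cell_in_cells[OF h] 3
        split_cell_Compl[OF a(2,4,8)]
      by (simp add: edge_cell_def)
  qed
  then show "edge_cell n A B \<in> cells 0 n 1"
    "tropical.cell_vertex 0 n (edge_cell n A B) 0 = split_cell n A"
    "tropical.cell_vertex 0 n (edge_cell n A B) 1 = split_cell n B" by blast+
qed

text \<open>Of the four ways to choose sides, the one with two complements is impossible because
  both contain \<open>n\<close>; each of the others determines the cell. So a 1-cell is determined
  by its ordered pair of vertices and never joins a vertex to itself.\<close>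

lemma edge_cell_unique:
  assumes c: "c \<in> cells 0 n 1" and A: "A \<in> splits n" and B: "B \<in> splits n"
    and v: "tropical.cell_vertex 0 n c 0 = split_cell n A" "tropical.cell_vertex 0 n c 1 = split_cell n B"
  shows "compatible A B" "c = edge_cell n A B"
proof -
  note a = splitsD[OF A] and b = splitsD[OF B]
  have n: "n \<in> {1..n}" using a(5) by simp
  obtain D E where D: "D \<subseteq> {1..n}" and E: "E \<subseteq> {1..n}" and cards: "card D \<ge> 2" "card E \<ge> 2"
    and disj: "D \<inter> E = {}" and un: "D \<union> E \<noteq> {1..n}" and cc: "c = double_split_cell n D E"
    by (rule genus_0_edgeE[OF c])
  have ne: "D \<noteq> {}" "E \<noteq> {}" using cards by auto
  note dv = double_split_vertices[OF D E cards disj un]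
  have DA: "D = A \<or> D = {1..n} - A"
    using dv(1) v(1) cc by (intro split_cell_eqD[OF D a(2,4,8)]) simp
  have EB: "E = B \<or> E = {1..n} - B"
    using dv(2) v(2) cc by (intro split_cell_eqD[OF E b(2,4,8)]) simp
  consider "D = A" "E = B" | "D = A" "E = {1..n} - B" | "D = {1..n} - A" "E = B"
    | "D = {1..n} - A" "E = {1..n} - B"
    using DA EB by blast
  then have "compatible A B \<and> c = edge_cell n A B"
  proof cases
    case 1
    then show ?thesis using cc disj ne by (auto simp: compatible_def edge_cell_def)
  next
    case 2
    have "A \<subseteq> B" using disj a(2) 2 by blast
    moreover have "A \<noteq> B" using un a(2) 2 by blast
    moreover have "A \<inter> B \<noteq> {}" using ne(1) 2(1) \<open>A \<subseteq> B\<close> by blast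
    ultimately show ?thesis using cc 2 by (auto simp: compatible_def edge_cell_def)
  next
    case 3
    have "B \<subseteq> A" using disj b(2) 3 by blast
    moreover have "A \<noteq> B" using un a(2) 3 by blast
    moreover have "A \<inter> B \<noteq> {}" using ne(2) 3(2) \<open>B \<subseteq> A\<close> by blast
    moreover have "\<not> A \<subset> B" using \<open>B \<subseteq> A\<close> by blast
    ultimately show ?thesis unfolding cc 3 by (simp add: compatible_def edge_cell_def psubset_eq)
  next
    case 4
    then have "n \<in> D \<inter> E" using n a(6) b(6) by blast
    then show ?thesis using disj by blast
  qed
  then show "compatible A B" "c = edge_cell n A B" by blast+
qed

lemma split_triangle_perm:
  assumes "split_triangle n A B C"
  shows "split_triangle n B A C" "split_triangle n A C B"
  using assms unfolding split_triangle_def by blast+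

lemma split_triangle_Compl:
  assumes "C \<in> splits n" "split_triangle n A B ({1..n} - C)"
  shows "split_triangle n A B C"
  using assms(2) split_cell_Compl[OF splitsD(2,4,8)[OF assms(1)]] by (simp add: split_triangle_def)

text \<open>Up to order there are four patterns: pairwise disjoint; \<open>X \<subset> Y\<close>
  disjoint from \<open>Z\<close>; a chain; two disjoint sets inside a third. Stars realize the first
  and the last, paths the other two, after passing to the complement of the largest set where
  needed.\<close>

lemma split_triangle_compatible_aux:
  assumes A: "A \<in> splits n" and B: "B \<in> splits n" and C: "C \<in> splits n"
    and AB: "A \<inter> B = {} \<or> A \<subset> B" and AC: "compatible A C" and BC: "compatible B C"
  shows "split_triangle n A B C"
proof -
  note a = splitsD[OF A] and b = splitsD[OF B] and c = splitsD[OF C]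
  have n: "n \<in> {1..n}" using a(5) by simp
  note perm = split_triangle_perm
  have nested: "split_triangle n X Y Z"
    if X: "X \<in> splits n" and Y: "Y \<in> splits n" and Z: "Z \<in> splits n" and "X \<subset> Y" "Y \<inter> Z = {}" for X Y Z
  proof (rule split_triangle_path[OF \<open>X \<subset> Y\<close>])
    show "Y \<union> Z \<noteq> {1..n}" using n splitsD(6)[OF Y] splitsD(6)[OF Z] by blast
  qed (use splitsD[OF X] splitsD[OF Y] splitsD[OF Z] \<open>Y \<inter> Z = {}\<close> in auto)
  have chain: "split_triangle n X Y Z"
    if X: "X \<in> splits n" and Y: "Y \<in> splits n" and Z: "Z \<in> splits n" and "X \<subset> Y" "Y \<subset> Z" for X Y Z
  proof (rule split_triangle_Compl[OF Z], rule split_triangle_path[OF \<open>X \<subset> Y\<close>])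
    show "Y \<union> ({1..n} - Z) \<noteq> {1..n}" using splitsD(2)[OF Z] \<open>Y \<subset> Z\<close> by blast
  qed (use splitsD[OF X] splitsD[OF Y] splitsD[OF Z] \<open>Y \<subset> Z\<close> in auto)
  have inside: "split_triangle n X Y Z"
    if X: "X \<in> splits n" and Y: "Y \<in> splits n" and Z: "Z \<in> splits n" and "X \<inter> Y = {}" "X \<subset> Z" "Y \<subset> Z" for X Y Z
    by (rule split_triangle_Compl[OF Z], rule split_triangle_star)
       (use splitsD[OF X] splitsD[OF Y] splitsD[OF Z] that(4-6) in auto)
  from AB show ?thesis
  proof
    assume AB: "A \<inter> B = {}"
    consider "A \<inter> C = {}" | "C \<subset> A" | "A \<subset> C" using AC by (auto simp: compatible_def)
    then show ?thesis
    proof cases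
      case 1
      consider "B \<inter> C = {}" | "C \<subset> B" | "B \<subset> C" using BC by (auto simp: compatible_def)
      then show ?thesis
      proof cases
        case 1
        then show ?thesis using split_triangle_star[of A n B C] a b c AB \<open>A \<inter> C = {}\<close> by auto
      next
        case 2
        have "split_triangle n C B A" using nested[OF C B A 2] AB by blast
        then show ?thesis using perm by blast
      next
        case 3
        have "split_triangle n B C A" using nested[OF B C A 3] 1 by blast
        then show ?thesis using perm by blast
      qed
    next
      case 2
      have "split_triangle n C A B" using nested[OF C A B 2 AB] .
      then show ?thesis using perm by blast
    next
      case 3
      consider "B \<inter> C = {}" | "C \<subset> B" | "B \<subset> C" using BC by (auto simp: compatible_def)
      then show ?thesis
      proof cases
        case 1
        have "split_triangle n A C B" using nested[OF A C B 3] 1 by blast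
        then show ?thesis using perm by blast
      next
        case 2
        then show ?thesis using 3 AB a(7) by blast
      next
        case 3
        then show ?thesis using inside[OF A B C AB \<open>A \<subset> C\<close>] by blast
      qed
    qed
  next
    assume AB: "A \<subset> B"
    consider "A \<inter> C = {}" | "C \<subset> A" | "A \<subset> C" using AC by (auto simp: compatible_def)
    then show ?thesis
    proof cases
      case 1
      consider "B \<inter> C = {}" | "C \<subset> B" | "B \<subset> C" using BC by (auto simp: compatible_def)
      then show ?thesis
      proof cases
        case 1
        then show ?thesis using nested[OF A B C AB] by blast
      next
        case 2
        have "split_triangle n A C B" using inside[OF A C B 1 AB 2] .
        then show ?thesis using perm by blast
      next
        case 3
        then show ?thesis using 1 AB a(7) by blast
      qed
    next
      case 2
      have "split_triangle n C A B" using chain[OF C A B 2 AB] .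
      then show ?thesis using perm by blast
    next
      case 3
      consider "B \<inter> C = {}" | "C \<subset> B" | "B \<subset> C" using BC by (auto simp: compatible_def)
      then show ?thesis
      proof cases
        case 1
        then show ?thesis using AB 3 a(7) by blast
      next
        case 2
        have "split_triangle n A C B" using chain[OF A C B 3 2] .
        then show ?thesis using perm by blast
      next
        case 3
        then show ?thesis using chain[OF A B C AB] by blast
      qed
    qed
  qed
qed

lemma split_triangle_compatible:
  assumes A: "A \<in> splits n" and B: "B \<in> splits n" and C: "C \<in> splits n"
    and c: "compatible A B" "compatible A C" "compatible B C"
  shows "split_triangle n A B C"
proof (cases "B \<subset> A")
  case True
  then show ?thesis
    using split_triangle_compatible_aux[OF B A C _ c(3,2)] split_triangle_perm(1) by blast
next
  case False
  then show ?thesis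
    using c(1) split_triangle_compatible_aux[OF A B C _ c(2,3)] by (auto simp: compatible_def)
qed

section \<open>Propagation from a spanning tree to all compatible pairs\<close>

text \<open>Removing the label \<open>n - 1\<close> retracts the splits onto the star of \<open>{1..n - 2}\<close>, except for
  the splits \<open>{a, n - 1}\<close>. Each of the latter is coned off after the others, and its link is connected
  because every member is joined to \<open>{1..n - 2} - {a}\<close>; this is where \<open>n \<ge> 6\<close> is needed.\<close>

lemma splits_closure:
  fixes ok :: "nat set \<Rightarrow> nat set \<Rightarrow> bool" and n :: nat
  defines "V \<equiv> {1..<n - 1}"
  assumes n: "n \<ge> 6"
    and sym: "\<And>A B. \<lbrakk>A \<in> splits n; B \<in> splits n; compatible A B; ok A B\<rbrakk> \<Longrightarrow> ok B A"
    and trans: "\<And>A B C. \<lbrakk>A \<in> splits n; B \<in> splits n; C \<in> splits n; compatible A B; compatible A C;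
      compatible B C; ok A B; ok B C\<rbrakk> \<Longrightarrow> ok A C"
    and base: "\<And>A. \<lbrakk>A \<in> splits n; A \<subset> V\<rbrakk> \<Longrightarrow> ok V A"
    and drop: "\<And>A. \<lbrakk>A \<in> splits n; n - 1 \<in> A; card A \<noteq> 2\<rbrakk> \<Longrightarrow> ok (A - {n - 1}) A"
    and pair: "\<And>A. \<lbrakk>A \<in> splits n; n - 1 \<in> A; card A = 2\<rbrakk> \<Longrightarrow> ok (V - A) A"
    and A: "A \<in> splits n" and B: "B \<in> splits n" and AB: "compatible A B"
  shows "ok A B"
proof -
  let ?m = "n - 1"
  have range: "{1..<n} = insert ?m V" "?m \<notin> V" "finite V" "card V = n - 2"
    using n by (auto simp: V_def)
  have V: "V \<in> splits n"
    using n range by (auto simp: splits_def)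
  have in_V: "X \<subseteq> V \<longleftrightarrow> ?m \<notin> X" if "X \<in> splits n" for X
    using splitsD(1)[OF that] range(2) unfolding range(1) by blast
  have inV_splits: "X \<in> splits n" if "X \<subseteq> V" "card X \<ge> 2" for X
  proof -
    have "card X \<le> n - 2"
      using card_mono[OF range(3) that(1)] range(4) by simp
    then show ?thesis
      using that n unfolding splits_def range(1) by auto
  qed
  \<comment> \<open>\<open>V\<close> contains all splits avoiding \<open>?m\<close> and is joined to
    each of the others by \<open>base\<close>, so every compatible pair of them closes a triangle
    with \<open>V\<close>.\<close>
  have ok1: "ok X Y" if X: "X \<in> splits n" "?m \<notin> X" and Y: "Y \<in> splits n" "?m \<notin> Y" and XY: "compatible X Y" for X Y
  proof -
    have sub: "X \<subseteq> V" "Y \<subseteq> V"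
      using in_V[OF X(1)] in_V[OF Y(1)] X Y by auto
    consider "X = V" | "Y = V" | "X \<subset> V" "Y \<subset> V" using sub by blast
    then show ?thesis
    proof cases
      case 1
      then show ?thesis using base[OF Y(1)] sub XY by (auto simp: compatible_def)
    next
      case 2
      then have "X \<subset> V" using sub XY by (auto simp: compatible_def)
      then show ?thesis
        using sym[OF V X(1) _ base[OF X(1)]] 2 by (auto simp: compatible_def)
    next
      case 3
      then have c: "compatible X V" "compatible V Y" "compatible V X"
        by (auto simp: compatible_def)
      show ?thesis
        by (rule trans[OF X(1) V Y(1) c(1) XY c(2) sym[OF V X(1) c(3) base[OF X(1) 3(1)]] base[OF Y(1) 3(2)]])
    qed
  qed
  have dropped: "X - {?m} \<in> splits n" "X - {?m} \<subset> X" if X: "X \<in> splits n" "?m \<in> X" "card X \<noteq> 2" for X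
  proof -
    have "card (X - {?m}) = card X - 1"
      using X(2) splitsD(3)[OF X(1)] by simp
    then have "card (X - {?m}) \<ge> 2"
      using splitsD(4)[OF X(1)] X(3) by simp
    moreover have "X - {?m} \<subseteq> V"
      using splitsD(1)[OF X(1)] range by blast
    ultimately show "X - {?m} \<in> splits n" by (intro inV_splits)
    show "X - {?m} \<subset> X" using X(2) by blast
  qed
  \<comment> \<open>If \<open>Y\<close> avoids \<open>?m\<close> and is compatible with
    \<open>X\<close>, then it equals \<open>X - {?m}\<close> or is compatible with it; the pair
    passes through that set.\<close>
  have ok2: "ok Y X" if X: "X \<in> splits n" "?m \<in> X" "card X \<noteq> 2" and Y: "Y \<in> splits n" "?m \<notin> Y"
    and YX: "compatible Y X" for X Y
  proof (cases "Y = X - {?m}")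
    case True
    then show ?thesis using drop[OF X] by simp
  next
    case False
    note X' = dropped[OF X]
    have "Y \<inter> X = {} \<or> Y \<subset> X"
      using YX X(2) Y(2) by (auto simp: compatible_def)
    then have c: "compatible Y (X - {?m})"
      using False Y(2) by (auto simp: compatible_def)
    have c': "compatible (X - {?m}) X"
      using X'(2) by (auto simp: compatible_def)
    have "ok Y (X - {?m})"
      by (rule ok1[OF Y X'(1) _ c]) simp
    then show ?thesis
      by (rule trans[OF Y(1) X'(1) X(1) c YX c' _ drop[OF X]])
  qed
  \<comment> \<open>Here both sets contain \<open>?m\<close> and \<open>X - {?m}\<close> is the
    intermediate vertex; its edge to \<open>Y\<close> is covered by \<open>ok2\<close>.\<close>
  have ok3: "ok X Y" if X: "X \<in> splits n" "?m \<in> X" "card X \<noteq> 2"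
    and Y: "Y \<in> splits n" "?m \<in> Y" "card Y \<noteq> 2" and XY: "X \<subset> Y" for X Y
  proof -
    note X' = dropped[OF X]
    have c: "compatible X (X - {?m})" "compatible (X - {?m}) Y" "compatible (X - {?m}) X" "compatible X Y"
      using X'(2) XY by (auto simp: compatible_def)
    have "ok (X - {?m}) Y"
      by (rule ok2[OF Y X'(1) _ c(2)]) simp
    then show ?thesis
      by (rule trans[OF X(1) X'(1) Y(1) c(1,4,2) sym[OF X'(1) X(1) c(3) drop[OF X]]])
  qed
  \<comment> \<open>A set disjoint from the pair \<open>X\<close> lies in \<open>V - X\<close>, to
    which \<open>X\<close> is joined by \<open>pair\<close>.\<close>
  have ok4: "ok Y X" if X: "X \<in> splits n" "?m \<in> X" "card X = 2" and Y: "Y \<in> splits n"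
    and YX: "Y \<inter> X = {}" for X Y
  proof -
    let ?W = "V - X"
    have mY: "?m \<notin> Y" using YX X(2) by blast
    then have YW: "Y \<subseteq> ?W" using in_V[OF Y] YX by blast
    then have "card ?W \<ge> 2"
      using card_mono[of ?W Y] range(3) splitsD(4)[OF Y] by simp
    then have W: "?W \<in> splits n" by (intro inV_splits) auto
    show ?thesis
    proof (cases "Y = ?W")
      case True
      then show ?thesis using pair[OF X] by simp
    next
      case False
      have ne: "Y \<noteq> {}" "?W \<noteq> {}" using splitsD(7)[OF Y] YW by auto
      have c: "compatible Y ?W" "compatible Y X" "compatible ?W X"
        using False YW YX ne by (auto simp: compatible_def)
      have "ok Y ?W" using range(2) by (intro ok1[OF Y mY W _ c(1)]) simp
      then show ?thesis
        by (rule trans[OF Y W X(1) c _ pair[OF X]])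
    qed
  qed
  \<comment> \<open>A proper subset of the pair \<open>X\<close> is too small to be a split. For
    \<open>X \<subset> Y\<close> the passage is through a set \<open>F\<close> disjoint from
    \<open>X\<close> and compatible with \<open>Y\<close>.\<close>
  have ok5: "ok Y X" if X: "X \<in> splits n" "?m \<in> X" "card X = 2" and Y: "Y \<in> splits n"
    and YX: "compatible Y X" for X Y
  proof -
    have "\<not> Y \<subset> X"
    proof
      assume "Y \<subset> X"
      from psubset_card_mono[OF splitsD(3)[OF X(1)] this] show False
        using X(3) splitsD(4)[OF Y] by simp
    qed
    then consider "Y \<inter> X = {}" | "X \<subset> Y" using YX by (auto simp: compatible_def)
    then show ?thesis
    proof cases
      case 1
      then show ?thesis using ok4[OF X Y] by simp
    next
      case 2
      then have mY: "?m \<in> Y" using X(2) by blast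
      have cY: "card Y \<noteq> 2"
        using psubset_card_mono[OF splitsD(3)[OF Y] 2] X(3) by simp
      \<comment> \<open>Either \<open>Y - X\<close> or \<open>V - Y\<close> is large enough: if
        \<open>Y - X\<close> has at most one element, then \<open>Y\<close> has at most three, one
        of them \<open>?m\<close>, and \<open>V - Y\<close> has at least \<open>n - 4\<close>
        elements, which is where \<open>n \<ge> 6\<close> enters.\<close>
      obtain F where F: "F \<subseteq> V" "card F \<ge> 2" "F \<inter> X = {}" "F \<subset> Y \<or> F \<inter> Y = {}"
      proof (cases "card (Y - X) \<ge> 2")
        case True
        have "Y - X \<subseteq> V" using splitsD(1)[OF Y] X(2) unfolding range(1) by blast
        moreover have "Y - X \<subset> Y" using X(2) mY by blast
        ultimately show thesis using that[of "Y - X"] True by blast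
      next
        case False
        have cYX: "card (Y - X) = card Y - 2"
          using card_Diff_subset[OF splitsD(3)[OF X(1)]] 2 X(3) by auto
        have "card (V - Y) \<ge> card V - card (Y \<inter> V)"
          using diff_card_le_card_Diff[of "Y \<inter> V" V] range(3) by (metis Diff_Int2 Int_absorb finite_Int)
        moreover have "Y \<inter> V = Y - {?m}"
          using splitsD(1)[OF Y] range by blast
        then have "card (Y \<inter> V) = card Y - 1"
          using mY splitsD(3)[OF Y] by simp
        ultimately have "card (V - Y) \<ge> 2"
          using False cYX range(4) n by linarith
        then show thesis using that[of "V - Y"] 2 by blast
      qed
      have Fs: "F \<in> splits n" by (rule inV_splits[OF F(1,2)])
      have mF: "?m \<notin> F" using F(1) range(2) by blast
      have ne: "F \<noteq> {}" using F(2) by auto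
      have c: "compatible F Y" "compatible Y F" "compatible F X"
        using F(3,4) ne mY mF by (auto simp: compatible_def)
      have "ok F Y" by (rule ok2[OF Y mY cY Fs mF c(1)])
      then have "ok Y F" by (rule sym[OF Fs Y c(1)])
      then show ?thesis
        by (rule trans[OF Y Fs X(1) c(2) YX c(3) _ ok4[OF X Fs F(3)]])
    qed
  qed
  show ?thesis
  proof (cases "?m \<in> A")
    case False
    show ?thesis
    proof (cases "?m \<in> B")
      case True
      then show ?thesis using ok5[OF B _ _ A AB] ok2[OF B _ _ A False AB] by blast
    next
      case mB: False
      then show ?thesis using ok1[OF A False B mB AB] by simp
    qed
  next
    case mA: True
    note BA = compatible_sym[OF AB]
    show ?thesis
    proof (cases "?m \<in> B")
      case False
      have "ok B A" using ok5[OF A mA _ B BA] ok2[OF A mA _ B False BA] by blast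
      then show ?thesis by (rule sym[OF B A BA])
    next
      case mB: True
      consider "card B = 2" | "card A = 2" | "card A \<noteq> 2" "card B \<noteq> 2" by blast
      then show ?thesis
      proof cases
        case 1
        then show ?thesis using ok5[OF B mB _ A AB] by simp
      next
        case 2
        then have "ok B A" using ok5[OF A mA _ B BA] by simp
        then show ?thesis by (rule sym[OF B A BA])
      next
        case 3
        have "A \<subset> B \<or> B \<subset> A" using AB mA mB by (auto simp: compatible_def)
        then show ?thesis
          using ok3[OF A mA 3(1) B mB 3(2)] ok3[OF B mB 3(2) A mA 3(1)] sym[OF B A BA] by blast
      qed
    qed
  qed
qed

theorem simply_connected_genus_0:
  assumes n: "n \<ge> 6"
  shows "simply_connected_space (tropical_moduli_space 0 n)"
proof -
  let ?X = "tropical.realization 0 n" and ?m = "n - 1"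
  define V where "V = {1..<n - 1}"
  let ?pt = "\<lambda>A. tropical.vertex_point 0 n (split_cell n A)"
  define seg where "seg A B = tropical.segment 0 n 1 (edge_cell n A B) (vert 0) (vert 1)" for A B
  have range: "{1..<n} = insert ?m V" "?m \<notin> V" "finite V" "card V = n - 2"
    using n by (auto simp: V_def)
  have V: "V \<in> splits n"
    using n range by (auto simp: splits_def)
  have cell0: "split_cell n A \<in> cells 0 n 0" if "A \<in> splits n" for A
    using splitsD[OF that] by (intro split_cell_in_cells)
  have pt: "?pt A \<in> topspace ?X" if "A \<in> splits n" for A
    unfolding tropical.vertex_point_def
    by (rule tropical.point_in_realization[OF cell0[OF that] vert_in_simplex]) simp
  have seg: "path_from_to ?X (?pt A) (?pt B) (seg A B)"
    if A: "A \<in> splits n" and B: "B \<in> splits n" and c: "compatible A B" for A B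
  proof -
    note e = edge_cell_vertices[OF A B c]
    have "path_from_to ?X (tropical.point 0 n (1, edge_cell n A B, vert 0))
        (tropical.point 0 n (1, edge_cell n A B, vert 1)) (seg A B)"
      unfolding seg_def by (intro tropical.segment_path[OF e(1)] vert_in_simplex) simp_all
    then show ?thesis
      using tropical.point_vertex[OF e(1), of 0] tropical.point_vertex[OF e(1), of 1] e(2,3) by simp
  qed
  define P1 where "P1 A = (if A = V then (\<lambda>_. ?pt V) else seg V A)" for A
  \<comment> \<open>The parent of a split containing \<open>?m\<close> in a spanning tree rooted at
    \<open>V\<close>, matching \<open>drop\<close> and \<open>pair\<close> of
    \<open>splits_closure\<close>; splits avoiding \<open>?m\<close> are children of
    \<open>V\<close>.\<close>
  define prev where "prev A = (if card A = 2 then V - A else A - {?m})" for A :: "nat set"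
  define P where "P A = (if ?m \<in> A then path_join (P1 (prev A)) (seg (prev A) A) else P1 A)" for A
  define Q where "Q d = P (THE A. A \<in> splits n \<and> d = split_cell n A)" for d
  have Q_split: "Q (split_cell n A) = P A" if "A \<in> splits n" for A
  proof -
    have "(THE B. B \<in> splits n \<and> split_cell n A = split_cell n B) = A"
      using that split_cell_inj by (intro the_equality) auto
    then show ?thesis by (simp add: Q_def)
  qed
  have P1: "path_from_to ?X (?pt V) (?pt A) (P1 A)" if A: "A \<in> splits n" "?m \<notin> A" for A
  proof (cases "A = V")
    case True
    then show ?thesis using path_from_to_const[OF pt[OF V]] by (simp add: P1_def)
  next
    case False
    then have "A \<subset> V"
      using splitsD(1)[OF A(1)] A(2) unfolding range(1) by blast
    then show ?thesis
      using False seg[OF V A(1)] by (auto simp: P1_def compatible_def)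
  qed
  have prev: "prev A \<in> splits n" "?m \<notin> prev A" "compatible (prev A) A"
    if A: "A \<in> splits n" "?m \<in> A" for A
  proof -
    note a = splitsD[OF A(1)]
    have "prev A \<subseteq> V"
      using a(1) range(1) by (auto simp: prev_def)
    moreover have "card (prev A) \<ge> 2"
    proof (cases "card A = 2")
      case True
      have "V \<inter> A = A - {?m}" using a(1) range by blast
      then have "card (V \<inter> A) = 1" using True A(2) a(3) by simp
      then have "card (V - A) = n - 3"
        using card_Diff_subset_Int[of V A] range(3,4) by simp
      then show ?thesis using True n by (simp add: prev_def)
    next
      case False
      have "card (A - {?m}) = card A - 1" using A(2) a(3) by simp
      then show ?thesis using False a(4) by (simp add: prev_def)
    qed
    moreover have "card (prev A) \<le> n - 2"
      using card_mono[OF range(3) \<open>prev A \<subseteq> V\<close>] range(4) by simp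
    ultimately show ps: "prev A \<in> splits n"
      using n unfolding splits_def range(1) by auto
    show "?m \<notin> prev A"
      using \<open>prev A \<subseteq> V\<close> range(2) by blast
    then show "compatible (prev A) A"
      using A(2) splitsD(7)[OF ps] by (auto simp: compatible_def prev_def split: if_splits)
  qed
  have P: "path_from_to ?X (?pt V) (?pt A) (P A)" if A: "A \<in> splits n" for A
  proof (cases "?m \<in> A")
    case True
    note p = prev[OF A True]
    show ?thesis
      using path_from_to_join[OF P1[OF p(1,2)] seg[OF p(1) A p(3)]] True by (simp add: P_def)
  qed (use P1[OF A] in \<open>simp add: P_def\<close>)
  have Q: "path_from_to ?X (?pt V) (tropical.vertex_point 0 n d) (Q d)" if d: "d \<in> cells 0 n 0" for d
  proof -
    obtain A where "A \<in> splits n" "d = split_cell n A"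
      using n by (auto intro: vertex_split[OF d])
    then show ?thesis using P Q_split by simp
  qed
  interpret tropical_vertex_paths 0 n "split_cell n V" Q
    by unfold_locales (use cell0[OF V] Q in auto)
  define ok where "ok A B \<longleftrightarrow> good 1 (edge_cell n A B) 0 1" for A B
  \<comment> \<open>Since a 1-cell is determined by its vertices, the condition on an edge of any
    cell depends only on the two splits at its ends. This turns \<open>good\<close> into a relation
    on splits.\<close>
  have good_edge: "compatible A B \<and> (good q T i j \<longleftrightarrow> ok A B)"
    if T: "T \<in> cells 0 n q" and ij: "i \<le> q" "j \<le> q" and A: "A \<in> splits n" and B: "B \<in> splits n" and "A \<noteq> B"
      and v: "tropical.cell_vertex 0 n T i = split_cell n A" "tropical.cell_vertex 0 n T j = split_cell n B"
    for q T i j A B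
  proof -
    let ?\<theta> = "\<lambda>l::nat. if l = 0 then i else j"
    have "i \<noteq> j" using v split_cell_inj[OF A B] \<open>A \<noteq> B\<close> by auto
    then have \<theta>: "inj_on ?\<theta> {..1}" "?\<theta> ` {..1} \<subseteq> {..q}"
      using ij by (auto simp: inj_on_def)
    have c: "pull_cell 0 n 1 ?\<theta> T \<in> cells 0 n 1"
      by (rule tropical.pull_closed[OF \<theta> T])
    have cv: "tropical.cell_vertex 0 n (pull_cell 0 n 1 ?\<theta> T) 0 = split_cell n A"
        "tropical.cell_vertex 0 n (pull_cell 0 n 1 ?\<theta> T) 1 = split_cell n B"
      using tropical.cell_vertex_pull[OF \<theta> T, of 0] tropical.cell_vertex_pull[OF \<theta> T, of 1] v by simp_all
    note u = edge_cell_unique[OF c A B cv]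
    show ?thesis
      using good_pull[OF \<theta> T, of 0 1] u by (simp add: ok_def)
  qed
  have "ok A B" if A: "A \<in> splits n" and B: "B \<in> splits n" and AB: "compatible A B" for A B
  proof (rule splits_closure[where ok = ok, OF n _ _ _ _ _ A B AB])
    show "ok B A" if A: "A \<in> splits n" and B: "B \<in> splits n" and AB: "compatible A B" and ok: "ok A B" for A B
    proof -
      note e = edge_cell_vertices[OF A B AB]
      have "good 1 (edge_cell n A B) 1 0"
        using good_sym[OF e(1), of 0 1] ok by (simp add: ok_def)
      moreover have "B \<noteq> A" using AB by (auto simp: compatible_def)
      ultimately show ?thesis
        using good_edge[OF e(1), of 1 0 B A] e A B by simp
    qed
    show "ok A C" if A: "A \<in> splits n" and B: "B \<in> splits n" and C: "C \<in> splits n"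
      and c: "compatible A B" "compatible A C" "compatible B C" and ok: "ok A B" "ok B C" for A B C
    proof -
      obtain T i j k where T: "T \<in> cells 0 n 2" "i \<le> 2" "j \<le> 2" "k \<le> 2"
        and v: "tropical.cell_vertex 0 n T i = split_cell n A" "tropical.cell_vertex 0 n T j = split_cell n B"
          "tropical.cell_vertex 0 n T k = split_cell n C"
        using split_triangle_compatible[OF A B C c] unfolding split_triangle_def by blast
      have ne: "A \<noteq> B" "A \<noteq> C" "B \<noteq> C" using c by (auto simp: compatible_def)
      have "good 2 T i j" "good 2 T j k"
        using good_edge[OF T(1,2,3) A B ne(1) v(1,2)] good_edge[OF T(1,3,4) B C ne(3) v(2,3)] ok by auto
      then have "good 2 T i k"
        by (rule good_trans[OF T(1,2,3,4)])
      then show ?thesis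
        using good_edge[OF T(1,2,4) A C ne(2) v(1,3)] by simp
    qed
    show "ok {1..<n - 1} A" if A: "A \<in> splits n" and AV: "A \<subset> {1..<n - 1}" for A
    proof -
      have AV: "A \<subset> V" "A \<noteq> V" using AV by (auto simp: V_def)
      have c: "compatible V A" using AV by (auto simp: compatible_def)
      have mA: "?m \<notin> A" using AV range(2) by blast
      note e = edge_cell_vertices[OF V A c]
      have "good 1 (edge_cell n V A) 0 1"
        using path_hom_const_left[OF seg[OF V A c]] e mA AV range(2)
        by (simp add: good_def Q_split[OF V] Q_split[OF A] P_def P1_def seg_def)
      then show ?thesis by (simp add: ok_def V_def)
    qed
    \<comment> \<open>Edges of the spanning tree satisfy the condition by construction:
      \<open>P A\<close> is the path to \<open>prev A\<close> followed by this edge.\<close>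
    have ok_prev: "ok (prev A) A" if A: "A \<in> splits n" "?m \<in> A" for A
    proof -
      note p = prev[OF A]
      note e = edge_cell_vertices[OF p(1) A(1) p(3)]
      have "good 1 (edge_cell n (prev A) A) 0 1"
        using P[OF A(1)] e A p
        by (simp add: good_def Q_split P_def seg_def path_hom_refl)
      then show ?thesis by (simp add: ok_def)
    qed
    show "ok (A - {n - 1}) A" if "A \<in> splits n" "n - 1 \<in> A" "card A \<noteq> 2" for A
      using ok_prev[OF that(1,2)] that(3) by (simp add: prev_def)
    show "ok ({1..<n - 1} - A) A" if "A \<in> splits n" "n - 1 \<in> A" "card A = 2" for A
      using ok_prev[OF that(1,2)] that(3) by (simp add: prev_def V_def)
  qed
  note ok = this
  interpret simply_connected_complex "cells 0 n" "pull_cell 0 n" "split_cell n V" Q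
  proof
    fix c assume c: "c \<in> cells 0 n 1"
    have v: "tropical.cell_vertex 0 n c 0 \<in> cells 0 n 0" "tropical.cell_vertex 0 n c 1 \<in> cells 0 n 0"
      by (intro tropical.cell_vertex_closed[OF c]; simp)+
    obtain A where A: "A \<in> splits n" "tropical.cell_vertex 0 n c 0 = split_cell n A"
      using n by (auto intro: vertex_split[OF v(1)])
    obtain B where B: "B \<in> splits n" "tropical.cell_vertex 0 n c 1 = split_cell n B"
      using n by (auto intro: vertex_split[OF v(2)])
    note u = edge_cell_unique[OF c A(1) B(1) A(2) B(2)]
    show "good 1 c 0 1"
      using ok[OF A(1) B(1) u(1)] u(2) by (simp add: ok_def)
  qed
  show ?thesis
    unfolding tropical_moduli_space_eq by (rule simply_connected_realization)
qed

theorem theorem1p4: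
  fixes g n :: nat
  assumes "2 * int g - 2 + int n > 0"
    and "3 * int g - 3 + int n > 0"
    and "(g, n) \<noteq> (0, 4)"
    and "(g, n) \<noteq> (0, 5)"
  shows "simply_connected_space (tropical_moduli_space g n)"
proof (cases "g = 0")
  case True
  \<comment> \<open>In genus 0 the second inequality means \<open>n \<ge> 4\<close>, and the
    excluded pairs remove 4 and 5.\<close>
  then have "n \<ge> 6"
    using assms by auto
  then show ?thesis
    using simply_connected_genus_0 True by simp
next
  case False
  then show ?thesis
    using simply_connected_positive_genus assms(1) by simp
qed

end
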